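(* As $x\to\infty$, the number of positive integers $n\le x$ for which $2$ is not the least primary factor of $M_n=(\mathbb Z/n\mathbb Z)^\times$ is \[ C_3 \frac{x}{(\log x)^{1/2}} + O \biggl( \frac x{(\log x)^{2/3}} \biggr), \] where \[ C_3 = \frac3{4\sqrt2} \prod_{p \equiv 3 \ (\mathrm{mod}\ 4)}\bigg(1 - \frac{1}{p^2}\bigg)^{1/2} \approx 0.490694, \] the product being over all primes $p\equiv 3 \pmod 4$.
   Context: $M_n=(\mathbb Z/n\mathbb Z)^\times$ is the multiplicative group modulo $n$. Every finite abelian group $G$ is isomorphic to a product $\mathbb Z_{q_1}\times\cdots\times\mathbb Z_{q_t}$ of cyclic groups of prime power orders $q_j>1$ (primary decomposition), unique up to order; the $q_j$ are the primary factors of $G$, and the least primary factor is the smallest $q_j$. The groups $M_1$ and $M_2$ are trivial and have no primary factor (how $n=1,2$ are treated does not affect the statement). *)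

theory Defs
  imports
    "HOL-Algebra.IntRing"
    "HOL-Algebra.Product_Groups"
    "HOL-Number_Theory.Number_Theory"
    "HOL-Analysis.Analysis"
    "HOL-Library.Landau_Symbols"
begin

text \<open>
  The quotient ring \<open>ZFact (int n)\<close> is the zero ring for \<open>n = 1\<close>, so its unit group is
  trivial as it should be; \<open>residue_ring 1\<close> is degenerate (its \<open>\<one>\<close> is not in its carrier).
\<close>

definition mult_group_mod :: "nat \<Rightarrow> int set monoid" where
  "mult_group_mod n = units_of (ZFact (int n))"

text \<open>
  The list \<open>qs\<close> is a primary decomposition of \<open>G\<close> if \<open>G\<close> is isomorphic to the direct
  product of the cyclic groups of orders \<open>qs ! j\<close>.  Members of \<open>primepow\<close> are
  \<open>p ^ k\<close> with \<open>k > 0\<close>, hence greater than \<open>1\<close>; the empty list decomposes the trivial group.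
\<close>

definition primary_decomposition :: "('a, 'b) monoid_scheme \<Rightarrow> nat list \<Rightarrow> bool" where
  "primary_decomposition G qs \<longleftrightarrow>
     (\<forall>q\<in>set qs. primepow q) \<and>
     G \<cong> product_group {..<length qs} (\<lambda>j. integer_mod_group (qs ! j))"

definition primary_factors :: "('a, 'b) monoid_scheme \<Rightarrow> nat set" where
  "primary_factors G = {q. \<exists>qs. primary_decomposition G qs \<and> q \<in> set qs}"

text \<open>
  A relation rather than a function: a trivial group has no primary factor, hence no least one.
\<close>

definition is_least_primary_factor :: "('a, 'b) monoid_scheme \<Rightarrow> nat \<Rightarrow> bool" where
  "is_least_primary_factor G q \<longleftrightarrow>
     q \<in> primary_factors G \<and> (\<forall>r\<in>primary_factors G. q \<le> r)"

definition C\<^sub>3 :: real where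
  "C\<^sub>3 = 3 / (4 * sqrt 2) *
     prodinf (\<lambda>p::nat. if Factorial_Ring.prime p \<and> [p = 3] (mod 4)
                       then (1 - 1 / (real p)\<^sup>2) powr (1 / 2) else 1)"

end

theory Submission
  imports
    Defs
    "HOL-Algebra.Sylow"
    "HOL-Algebra.Multiplicative_Group"
    "HOL-Complex_Analysis.Complex_Analysis"
    "HOL-Probability.Characteristic_Functions"
    "HOL-Probability.Sinc_Integral"
    "HOL-Real_Asymp.Real_Asymp"
begin

text \<open>
  The number 2 is a primary factor of a finite abelian group iff some \<open>a\<close> with \<open>a\<^sup>2 = 1\<close> is not a
  square.  For \<open>(\<int>/n\<int>)\<^sup>\<times>\<close> this happens iff \<open>4\<close> or a prime \<open>p \<equiv> 3 (mod 4)\<close> divides \<open>n\<close>: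
  then \<open>a = -1\<close> works, and otherwise an \<open>i\<close> with \<open>i\<^sup>2 = -1\<close> gives the square root
  \<open>((1 + a) + i (1 - a)) / 2\<close> of \<open>a\<close>.  So one counts the \<open>m\<close> and \<open>2 m\<close>, where all prime factors
  of \<open>m\<close> are \<open>1\<close> modulo \<open>4\<close>.

  Let \<open>F(s)\<close> be the Dirichlet series of these \<open>m\<close>.  Comparing Euler products,
  \<open>F(s)\<^sup>2 = \<zeta>(s) L(s, \<chi>) (1 - 2\<^sup>-\<^sup>s) \<Prod>(1 - p\<^sup>-\<^sup>2\<^sup>s)\<close> over \<open>p \<equiv> 3 (mod 4)\<close>, so \<open>F(s) = c (s - 1)\<^sup>-\<^sup>1\<^sup>/\<^sup>2 + \<dots>\<close>
  at \<open>s = 1\<close>.  The inequality \<open>3 + 4 cos t + cos 2t \<ge> 0\<close>, applied to \<open>F\<close> itself, bounds \<open>F\<close>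
  from below near the line \<open>Re s = 1\<close>, hence \<open>F' = (F\<^sup>2)' / (2 F)\<close> from above.  After subtraction of the
  transform of \<open>sqrt(log y)\<close>, a Perron integral for \<open>F'\<close> with kernel \<open>1 / (s (s + 1))\<close> converges absolutely
  up to the line, so that \<open>\<Sum> log m (x - m)\<close> is known up to \<open>O(x\<^sup>2)\<close>.  Differencing over \<open>x / (log x)\<^sup>1\<^sup>/\<^sup>4\<close> and
  dividing by \<open>log x\<close> gives the count with error \<open>O(x / (log x)\<^sup>3\<^sup>/\<^sup>4)\<close>.

  For the numerical value, \<open>\<Prod>(1 - p\<^sup>-\<^sup>2)\<^sup>2 = (8 G / \<pi>\<^sup>2) \<Prod>(1 - p\<^sup>-\<^sup>4)\<close> with Catalan's constant \<open>G = L(2, \<chi>)\<close>.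
\<close>

hide_const (open) Polynomial.order

section \<open>Primary decompositions of finite abelian groups\<close>

text \<open>The weight log m has a purpose. An integral along \<open>Re s = 1\<close> that is
  estimated by absolute values only gives O(x^2). The smoothed count itself has size x^2 / sqrt(log
  x) and would drown in that error; with the weight, the main term becomes x^2 sqrt(log x) and a
  factor sqrt(log x) is gained. The price is a singularity (s - 1)^(-3/2), not integrable on the
  line, hence the subtraction, which leaves |s - 1|^(-1/2).

  The obstacle is the division by F: what continues past the line is F^2 cleared of its pole, while
  F' needs F from below. A lower bound with polynomial loss in t suffices, as long as F' stays well
  below |t| against the kernel of size t^(-2). The exponents 9/8, 1/2 and 3/8 live on this budget.
  Since F has nonnegative coefficients, the trigonometric inequality for F handles zeta and L
  together.

  On the algebraic side, the criterion for the factor 2 is a property of the group alone, so it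
  gives the same answer for every decomposition; a decomposition must however be shown to
  exist.\<close>

lemma product_group_lessThan_append:
  fixes F F' :: "nat \<Rightarrow> ('a, 'b) monoid_scheme"
  shows "product_group {..<m} F \<times>\<times> product_group {..<n} F' \<cong> product_group {..<m + n} (\<lambda>i. if i < m then F i else F' (i - m))"
proof (rule is_isoI, rule isoI)
  let ?P = "product_group {..<m} F" and ?Q = "product_group {..<n} F'"
    and ?R = "product_group {..<m + n} (\<lambda>i. if i < m then F i else F' (i - m))"
  define \<phi> where "\<phi> = (\<lambda>(x :: nat \<Rightarrow> 'a, y :: nat \<Rightarrow> 'a). \<lambda>i\<in>{..<m + n}. if i < m then x i else y (i - m))"
  define \<psi> where "\<psi> z = (\<lambda>i\<in>{..<m}. z i, \<lambda>i\<in>{..<n}. z (m + i))" for z :: "nat \<Rightarrow> 'a"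
  show "\<phi> \<in> hom (?P \<times>\<times> ?Q) ?R"
    by (rule homI) (auto simp: \<phi>_def PiE_iff fun_eq_iff DirProd_def)
  show "bij_betw \<phi> (carrier (?P \<times>\<times> ?Q)) (carrier ?R)"
  proof (rule bij_betwI[where g = \<psi>])
    show "\<phi> \<in> carrier (?P \<times>\<times> ?Q) \<rightarrow> carrier ?R"
      by (auto simp: \<phi>_def DirProd_def PiE_iff)
    show "\<psi> \<in> carrier ?R \<rightarrow> carrier (?P \<times>\<times> ?Q)"
    proof
      fix z assume z: "z \<in> carrier ?R"
      have "z i \<in> carrier (F i)" if "i < m" for i
        using z that by (auto simp: PiE_iff dest!: bspec[of _ _ i])
      moreover have "z (m + i) \<in> carrier (F' i)" if "i < n" for i
        using z that by (auto simp: PiE_iff dest!: bspec[of _ _ "m + i"])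
      ultimately show "\<psi> z \<in> carrier (?P \<times>\<times> ?Q)" by (simp add: \<psi>_def DirProd_def)
    qed
    show "\<psi> (\<phi> x) = x" if "x \<in> carrier (?P \<times>\<times> ?Q)" for x
      using that by (auto simp: \<phi>_def \<psi>_def DirProd_def PiE_iff extensional_def fun_eq_iff)
    show "\<phi> (\<psi> y) = y" if "y \<in> carrier ?R" for y
      using that by (auto simp: \<phi>_def \<psi>_def PiE_iff extensional_def fun_eq_iff)
  qed
qed

lemma primary_decomposition_DirProd:
  assumes "Group.group G" "primary_decomposition G ps" "primary_decomposition H qs"
  shows "primary_decomposition (G \<times>\<times> H) (ps @ qs)"
proof -
  let ?F = "\<lambda>qs j. integer_mod_group (qs ! j)"
  have "G \<times>\<times> H \<cong> product_group {..<length ps} (?F ps) \<times>\<times> product_group {..<length qs} (?F qs)"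
    using assms by (intro group.DirProd_iso_trans) (auto simp: primary_decomposition_def)
  also have "\<dots> \<cong> product_group {..<length ps + length qs} (\<lambda>i. if i < length ps then ?F ps i else ?F qs (i - length ps))"
    by (rule product_group_lessThan_append)
  also have "(\<lambda>i. if i < length ps then ?F ps i else ?F qs (i - length ps)) = ?F (ps @ qs)"
    by (auto simp: nth_append)
  finally show ?thesis using assms by (auto simp: primary_decomposition_def)
qed

lemma primary_decomposition_iso:
  assumes "G \<cong> H" "primary_decomposition H qs"
  shows "primary_decomposition G qs"
  using assms iso_trans by (auto simp: primary_decomposition_def)

lemma primary_decomposition_single:
  fixes q :: nat and G :: "('a, 'b) monoid_scheme"
  assumes "primepow q" "G \<cong> integer_mod_group q"
  shows "primary_decomposition G ([q])"
proof -
  have "integer_mod_group q \<cong> product_group {..<1} (\<lambda>j. integer_mod_group ([q] ! j))"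
  proof (rule is_isoI, rule isoI)
    let ?h = "\<lambda>x::int. \<lambda>i\<in>{..<1::nat}. x"
    show "?h \<in> hom (integer_mod_group q) (product_group {..<1} (\<lambda>j. integer_mod_group ([q] ! j)))"
      by (rule homI) (auto simp: fun_eq_iff)
    show "bij_betw ?h (carrier (integer_mod_group q)) (carrier (product_group {..<1} (\<lambda>j. integer_mod_group ([q] ! j))))"
      by (rule bij_betwI[where g = "\<lambda>f. f 0"]) (auto simp: PiE_iff extensional_def fun_eq_iff)
  qed
  then show ?thesis using assms iso_trans[of G "integer_mod_group q"] by (simp add: primary_decomposition_def)
qed

lemma primary_decomposition_trivial:
  assumes "Group.group G" "carrier G = {\<one>\<^bsub>G\<^esub>}"
  shows "primary_decomposition G []"
proof -
  interpret group G by fact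
  have "G \<cong> product_group {..<0::nat} (\<lambda>j. integer_mod_group ([] ! j))"
  proof (rule is_isoI, rule isoI)
    let ?h = "\<lambda>x. \<lambda>i\<in>{..<0::nat}. (0 :: int)"
    show "?h \<in> hom G (product_group {..<0} (\<lambda>j. integer_mod_group ([] ! j)))"
      by (rule homI) (auto simp: fun_eq_iff)
    show "bij_betw ?h (carrier G) (carrier (product_group {..<0} (\<lambda>j. integer_mod_group ([] ! j))))"
      unfolding assms(2) by (auto simp: bij_betw_def restrict_def)
  qed
  then show ?thesis by (simp add: primary_decomposition_def)
qed

context comm_group
begin

lemma subgroup_comm_group:
  assumes "subgroup H G"
  shows "comm_group (G\<lparr>carrier := H\<rparr>)"
proof (rule group.group_comm_groupI)
  show "Group.group (G\<lparr>carrier := H\<rparr>)" by (rule subgroup_imp_group[OF assms])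
  show "x \<otimes>\<^bsub>G\<lparr>carrier := H\<rparr>\<^esub> y = y \<otimes>\<^bsub>G\<lparr>carrier := H\<rparr>\<^esub> x"
    if "x \<in> carrier (G\<lparr>carrier := H\<rparr>)" "y \<in> carrier (G\<lparr>carrier := H\<rparr>)" for x y
    using that subgroup.mem_carrier[OF assms] by (simp add: m_comm)
qed

lemma internal_direct_product:
  assumes H: "subgroup H G" and K: "subgroup K G" and HK: "H \<inter> K = {\<one>}" and gen: "carrier G \<subseteq> H <#> K"
  shows "G \<cong> G\<lparr>carrier := H\<rparr> \<times>\<times> G\<lparr>carrier := K\<rparr>"
proof -
  have HG: "x \<in> carrier G" if "x \<in> H" for x using subgroup.mem_carrier[OF H that] .
  have KG: "x \<in> carrier G" if "x \<in> K" for x using subgroup.mem_carrier[OF K that] .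
  let ?f = "\<lambda>(x, y). x \<otimes> y"
  have "?f \<in> iso (G\<lparr>carrier := H\<rparr> \<times>\<times> G\<lparr>carrier := K\<rparr>) G"
  proof (rule isoI)
    show "?f \<in> hom (G\<lparr>carrier := H\<rparr> \<times>\<times> G\<lparr>carrier := K\<rparr>) G"
      by (rule homI) (auto simp: DirProd_def HG KG m_ac)
    show "bij_betw ?f (carrier (G\<lparr>carrier := H\<rparr> \<times>\<times> G\<lparr>carrier := K\<rparr>)) (carrier G)"
      unfolding bij_betw_def
    proof
      show "inj_on ?f (carrier (G\<lparr>carrier := H\<rparr> \<times>\<times> G\<lparr>carrier := K\<rparr>))"
      proof (rule inj_onI, clarsimp simp: DirProd_def)
        fix a b c d assume m: "a \<in> H" "b \<in> K" "c \<in> H" "d \<in> K" and e: "a \<otimes> b = c \<otimes> d"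
        have * [simp]: "a \<in> carrier G" "b \<in> carrier G" "c \<in> carrier G" "d \<in> carrier G" using m HG KG by auto
        have "inv c \<otimes> a = d \<otimes> inv b"
        proof -
          have "inv c \<otimes> a = inv c \<otimes> (a \<otimes> b) \<otimes> inv b"
            by (simp add: m_assoc)
          also have "\<dots> = inv c \<otimes> (c \<otimes> d) \<otimes> inv b" by (simp only: e)
          also have "inv c \<otimes> (c \<otimes> d) = d" by (simp add: m_assoc[symmetric])
          finally show ?thesis .
        qed
        moreover have "inv c \<otimes> a \<in> H" "d \<otimes> inv b \<in> K"
          using m by (auto intro!: subgroup.m_closed[OF H] subgroup.m_closed[OF K] subgroup.m_inv_closed[OF H] subgroup.m_inv_closed[OF K])
        ultimately have "inv c \<otimes> a = \<one>" "d \<otimes> inv b = \<one>" using HK by auto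
        moreover have "a = c \<otimes> (inv c \<otimes> a)" "d = (d \<otimes> inv b) \<otimes> b"
          by (simp add: m_assoc[symmetric], simp add: m_assoc)
        ultimately show "a = c \<and> b = d" by simp
      qed
      show "?f ` carrier (G\<lparr>carrier := H\<rparr> \<times>\<times> G\<lparr>carrier := K\<rparr>) = carrier G"
        using gen HG KG by (force simp: DirProd_def set_mult_def)
    qed
  qed
  then have "G\<lparr>carrier := H\<rparr> \<times>\<times> G\<lparr>carrier := K\<rparr> \<cong> G" by (rule is_isoI)
  then show ?thesis
    by (rule group.iso_sym[OF DirProd_group[OF subgroup_imp_group[OF H] subgroup_imp_group[OF K]]])
qed

lemma generate_iso_integer_mod_group:
  assumes g: "g \<in> carrier G" and q: "ord g > 0"
  shows "G\<lparr>carrier := generate G {g}\<rparr> \<cong> integer_mod_group (ord g)"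
proof -
  let ?q = "ord g"
  have gen: "generate G {g} = {g [^] (k::int) | k. k \<in> UNIV}" by (rule generate_pow[OF g])
  have md: "g [^] (k mod int ?q) = g [^] k" for k :: int
    by (subst int_pow_eq[OF g]) (auto simp: mod_eq_dvd_iff[symmetric])
  have "(\<lambda>k. g [^] (k::int)) \<in> iso (integer_mod_group ?q) (G\<lparr>carrier := generate G {g}\<rparr>)"
  proof (rule isoI)
    show "(\<lambda>k. g [^] (k::int)) \<in> hom (integer_mod_group ?q) (G\<lparr>carrier := generate G {g}\<rparr>)"
      using g by (intro homI) (auto simp: gen md int_pow_mult)
    show "bij_betw (\<lambda>k. g [^] (k::int)) (carrier (integer_mod_group ?q)) (carrier (G\<lparr>carrier := generate G {g}\<rparr>))"
      unfolding bij_betw_def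
    proof
      show "inj_on (\<lambda>k. g [^] (k::int)) (carrier (integer_mod_group ?q))"
      proof (rule inj_onI)
        fix x y assume xy: "x \<in> carrier (integer_mod_group ?q)" "y \<in> carrier (integer_mod_group ?q)" "g [^] x = g [^] y"
        then have "x mod int ?q = y mod int ?q" by (simp add: int_pow_eq[OF g] mod_eq_dvd_iff dvd_diff_commute)
        then show "x = y" using xy q by (simp add: carrier_integer_mod_group)
      qed
      show "(\<lambda>k. g [^] (k::int)) ` carrier (integer_mod_group ?q) = carrier (G\<lparr>carrier := generate G {g}\<rparr>)"
      proof
        show "carrier (G\<lparr>carrier := generate G {g}\<rparr>) \<subseteq> (\<lambda>k. g [^] (k::int)) ` carrier (integer_mod_group ?q)"
        proof
          fix x assume "x \<in> carrier (G\<lparr>carrier := generate G {g}\<rparr>)"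
          then obtain k :: int where "x = g [^] k" by (auto simp: gen)
          then have "x = g [^] (k mod int ?q)" by (simp add: md)
          then show "x \<in> (\<lambda>k. g [^] (k::int)) ` carrier (integer_mod_group ?q)"
            by (rule image_eqI) (use q in \<open>simp add: carrier_integer_mod_group\<close>)
        qed
      qed (auto simp: gen)
    qed
  qed
  then have "integer_mod_group ?q \<cong> G\<lparr>carrier := generate G {g}\<rparr>" by (rule is_isoI)
  then show ?thesis by (rule group.iso_sym[OF group_integer_mod_group])
qed

lemma subgroup_torsion: "subgroup {x \<in> carrier G. x [^] (a::nat) = \<one>} G"
  by (rule subgroupI) (auto simp: nat_pow_distrib nat_pow_inv intro!: exI[of _ \<one>])

text \<open>Bezout: with u a + v b = 1, y is the product of (y^a)^u and (y^b)^v. For trivial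
  \<open>P\<close> it says that coprime torsion subgroups meet trivially; for general
  \<open>P\<close> it finishes the complement argument below.\<close>

lemma mem_subgroup_of_coprime_powers:
  assumes P: "subgroup P G" and y: "y \<in> carrier G" and "y [^] (a::nat) \<in> P" "y [^] (b::nat) \<in> P" "coprime a b"
  shows "y \<in> P"
proof -
  obtain u v :: int where uv: "u * int a + v * int b = 1"
  proof -
    have g: "gcd (int a) (int b) = 1"
      by (rule coprime_imp_gcd_eq_1) (use assms(5) in simp)
    show ?thesis using bezout_int[of "int a" "int b"] that unfolding g by blast
  qed
  have "y = y [^] (int a * u + int b * v)" using uv y by (simp add: mult.commute)
  also have "\<dots> = (y [^] a) [^] u \<otimes> (y [^] b) [^] v"
    using y by (simp only: int_pow_mult int_pow_pow[symmetric] int_pow_int)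
  also have "\<dots> \<in> P" using assms by (intro subgroup.m_closed[OF P] subgroup_int_pow_closed[OF P])
  finally show ?thesis .
qed

text \<open>With u a + v b = 1, write x = x^(v b) x^(u a). The first factor is killed by a and the
  second by b, because a b is the group order and kills everything.\<close>

lemma coprime_torsion_splitting:
  assumes "order G = a * b" "coprime a b" "finite (carrier G)"
  defines "H \<equiv> {x \<in> carrier G. x [^] a = \<one>}" and "K \<equiv> {x \<in> carrier G. x [^] b = \<one>}"
  shows "H \<inter> K = {\<one>}" "carrier G \<subseteq> H <#> K"
proof -
  show "H \<inter> K = {\<one>}"
  proof -
    have "x = \<one>" if "x \<in> H \<inter> K" for x
      using mem_subgroup_of_coprime_powers[OF triv_subgroup, of x a b] that assms by auto
    moreover have "\<one> \<in> H \<inter> K" by (simp add: H_def K_def)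
    ultimately show ?thesis by blast
  qed
  show "carrier G \<subseteq> H <#> K"
  proof
    fix x assume x: "x \<in> carrier G"
    obtain u v :: int where uv: "u * int a + v * int b = 1"
    proof -
    have g: "gcd (int a) (int b) = 1"
      by (rule coprime_imp_gcd_eq_1) (use assms(2) in simp)
    show ?thesis using bezout_int[of "int a" "int b"] that unfolding g by blast
  qed
    have o: "x [^] (int (a * b)) = \<one>"
      using pow_order_eq_1[OF x] assms(1) by (simp only: int_pow_int)
    have pw: "(x [^] (i * int c)) [^] d = \<one>" if "c * d = a * b" for i :: int and c d :: nat
    proof -
      have "(x [^] (i * int c)) [^] d = x [^] (int (a * b) * i)"
        using x that[symmetric] by (simp flip: int_pow_int add: int_pow_pow mult_ac)
      also have "\<dots> = (x [^] (int (a * b))) [^] i" using x by (simp only: int_pow_pow)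
      finally show ?thesis by (simp only: o int_pow_one)
    qed
    have "x [^] (v * int b) \<in> H" "x [^] (u * int a) \<in> K"
      using x pw[of b a v] pw[of a b u] by (auto simp: H_def K_def mult.commute)
    moreover have "x = x [^] (v * int b) \<otimes> x [^] (u * int a)"
      using x uv by (simp add: int_pow_mult[symmetric] add.commute)
    ultimately show "x \<in> H <#> K" unfolding set_mult_def by blast
  qed
qed

text \<open>The complement is a maximal subgroup meeting the cyclic group trivially.\<close>

lemma cyclic_complement:
  assumes fin: "finite (carrier G)" and p: "prime p" and o: "order G = p ^ n"
    and g: "g \<in> carrier G" and max: "\<And>x. x \<in> carrier G \<Longrightarrow> ord x \<le> ord g"
  shows "\<exists>H. subgroup H G \<and> generate G {g} \<inter> H = {\<one>} \<and> carrier G \<subseteq> generate G {g} <#> H"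
proof -
  define C where "C = generate G {g}"
  have C: "subgroup C G" unfolding C_def using g by (intro generate_is_subgroup) simp
  have ordp: "\<exists>i\<le>n. ord x = p ^ i" if "x \<in> carrier G" for x
    using ord_dvd_group_order[OF that] divides_primepow_nat[OF p] o by auto
  obtain j where j: "ord g = p ^ j" using ordp[OF g] by auto
  have expo: "x [^] (p ^ j) = \<one>" if x: "x \<in> carrier G" for x
  proof -
    obtain i where i: "ord x = p ^ i" using ordp[OF x] by auto
    then have "p ^ i \<le> p ^ j" using max[OF x] j by simp
    then have "i \<le> j" by (rule power_le_imp_le_exp[OF prime_gt_1_nat[OF p]])
    then show ?thesis using i x by (simp add: pow_eq_id le_imp_power_dvd)
  qed
  define F where "F = {H. subgroup H G \<and> C \<inter> H = {\<one>}}"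
  have "finite F" using fin by (intro finite_subset[of F "Pow (carrier G)"]) (auto simp: F_def dest: subgroup.subset)
  moreover have "{\<one>} \<in> F" using triv_subgroup subgroup.one_closed[OF C] by (auto simp: F_def)
  ultimately obtain H where HF: "H \<in> F" and Hmax: "\<And>H'. H' \<in> F \<Longrightarrow> H \<subseteq> H' \<Longrightarrow> H' = H"
    using finite_has_maximal[of F] by (metis empty_iff)
  have H: "subgroup H G" and CH: "C \<inter> H = {\<one>}" using HF by (auto simp: F_def)
  define P where "P = C <#> H"
  have P: "subgroup P G" unfolding P_def by (rule mult_subgroups[OF C H])
  have CP: "C \<subseteq> P" "H \<subseteq> P"
    unfolding P_def set_mult_def using subgroup.one_closed[OF C] subgroup.one_closed[OF H]
      subgroup.mem_carrier[OF C] subgroup.mem_carrier[OF H] by force+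
  have "carrier G \<subseteq> P"
  proof (rule ccontr)
    assume "\<not> carrier G \<subseteq> P"
    then obtain x0 where x0: "x0 \<in> carrier G" "x0 \<notin> P" by auto
    have "x0 [^] (p ^ j) \<in> P" using expo[OF x0(1)] subgroup.one_closed[OF P] by simp
    moreover have "x0 [^] (p ^ 0) \<notin> P" using x0 by simp
    ultimately obtain i where i: "x0 [^] (p ^ i) \<notin> P" "x0 [^] (p ^ Suc i) \<in> P"
    proof -
      have "\<exists>i. x0 [^] (p ^ i) \<notin> P \<and> x0 [^] (p ^ Suc i) \<in> P"
      proof (rule ccontr)
        assume "\<not> ?thesis"
        then have "x0 [^] (p ^ i) \<notin> P" for i
          by (induction i) (use \<open>x0 [^] (p ^ 0) \<notin> P\<close> in auto)
        then show False using \<open>x0 [^] (p ^ j) \<in> P\<close> by blast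
      qed
      then show ?thesis using that by blast
    qed
    define x where "x = x0 [^] (p ^ i)"
    have x: "x \<in> carrier G" "x \<notin> P" using x0 i by (auto simp: x_def)
    have xp: "x [^] p \<in> P" using i x0 by (simp add: x_def nat_pow_pow mult.commute)
    then obtain c h where ch: "c \<in> C" "h \<in> H" "x [^] p = c \<otimes> h" unfolding P_def set_mult_def by blast
    then obtain s :: int where s: "c = g [^] s" unfolding C_def generate_pow[OF g] by blast
    have hG: "h \<in> carrier G" and cG: "c \<in> carrier G" using ch subgroup.mem_carrier[OF H] subgroup.mem_carrier[OF C] by auto
    have j0: "j > 0"
    proof (rule ccontr)
      assume "\<not> j > 0"
      then have "x = \<one>" using expo[OF x(1)] x(1) by simp
      then show False using x subgroup.one_closed[OF P] by simp
    qed
    \<comment> \<open>Here x lies outside \<open>P\<close> but x^p = c h lies in it. Raising to the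
      power p^(j-1) kills the left side, as all orders divide p^j, so a power of c equals a power of
      h and lies in the trivial intersection. Since g has order exactly p^j, the exponent s of c =
      g^s is then divisible by p.\<close>
    have "\<one> = (x [^] p) [^] (p ^ (j - 1))"
    proof -
      have "p * p ^ (j - 1) = p ^ j" using j0 by (cases j) auto
      then show ?thesis using expo[OF x(1)] x(1) by (simp add: nat_pow_pow)
    qed
    also have "\<dots> = c [^] (p ^ (j - 1)) \<otimes> h [^] (p ^ (j - 1))"
      unfolding ch(3) using cG hG by (rule nat_pow_distrib)
    finally have ceq: "c [^] (p ^ (j - 1)) = inv (h [^] (p ^ (j - 1)))"
      using cG hG by (intro inv_equality[symmetric]) auto
    moreover have "c [^] (p ^ (j - 1)) \<in> C" "inv (h [^] (p ^ (j - 1))) \<in> H"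
      using subgroup_int_pow_closed[OF C ch(1), of "int (p ^ (j - 1))"] subgroup_int_pow_closed[OF H ch(2), of "int (p ^ (j - 1))"]
      by (auto simp only: int_pow_int intro!: subgroup.m_inv_closed[OF H])
    ultimately have "c [^] (p ^ (j - 1)) = \<one>" using CH by auto
    then have "g [^] (s * int (p ^ (j - 1))) = \<one>"
      unfolding s using g by (simp only: int_pow_pow[symmetric] int_pow_int)
    then have "int (p ^ j) dvd s * int (p ^ (j - 1))"
      using int_pow_eq_id[OF g] j by simp
    then have "int p * int (p ^ (j - 1)) dvd s * int (p ^ (j - 1))"
      using j0 by (cases j) auto
    then have "int p dvd s" using prime_gt_0_nat[OF p] by simp
    then obtain s' where s': "s = int p * s'" by auto
    \<comment> \<open>Dividing x by a p-th root of c removes the part in \<open>C\<close>: y is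
      still outside \<open>P\<close>, but y^p = h lies in \<open>H\<close>.\<close>
    define y where "y = x \<otimes> inv (g [^] s')"
    have y: "y \<in> carrier G" using x g by (simp add: y_def)
    have gs': "g [^] s' \<in> P" using CP(1) unfolding C_def generate_pow[OF g] by blast
    have yP: "y \<notin> P"
    proof
      assume "y \<in> P"
      then have "y \<otimes> g [^] s' \<in> P" using gs' by (rule subgroup.m_closed[OF P])
      moreover have "y \<otimes> g [^] s' = x" using x g by (simp add: y_def m_assoc)
      ultimately show False using x by simp
    qed
    have yp: "y [^] p = h"
    proof -
      have "(g [^] s') [^] p = c"
        using g unfolding s s' by (simp add: int_pow_pow mult.commute flip: int_pow_int)
      then have "y [^] p = x [^] p \<otimes> inv c"
        using x g by (simp add: y_def nat_pow_distrib nat_pow_inv)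
      also have "\<dots> = h" unfolding ch(3) using cG hG by (simp add: m_comm[of c h] m_assoc)
      finally show ?thesis .
    qed
    \<comment> \<open>Enlarging \<open>H\<close> by y contradicts maximality, so some z = y^r k
      different from the identity lies in \<open>C\<close>, with k in \<open>H\<close>. If p divides
      r, then y^r is in \<open>H\<close> and so is z; otherwise y^r and y^p both lie in
      \<open>P\<close>, which forces y into \<open>P\<close>.\<close>
    define H' where "H' = generate G {y} <#> H"
    have sY: "subgroup (generate G {y}) G" using y by (intro generate_is_subgroup) simp
    have sH': "subgroup H' G" unfolding H'_def by (rule mult_subgroups[OF sY H])
    have HH': "H \<subseteq> H'" unfolding H'_def set_mult_def
      using subgroup.one_closed[OF sY] subgroup.mem_carrier[OF H] by force
    have "y \<in> H'" unfolding H'_def set_mult_def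
      using subgroup.one_closed[OF H] y generate.incl[of y "{y}" G] by force
    then have "H' \<noteq> H" using yP CP(2) by auto
    then have "H' \<notin> F" using Hmax[OF _ HH'] by auto
    then have "C \<inter> H' \<noteq> {\<one>}" using sH' by (auto simp: F_def)
    then obtain z where z: "z \<in> C" "z \<in> H'" "z \<noteq> \<one>"
      using subgroup.one_closed[OF C] subgroup.one_closed[OF sH'] by auto
    obtain w k where wk: "w \<in> generate G {y}" "k \<in> H" "z = w \<otimes> k"
      using z(2) unfolding H'_def set_mult_def by blast
    have yfin: "ord y \<noteq> 0" using ordp[OF y] prime_gt_0_nat[OF p] by auto
    obtain r :: nat where r: "w = y [^] r" using wk(1) generate_pow_nat[OF y yfin] by auto
    have kG: "k \<in> carrier G" using wk(2) subgroup.mem_carrier[OF H] by auto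
    show False
    proof (cases "p dvd r")
      case True
      then obtain r' where "r = p * r'" by auto
      then have "w = h [^] r'" using r y yp by (simp add: nat_pow_pow[symmetric])
      then have "w \<in> H" using subgroup_int_pow_closed[OF H ch(2), of "int r'"] by (simp only: int_pow_int)
      then have "z \<in> H" using wk by (simp add: subgroup.m_closed[OF H])
      then show False using z CH by auto
    next
      case False
      then have cop: "coprime r p" using p by (metis coprime_commute prime_imp_coprime)
      have "w = z \<otimes> inv k" using wk(3) kG y r by (simp add: m_assoc)
      moreover have "z \<in> P" "inv k \<in> P" using z(1) wk(2) CP subgroup.m_inv_closed[OF H] by auto
      ultimately have "y [^] r \<in> P" using r by (simp add: subgroup.m_closed[OF P])
      moreover have "y [^] p \<in> P" using yp ch(2) CP(2) by auto
      ultimately have "y \<in> P" using mem_subgroup_of_coprime_powers[OF P y _ _ cop] by blast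
      then show False using yP by simp
    qed
  qed
  then show ?thesis using H CH unfolding C_def P_def by blast
qed

end

text \<open>Induction on the order. If two primes divide it, the group splits into torsion subgroups
  of coprime exponents; in a p-group an element of maximal order generates a direct factor, which is
  itself an admissible cyclic factor.\<close>

theorem primary_decomposition_exists:
  fixes G :: "('a, 'b) monoid_scheme"
  assumes "comm_group G" "finite (carrier G)"
  shows "\<exists>qs. primary_decomposition G qs"
  using assms
proof (induction "order G" arbitrary: G rule: less_induct)
  case less
  interpret comm_group G by fact
  note fin = less.prems(2)
  have split: "\<exists>qs. primary_decomposition G qs"
    if H: "subgroup H G" and K: "subgroup K G" and HK: "H \<inter> K = {\<one>\<^bsub>G\<^esub>}" "carrier G \<subseteq> H <#>\<^bsub>G\<^esub> K"
      and dH: "\<exists>qs. primary_decomposition (G\<lparr>carrier := H\<rparr>) qs"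
      and dK: "\<exists>qs. primary_decomposition (G\<lparr>carrier := K\<rparr>) qs" for H K
    using primary_decomposition_iso[OF internal_direct_product[OF H K HK]]
      primary_decomposition_DirProd[OF subgroup_imp_group[OF H]] dH dK by blast
  have proper: "\<exists>qs. primary_decomposition (G\<lparr>carrier := H\<rparr>) qs" if H: "subgroup H G" and "H \<noteq> carrier G" for H
  proof (rule less.hyps)
    have "H \<subset> carrier G" using that subgroup.subset[OF H] by auto
    then show "order (G\<lparr>carrier := H\<rparr>) < order G" using fin by (simp add: Coset.order_def psubset_card_mono)
    show "comm_group (G\<lparr>carrier := H\<rparr>)" by (rule subgroup_comm_group[OF H])
    show "finite (carrier (G\<lparr>carrier := H\<rparr>))" using fin subgroup.subset[OF H] by (auto intro: finite_subset)
  qed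
  have o0: "order G > 0" using fin order_gt_0_iff_finite by simp
  show ?case
  proof (cases "order G = 1")
    case True
    then obtain x where "carrier G = {x}" by (auto simp: Coset.order_def card_1_singleton_iff)
    then have "carrier G = {\<one>\<^bsub>G\<^esub>}" using one_closed by simp
    then show ?thesis using primary_decomposition_trivial[OF group_axioms] by blast
  next
    case False
    then obtain p where p: "prime p" "p dvd order G" using prime_factor_nat by blast
    obtain m where m: "order G = p ^ multiplicity p (order G) * m" "\<not> p dvd m"
      using multiplicity_decompose'[of "order G" p] o0 p by (metis less_numeral_extra(3) not_prime_unit)
    define k where "k = multiplicity p (order G)"
    have ok: "order G = p ^ k * m" using m(1) by (simp add: k_def)
    have k0: "k > 0" using m p by (cases k) (auto simp: k_def)
    show ?thesis
    proof (cases "m = 1")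
      case False
      define H where "H = {x \<in> carrier G. x [^]\<^bsub>G\<^esub> (p ^ k) = \<one>\<^bsub>G\<^esub>}"
      define K where "K = {x \<in> carrier G. x [^]\<^bsub>G\<^esub> m = \<one>\<^bsub>G\<^esub>}"
      have cop: "coprime (p ^ k) m" using m(2) p(1) by (simp add: prime_imp_coprime)
      have sub: "subgroup H G" "subgroup K G" unfolding H_def K_def by (rule subgroup_torsion)+
      \<comment> \<open>\<open>sylow_thm\<close> with exponent 1 is Cauchy's theorem. Its subgroup
        of order r would be killed by r and by the coprime number a, hence be trivial. This makes
        both torsion subgroups proper, so that the induction hypothesis applies.\<close>
      have not_all: "{x \<in> carrier G. x [^]\<^bsub>G\<^esub> a = \<one>\<^bsub>G\<^esub>} \<noteq> carrier G"
        if r: "prime r" "r dvd order G" "coprime a r" for a r :: nat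
      proof
        assume all: "{x \<in> carrier G. x [^]\<^bsub>G\<^esub> a = \<one>\<^bsub>G\<^esub>} = carrier G"
        obtain m' where "order G = r ^ 1 * m'" using r(2) by auto
        then obtain S where S: "subgroup S G" "card S = r ^ 1"
          using sylow_thm[OF r(1) group_axioms _ fin] by blast
        have "S \<subseteq> {\<one>\<^bsub>G\<^esub>}"
        proof
          fix x assume x: "x \<in> S"
          then have xG: "x \<in> carrier G" using subgroup.mem_carrier[OF S(1)] by auto
          interpret S: group "G\<lparr>carrier := S\<rparr>" by (rule subgroup_imp_group[OF S(1)])
          have "x [^]\<^bsub>G\<lparr>carrier := S\<rparr>\<^esub> r = \<one>\<^bsub>G\<lparr>carrier := S\<rparr>\<^esub>"
            using S.pow_order_eq_1[of x] x S(2) by (simp add: Coset.order_def)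
          then have "x [^]\<^bsub>G\<^esub> r = \<one>\<^bsub>G\<^esub>" using nat_pow_consistent[of x r S] by simp
          moreover have "x [^]\<^bsub>G\<^esub> a = \<one>\<^bsub>G\<^esub>" using all xG by blast
          ultimately show "x \<in> {\<one>\<^bsub>G\<^esub>}"
            using mem_subgroup_of_coprime_powers[OF triv_subgroup xG, of a r] r(3) by simp
        qed
        then have "card S \<le> 1" using card_mono[of "{\<one>\<^bsub>G\<^esub>}" S] by simp
        then show False using S(2) prime_gt_1_nat[OF r(1)] by simp
      qed
      obtain r where r: "prime r" "r dvd m" using False prime_factor_nat by blast
      have "coprime (p ^ k) r" using cop r(2) by (meson coprime_divisors dvd_refl)
      then have "H \<noteq> carrier G" unfolding H_def using r ok by (intro not_all[of r]) auto
      moreover have "coprime m p" using m(2) p(1) by (metis coprime_commute prime_imp_coprime)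
      then have "K \<noteq> carrier G" unfolding K_def using p by (intro not_all[of p]) auto
      ultimately show ?thesis
        using split[OF sub] coprime_torsion_splitting[OF ok cop fin] proper sub unfolding H_def K_def by blast
    next
      case True
      then have op: "order G = p ^ k" using ok by simp
      have "finite (ord ` carrier G)" "ord ` carrier G \<noteq> {}" using fin one_closed by auto
      then have "Max (ord ` carrier G) \<in> ord ` carrier G" by (rule Max_in)
      then obtain g where g: "g \<in> carrier G" "ord g = Max (ord ` carrier G)" by (metis imageE)
      have max: "ord x \<le> ord g" if "x \<in> carrier G" for x
        unfolding g(2) using fin that by (intro Max_ge) auto
      obtain H where H: "subgroup H G" "generate G {g} \<inter> H = {\<one>\<^bsub>G\<^esub>}" "carrier G \<subseteq> generate G {g} <#>\<^bsub>G\<^esub> H"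
        using cyclic_complement[OF fin p(1) op g(1) max] by blast
      have C: "subgroup (generate G {g}) G" using g by (intro generate_is_subgroup) simp
      have "ord g > 1"
      proof -
        obtain x where x: "x \<in> carrier G" "x \<noteq> \<one>\<^bsub>G\<^esub>"
        proof -
          have "carrier G \<noteq> {\<one>\<^bsub>G\<^esub>}" using \<open>order G \<noteq> 1\<close> by (auto simp: Coset.order_def)
          then show ?thesis using that one_closed by blast
        qed
        then have "ord x \<noteq> 1" "ord x \<noteq> 0"
          using ord_eq_1 ord_dvd_group_order[OF x(1)] o0 by auto
        then show ?thesis using max[OF x(1)] by simp
      qed
      moreover obtain i where i: "ord g = p ^ i"
        using ord_dvd_group_order[OF g(1)] divides_primepow_nat[OF p(1)] op by auto
      ultimately have "i > 0" by (cases i) auto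
      then have "primepow (ord g)" using p(1) i unfolding primepow_def by blast
      then have "primary_decomposition (G\<lparr>carrier := generate G {g}\<rparr>) [ord g]"
        using generate_iso_integer_mod_group[OF g(1)] \<open>ord g > 1\<close> by (intro primary_decomposition_single) auto
      moreover have "H \<noteq> carrier G"
      proof
        assume "H = carrier G"
        then have "g \<in> generate G {g} \<inter> H" using g generate.incl[of g "{g}" G] by simp
        then have "g = \<one>\<^bsub>G\<^esub>" using H(2) by simp
        then show False using \<open>ord g > 1\<close> by simp
      qed
      ultimately show ?thesis using split[OF C H(1) H(2) H(3)] proper[OF H(1)] by blast
    qed
  qed
qed

section \<open>The factor 2 in the multiplicative group modulo n\<close>

text \<open>The identity is a square, so a witness has order exactly 2. The property is invariant
  under isomorphism and can therefore be tested both on a product of cyclic groups and on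
  residues.\<close>

definition nonsquare_involution :: "('a, 'b) monoid_scheme \<Rightarrow> bool" where
  "nonsquare_involution G \<longleftrightarrow> (\<exists>a\<in>carrier G. a \<otimes>\<^bsub>G\<^esub> a = \<one>\<^bsub>G\<^esub> \<and> (\<forall>b\<in>carrier G. b \<otimes>\<^bsub>G\<^esub> b \<noteq> a))"

lemma nonsquare_involution_iso:
  assumes "Group.group G" "Group.group H" "G \<cong> H" "nonsquare_involution G"
  shows "nonsquare_involution H"
proof -
  obtain h where h: "h \<in> iso G H" using assms(3) by (auto simp: is_iso_def)
  then have hom: "h \<in> hom G H" and bij: "bij_betw h (carrier G) (carrier H)" by (auto simp: iso_def)
  interpret group_hom G H h using assms(1,2) hom by (simp add: group_hom_def group_hom_axioms_def)
  obtain a where a: "a \<in> carrier G" "a \<otimes>\<^bsub>G\<^esub> a = \<one>\<^bsub>G\<^esub>" "\<And>b. b \<in> carrier G \<Longrightarrow> b \<otimes>\<^bsub>G\<^esub> b \<noteq> a"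
    using assms(4) by (auto simp: nonsquare_involution_def)
  show ?thesis unfolding nonsquare_involution_def
  proof (intro bexI conjI ballI)
    show "h a \<otimes>\<^bsub>H\<^esub> h a = \<one>\<^bsub>H\<^esub>" using a by (metis hom_mult hom_one)
    show "h a \<in> carrier H" using a by simp
    fix c assume "c \<in> carrier H"
    then obtain b where b: "b \<in> carrier G" "c = h b" using bij by (auto simp: bij_betw_def)
    show "c \<otimes>\<^bsub>H\<^esub> c \<noteq> h a"
    proof
      assume "c \<otimes>\<^bsub>H\<^esub> c = h a"
      then have "h (b \<otimes>\<^bsub>G\<^esub> b) = h a" using b by simp
      then have "b \<otimes>\<^bsub>G\<^esub> b = a" using bij a b by (auto simp: bij_betw_def inj_on_def)
      then show False using a b by blast
    qed
  qed
qed

text \<open>In a coordinate of order 2 the class 1 is an involution but not a double. Conversely,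
  every coordinate of an involution is 0 or q/2. The latter needs q = 2^m, and if 2 itself is absent
  then m \<ge> 2 and q/2 is even; halving all coordinates gives a square root.\<close>

lemma nonsquare_involution_product:
  assumes qs: "\<forall>q\<in>set qs. primepow q"
  shows "nonsquare_involution (product_group {..<length qs} (\<lambda>j. integer_mod_group (qs ! j))) \<longleftrightarrow> 2 \<in> set qs"
    (is "nonsquare_involution ?P \<longleftrightarrow> _")
proof
  have pos: "qs ! i > 0" if "i < length qs" for i
    using qs that primepow_gt_0_nat nth_mem by blast
  have car: "x \<in> carrier ?P \<longleftrightarrow> x \<in> extensional {..<length qs} \<and> (\<forall>i<length qs. 0 \<le> x i \<and> x i < int (qs ! i))" for x
    using pos by (auto simp: PiE_iff carrier_integer_mod_group)
  show "nonsquare_involution ?P" if two: "2 \<in> set qs"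
  proof -
    obtain j where j: "j < length qs" "qs ! j = 2" using two by (auto simp: in_set_conv_nth)
    define a where "a = (\<lambda>i\<in>{..<length qs}. if i = j then 1 else 0 :: int)"
    have "a \<in> carrier ?P" unfolding car using pos j by (auto simp: a_def)
    moreover have "a \<otimes>\<^bsub>?P\<^esub> a = \<one>\<^bsub>?P\<^esub>" using j by (auto simp: a_def fun_eq_iff)
    moreover have "b \<otimes>\<^bsub>?P\<^esub> b \<noteq> a" for b
    proof
      assume "b \<otimes>\<^bsub>?P\<^esub> b = a"
      then have "(b \<otimes>\<^bsub>?P\<^esub> b) j = a j" by simp
      then have "(b j + b j) mod 2 = 1" using j by (simp add: a_def)
      then show False by presburger
    qed
    ultimately show ?thesis unfolding nonsquare_involution_def by blast
  qed
  show "2 \<in> set qs" if inv: "nonsquare_involution ?P"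
  proof (rule ccontr)
    assume n2: "2 \<notin> set qs"
    obtain a where a: "a \<in> carrier ?P" "a \<otimes>\<^bsub>?P\<^esub> a = \<one>\<^bsub>?P\<^esub>" "\<And>b. b \<in> carrier ?P \<Longrightarrow> b \<otimes>\<^bsub>?P\<^esub> b \<noteq> a"
      using inv unfolding nonsquare_involution_def by blast
    have ev: "even (a i)" if i: "i < length qs" for i
    proof -
      have "(a \<otimes>\<^bsub>?P\<^esub> a) i = \<one>\<^bsub>?P\<^esub> i" using a by simp
      then have "(a i + a i) mod int (qs ! i) = 0" using i by simp
      then obtain k where k: "2 * a i = int (qs ! i) * k" by (auto simp: mod_eq_0_iff_dvd)
      have r: "0 \<le> a i" "a i < int (qs ! i)" using a(1) i unfolding car by auto
      have "int (qs ! i) * k < int (qs ! i) * 2" "0 \<le> int (qs ! i) * k" using k r by linarith+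
      then have "k < 2" "0 \<le> k" using pos[OF i] by (auto simp: mult_less_cancel_left zero_le_mult_iff)
      then consider "k = 0" | "k = 1" by linarith
      then show ?thesis
      proof cases
        case 2
        then have e: "2 * a i = int (qs ! i)" using k by simp
        have "primepow (qs ! i)" using qs i by simp
        then obtain p m where pm: "prime p" "m > 0" "qs ! i = p ^ m" unfolding primepow_def by blast
        have "even (qs ! i)" using e by presburger
        then have "even p" using pm by (simp add: even_power)
        then have "p = 2" using pm(1) prime_odd_nat[of p] prime_ge_2_nat[of p] by (cases "p = 2") auto
        moreover have "m \<noteq> 1" using pm n2 i \<open>p = 2\<close> nth_mem[OF i] by auto
        ultimately obtain m' where "qs ! i = 4 * 2 ^ m'" using pm
          by (intro that[of "m - 2"]) (cases m; cases "m - 1"; simp)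
        then show ?thesis using e by presburger
      qed (use k in simp)
    qed
    define b where "b = (\<lambda>i\<in>{..<length qs}. a i div 2)"
    have "b \<in> carrier ?P"
    proof -
      have "0 \<le> a i div 2 \<and> a i div 2 < int (qs ! i)" if "i < length qs" for i
      proof -
        have "0 \<le> a i" "a i < int (qs ! i)" using a(1) that unfolding car by auto
        then show ?thesis by linarith
      qed
      then show ?thesis unfolding car by (auto simp: b_def)
    qed
    moreover have "b \<otimes>\<^bsub>?P\<^esub> b = a"
    proof
      fix i
      show "(b \<otimes>\<^bsub>?P\<^esub> b) i = a i"
      proof (cases "i < length qs")
        case True
        then have "0 \<le> a i" "a i < int (qs ! i)" using a(1) unfolding car by auto
        then show ?thesis using True ev[OF True] by (simp add: b_def)
      next
        case False
        then show ?thesis using a(1) unfolding car by (auto simp: extensional_def)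
      qed
    qed
    ultimately show False using a(3) by blast
  qed
qed

lemma two_mem_primary_decomposition:
  assumes "Group.group G" "primary_decomposition G qs"
  shows "2 \<in> set qs \<longleftrightarrow> nonsquare_involution G"
proof -
  let ?P = "product_group {..<length qs} (\<lambda>j. integer_mod_group (qs ! j))"
  have P: "Group.group ?P" by (rule product_group) simp
  have iso: "G \<cong> ?P" and pp: "\<forall>q\<in>set qs. primepow q" using assms(2) by (auto simp: primary_decomposition_def)
  have "nonsquare_involution G \<longleftrightarrow> nonsquare_involution ?P"
    using nonsquare_involution_iso[OF assms(1) P iso] nonsquare_involution_iso[OF P assms(1) group.iso_sym[OF assms(1) iso]] by blast
  then show ?thesis using nonsquare_involution_product[OF pp] by simp
qed

text \<open>Every primary factor is at least 2, so 2 is the least as soon as it occurs. Existence of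
  a decomposition turns the criterion into an actual occurrence.\<close>

lemma is_least_primary_factor_two_iff:
  assumes "comm_group G" "finite (carrier G)"
  shows "is_least_primary_factor G 2 \<longleftrightarrow> nonsquare_involution G"
proof -
  have G: "Group.group G" using assms(1) by (simp add: comm_group_def)
  obtain qs where qs: "primary_decomposition G qs" using primary_decomposition_exists[OF assms] by blast
  have ge2: "2 \<le> r" if "r \<in> primary_factors G" for r
  proof -
    have "primepow r" using that by (auto simp: primary_factors_def primary_decomposition_def)
    then show ?thesis using primepow_gt_Suc_0[of r] by simp
  qed
  have "2 \<in> primary_factors G \<longleftrightarrow> nonsquare_involution G"
    using two_mem_primary_decomposition[OF G] qs by (auto simp: primary_factors_def)
  then show ?thesis using ge2 by (auto simp: is_least_primary_factor_def)
qed

section \<open>The unit group of Z/n in terms of integer congruences\<close>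

lemma ZMod_mult: "ZMod n a \<otimes>\<^bsub>ZFact n\<^esub> ZMod n b = ZMod n (a * b)"
proof -
  interpret ideal "Idl\<^bsub>\<Z>\<^esub> {n}" \<Z>
    by (rule int.genideal_ideal) simp
  show ?thesis
    unfolding ZMod_def ZFact_def FactRing_def using rcoset_mult_add[of a b] by simp
qed

lemma ZMod_one: "\<one>\<^bsub>ZFact n\<^esub> = ZMod n 1"
  by (simp add: ZMod_def ZFact_def FactRing_def)

lemma carrier_ZFact: "carrier (ZFact n) = range (ZMod n)"
  by (auto simp: ZMod_def ZFact_def FactRing_def A_RCOSETS_def')

lemma ZMod_eq_cong: "ZMod n a = ZMod n b \<longleftrightarrow> [a = b] (mod n)"
  by (simp add: ZMod_eq_mod Cong.cong_def)

lemma finite_carrier_ZFact: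
  assumes "n > 0"
  shows "finite (carrier (ZFact n))"
proof -
  have "carrier (ZFact n) = ZMod n ` {0..<n}"
    unfolding carrier_ZFact using assms ZMod_mod[of n] by (auto simp: image_iff intro!: bexI[of _ "_ mod n"])
  then show ?thesis by simp
qed

text \<open>Units drop out of the right-hand side because they are automatic: a^2 = 1 makes a
  invertible, and b^2 = a then gives b^4 = 1, so every square root of a is invertible as
  well.\<close>

lemma nonsquare_involution_mult_group_mod:
  "nonsquare_involution (mult_group_mod n) \<longleftrightarrow> (\<exists>a::int. [a * a = 1] (mod int n) \<and> (\<forall>b. \<not> [b * b = a] (mod int n)))"
proof -
  let ?R = "ZFact (int n)"
  interpret cring ?R by (rule ZFact_is_cring)
  have U: "ZMod (int n) a \<in> Units ?R" if "[a * b = 1] (mod int n)" for a b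
    unfolding Units_def carrier_ZFact
    using that by (auto simp: ZMod_mult ZMod_one ZMod_eq_cong mult.commute intro!: bexI[of _ "ZMod (int n) b"])
  have carr: "carrier (mult_group_mod n) = Units ?R"
    and mul: "x \<otimes>\<^bsub>mult_group_mod n\<^esub> y = x \<otimes>\<^bsub>?R\<^esub> y" and one: "\<one>\<^bsub>mult_group_mod n\<^esub> = \<one>\<^bsub>?R\<^esub>" for x y
    by (simp_all add: mult_group_mod_def units_of_def)
  show ?thesis
  proof
    assume "nonsquare_involution (mult_group_mod n)"
    then obtain x where x: "x \<in> Units ?R" "x \<otimes>\<^bsub>?R\<^esub> x = \<one>\<^bsub>?R\<^esub>" "\<And>y. y \<in> Units ?R \<Longrightarrow> y \<otimes>\<^bsub>?R\<^esub> y \<noteq> x"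
      by (auto simp: nonsquare_involution_def carr mul one)
    obtain a where a: "x = ZMod (int n) a" using Units_closed[OF x(1)] unfolding carrier_ZFact by blast
    have aa: "[a * a = 1] (mod int n)" using x(2) by (simp add: a ZMod_mult ZMod_one ZMod_eq_cong)
    have "\<not> [b * b = a] (mod int n)" for b
    proof
      assume b: "[b * b = a] (mod int n)"
      then have "[b * b * (b * b) = a * a] (mod int n)" by (rule cong_mult[OF _ b])
      then have "[b * (b * (b * b)) = 1] (mod int n)" using aa by (simp add: mult.assoc cong_trans)
      then have "ZMod (int n) b \<in> Units ?R" by (rule U)
      moreover have "ZMod (int n) b \<otimes>\<^bsub>?R\<^esub> ZMod (int n) b = x" using b by (simp add: a ZMod_mult ZMod_eq_cong)
      ultimately show False using x(3) by blast
    qed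
    with aa show "\<exists>a. [a * a = 1] (mod int n) \<and> (\<forall>b. \<not> [b * b = a] (mod int n))" by blast
  next
    assume "\<exists>a. [a * a = 1] (mod int n) \<and> (\<forall>b. \<not> [b * b = a] (mod int n))"
    then obtain a where a: "[a * a = 1] (mod int n)" "\<And>b. \<not> [b * b = a] (mod int n)" by blast
    have "ZMod (int n) a \<in> Units ?R" using a(1) by (rule U)
    moreover have "ZMod (int n) a \<otimes>\<^bsub>?R\<^esub> ZMod (int n) a = \<one>\<^bsub>?R\<^esub>" using a(1) by (simp add: ZMod_mult ZMod_one ZMod_eq_cong)
    moreover have "y \<otimes>\<^bsub>?R\<^esub> y \<noteq> ZMod (int n) a" if y: "y \<in> Units ?R" for y
    proof -
      obtain b where b: "y = ZMod (int n) b" using Units_closed[OF y] unfolding carrier_ZFact by blast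
      show ?thesis using a(2)[of b] by (simp add: b ZMod_mult ZMod_eq_cong)
    qed
    ultimately show "nonsquare_involution (mult_group_mod n)"
      unfolding nonsquare_involution_def carr mul one by blast
  qed
qed

section \<open>Square roots of -1 and of involutions modulo n\<close>

lemma neg_one_not_square_mod_prime:
  assumes p: "prime (p::nat)" "p mod 4 = 3"
  shows "\<not> [b * b = -1] (mod int p)"
proof
  assume b: "[b * b = -1] (mod int p)"
  have p3: "p > 2" using mod_less_eq_dividend[of p 4] p(2) by simp
  have m: "odd ((p - 1) div 2)" using p(2) by presburger
  have "[Legendre (-1) (int p) = (-1) ^ ((p - 1) div 2)] (mod int p)"
    by (rule euler_criterion[OF p(1) p3])
  moreover have "Legendre (-1) (int p) = 1"
  proof -
    have "QuadRes (int p) (-1)" using b by (auto simp: QuadRes_def power2_eq_square)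
    moreover have "\<not> [-1 = 0] (mod int p)" using p3 by (simp add: cong_0_iff)
    ultimately show ?thesis by (simp add: Legendre_def)
  qed
  ultimately have "[1 = -1] (mod int p)" using m by simp
  then have "int p dvd 2" by (simp add: cong_iff_dvd_diff)
  then show False using p3 by (auto dest: zdvd_imp_le)
qed

lemma neg_one_square_mod_prime:
  assumes p: "prime (p::nat)" "p mod 4 = 1"
  shows "\<exists>i::int. [i * i = -1] (mod int p)"
proof -
  have "p \<noteq> 2" using p(2) by auto
  then have p2: "p > 2" using prime_ge_2_nat[OF p(1)] by simp
  have e: "even ((p - 1) div 2)" using p(2) by presburger
  have "[Legendre (-1) (int p) = (-1) ^ ((p - 1) div 2)] (mod int p)"
    using euler_criterion[OF p(1) p2, of "-1"] .
  then have L: "[Legendre (-1) (int p) = 1] (mod int p)" using e by simp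
  have "Legendre (-1) (int p) \<noteq> -1" 
  proof
    assume "Legendre (-1) (int p) = -1"
    then have "int p dvd 2" using L by (simp add: cong_iff_dvd_diff)
    then show False using p2 by (auto dest: zdvd_imp_le)
  qed
  moreover have "Legendre (-1) (int p) \<noteq> 0"
    using L p2 by (auto simp: cong_iff_dvd_diff)
  ultimately have "QuadRes (int p) (-1)" by (auto simp: Legendre_def split: if_splits)
  then show ?thesis by (auto simp: QuadRes_def power2_eq_square)
qed

text \<open>Induction splitting off one prime p from m = p k. If p does not divide k, the Chinese
  remainder theorem combines roots modulo p and k; otherwise a root i modulo k is lifted to i + k t,
  as in Hensel's lemma, since 2 i is invertible modulo p.\<close>

lemma neg_one_square_mod_split_number:
  assumes "m > 0" "\<And>p. prime p \<Longrightarrow> p dvd m \<Longrightarrow> p mod 4 = 1"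
  shows "\<exists>i::int. [i * i = -1] (mod int m)"
  using assms
proof (induction m rule: less_induct)
  case (less m)
  show ?case
  proof (cases "m = 1")
    case False
    then obtain p where p: "prime p" "p dvd m" using prime_factor_nat by blast
    then obtain k where k: "m = p * k" by auto
    have p4: "p mod 4 = 1" using less.prems(2) p by blast
    have k0: "k > 0" "k < m" using k less.prems(1) prime_gt_1_nat[OF p(1)] by auto
    obtain i where i: "[i * i = -1] (mod int k)"
      using less.IH[of k] k0 less.prems(2) k by auto
    show ?thesis
    proof (cases "p dvd k")
      case False
      then have cop: "coprime (int p) (int k)" using p(1) by (simp add: prime_imp_coprime)
      obtain j where j: "[j * j = -1] (mod int p)" using neg_one_square_mod_prime[OF p(1) p4] by blast
      obtain x where x: "[x = j] (mod int p)" "[x = i] (mod int k)"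
        using binary_chinese_remainder_int[OF cop] by blast
      have "[x * x = -1] (mod int p)" "[x * x = -1] (mod int k)"
        using cong_trans[OF cong_mult[OF x(1) x(1)] j] cong_trans[OF cong_mult[OF x(2) x(2)] i] by auto
      then have "[x * x = -1] (mod int p * int k)" using cop by (intro coprime_cong_mult) auto
      then show ?thesis using k by auto
    next
      case True
      obtain c where c: "i * i + 1 = int k * c"
        using i by (auto simp: cong_iff_dvd_diff)
      have "coprime (2 * i) (int p)"
      proof -
        have "\<not> int p dvd 2 * i"
        proof
          assume d: "int p dvd 2 * i"
          have "p \<noteq> 2" using p4 by auto
          then have "\<not> p dvd 2" using p(1) by (auto dest: primes_dvd_imp_eq[OF _ two_is_prime_nat])
          then have "\<not> int p dvd 2" by presburger
          then have "int p dvd i" using d p(1) by (auto simp: prime_dvd_mult_iff)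
          moreover have "int p dvd i * i + 1" using True c by (simp add: dvd_mult2)
          ultimately have "int p dvd 1" by (meson dvd_add_right_iff dvd_mult)
          then show False using p(1) by auto
        qed
        moreover have "prime (int p)" using p(1) by simp
        ultimately have "coprime (int p) (2 * i)" by (intro prime_imp_coprime)
        then show ?thesis by (simp only: coprime_commute)
      qed
      then obtain u where u: "[(2 * i) * u = 1] (mod int p)" using cong_solve_coprime_int by blast
      \<comment> \<open>(i + k t)^2 + 1 = k (c + 2 i t + k t^2), and p divides k. So p k divides
        this once t solves c + 2 i t = 0 modulo p, where u is the inverse of 2 i.\<close>
      define t where "t = - c * u"
      have "int p dvd c + 2 * i * t"
      proof -
        have "int p dvd (2 * i) * u - 1" using u by (simp add: cong_iff_dvd_diff)
        then have "int p dvd (- c) * ((2 * i) * u - 1)" by (rule dvd_mult)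
        also have "(- c) * ((2 * i) * u - 1) = c + 2 * i * t" by (simp add: t_def algebra_simps)
        finally show ?thesis .
      qed
      moreover have "int p dvd int k * t * t" using True by simp
      ultimately have "int p dvd (c + 2 * i * t) + int k * t * t" by (rule dvd_add)
      then have "int k * int p dvd int k * ((c + 2 * i * t) + int k * t * t)" by simp
      also have "int k * ((c + 2 * i * t) + int k * t * t) = (i + int k * t) * (i + int k * t) - (-1)"
        using c by (simp add: algebra_simps)
      finally have "[(i + int k * t) * (i + int k * t) = -1] (mod int m)"
        by (simp add: cong_iff_dvd_diff k mult.commute)
      then show ?thesis by blast
    qed
  qed auto
qed

lemma involution_is_square_odd:
  assumes m: "odd m" and i: "[i * i = -1] (mod m)" and a: "[a * a = 1] (mod m)"
  shows "\<exists>b::int. [b * b = a] (mod m)"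
proof -
  obtain h where h: "m = 2 * h - 1" using m by (elim oddE) (metis add_diff_cancel_right' distrib_left mult.right_neutral one_add_one diff_add_eq diff_diff_eq2)
  have two: "[2 * h = 1] (mod m)" by (simp add: cong_iff_dvd_diff h)
  define b where "b = h * ((1 + a) + i * (1 - a))"
  obtain c where c: "i * i + 1 = m * c" using i by (auto simp: cong_iff_dvd_diff)
  obtain d where d: "a * a - 1 = m * d" using a by (auto simp: cong_iff_dvd_diff)
  have "((1 + a) + i * (1 - a)) * ((1 + a) + i * (1 - a)) - 4 * a = (i * i + 1) * (1 - a) * (1 - a) - 2 * i * (a * a - 1)"
    by (simp add: algebra_simps)
  also have "m dvd \<dots>" unfolding c d by (intro dvd_diff) (auto simp: mult.assoc)
  finally have "[((1 + a) + i * (1 - a)) * ((1 + a) + i * (1 - a)) = 4 * a] (mod m)" by (simp add: cong_iff_dvd_diff)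
  then have "[h * h * (((1 + a) + i * (1 - a)) * ((1 + a) + i * (1 - a))) = h * h * (4 * a)] (mod m)"
    by (rule cong_scalar_left)
  moreover have "[(2 * h) * (2 * h) * a = 1 * 1 * a] (mod m)" by (intro cong_mult two cong_refl)
  ultimately have "[b * b = a] (mod m)" unfolding b_def by (simp add: mult_ac) (metis cong_trans)
  then show ?thesis by blast
qed

lemma exists_nonsquare_involution_mod_iff:
  assumes "n > 0"
  shows "(\<exists>a::int. [a * a = 1] (mod int n) \<and> (\<forall>b. \<not> [b * b = a] (mod int n))) \<longleftrightarrow>
     4 dvd n \<or> (\<exists>p. prime p \<and> p dvd n \<and> p mod 4 = 3)"
proof
  assume "4 dvd n \<or> (\<exists>p. prime p \<and> p dvd n \<and> p mod 4 = 3)"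
  then have "\<not> [b * b = -1] (mod int n)" for b
  proof
    assume "4 dvd n"
    then have four: "4 dvd int n" by presburger
    show ?thesis
    proof
      assume "[b * b = -1] (mod int n)"
      then have "[b * b = -1] (mod 4)" using four by (rule cong_dvd_modulus)
      then have "4 dvd b * b + 1" by (simp add: cong_iff_dvd_diff)
      moreover have "b mod 4 = 0 \<or> b mod 4 = 1 \<or> b mod 4 = 2 \<or> b mod 4 = 3" by presburger
      moreover have "(b * b + 1) mod 4 = ((b mod 4) * (b mod 4) + 1) mod 4" by (metis mod_add_left_eq mod_mult_eq)
      ultimately show False by (elim disjE) (simp_all add: dvd_eq_mod_eq_0)
    qed
  next
    assume "\<exists>p. prime p \<and> p dvd n \<and> p mod 4 = 3"
    then obtain p where p: "prime p" "p dvd n" "p mod 4 = 3" by blast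
    then have "int p dvd int n" by simp
    then show ?thesis using neg_one_not_square_mod_prime[OF p(1,3)] cong_dvd_modulus by blast
  qed
  moreover have "[(-1) * (-1) = (1::int)] (mod int n)" by simp
  ultimately show "\<exists>a::int. [a * a = 1] (mod int n) \<and> (\<forall>b. \<not> [b * b = a] (mod int n))" by blast
next
  assume *: "\<exists>a::int. [a * a = 1] (mod int n) \<and> (\<forall>b. \<not> [b * b = a] (mod int n))"
  show "4 dvd n \<or> (\<exists>p. prime p \<and> p dvd n \<and> p mod 4 = 3)"
  proof (rule ccontr)
    assume neg: "\<not> ?thesis"
    define m where "m = (if even n then n div 2 else n)"
    have n: "n = m \<or> n = 2 * m" by (auto simp: m_def)
    have om: "odd m" using neg by (auto simp: m_def elim!: evenE oddE)
    have m0: "m > 0" using om by (cases m) auto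
    have "p mod 4 = 1" if p: "prime p" "p dvd m" for p
    proof -
      have "odd p" using om p(2) by (meson dvd_trans)
      moreover have "p dvd n" using p(2) n by auto
      then have "p mod 4 \<noteq> 3" using neg p(1) by blast
      ultimately show ?thesis by presburger
    qed
    then obtain i where i: "[i * i = -1] (mod int m)" using neg_one_square_mod_split_number[OF m0] by blast
    obtain a where a: "[a * a = 1] (mod int n)" "\<And>b. \<not> [b * b = a] (mod int n)" using * by blast
    have "int m dvd int n" using n by auto
    then have "[a * a = 1] (mod int m)" using a(1) cong_dvd_modulus by blast
    then obtain b where b: "[b * b = a] (mod int m)" using involution_is_square_odd[of "int m" i a] om i by auto
    show False
    proof (cases "n = m")
      case True
      then show False using a(2) b by blast
    next
      case False
      then have n2: "n = 2 * m" using n by simp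
      have "odd a" 
      proof -
        have "2 dvd int n" using n2 by simp
        then have "2 dvd a * a - 1" using a(1) by (meson cong_iff_dvd_diff dvd_trans)
        then show ?thesis by auto
      qed
      \<comment> \<open>Adding the odd number m changes the parity and keeps the residue modulo m.
        An odd root also works modulo 2, because a is odd.\<close>
      define b' where "b' = (if odd b then b else b + int m)"
      have ob: "odd b'" using om by (simp add: b'_def)
      have "[b' = b] (mod int m)" by (simp add: b'_def cong_iff_dvd_diff)
      then have "[b' * b' = a] (mod int m)" using b by (meson cong_mult cong_trans)
      moreover have "[b' * b' = a] (mod 2)" using ob \<open>odd a\<close> by (simp add: cong_iff_dvd_diff)
      moreover have "coprime 2 (int m)" using om by simp
      ultimately have "[b' * b' = a] (mod 2 * int m)" by (intro coprime_cong_mult) auto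
      then show False using a(2) n2 by simp
    qed
  qed
qed

theorem least_primary_factor_mult_group_mod_iff:
  assumes "n > 0"
  shows "is_least_primary_factor (mult_group_mod n) 2 \<longleftrightarrow> 4 dvd n \<or> (\<exists>p. prime p \<and> p dvd n \<and> p mod 4 = 3)"
proof -
  interpret R: cring "ZFact (int n)" by (rule ZFact_is_cring)
  have "comm_group (mult_group_mod n)" unfolding mult_group_mod_def by (rule R.units_comm_group)
  moreover have "finite (carrier (mult_group_mod n))"
    using finite_carrier_ZFact[of "int n"] assms by (auto simp: mult_group_mod_def units_of_def Units_def intro: finite_subset)
  ultimately show ?thesis
    using is_least_primary_factor_two_iff nonsquare_involution_mult_group_mod exists_nonsquare_involution_mod_iff[OF assms] by blast
qed

section \<open>Fourier inversion and a Perron formula\<close>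

text \<open>This is the characteristic function of the standard normal distribution, rescaled by e.
  It serves as the convergence factor in the inversion formula.\<close>

lemma gaussian_integral_iexp:
  fixes e x :: real
  assumes "e > 0"
  shows "integrable lborel (\<lambda>t. iexp (t * x) * complex_of_real (exp (- (e * t)\<^sup>2 / 2)))"
    and "(LINT t|lborel. iexp (t * x) * complex_of_real (exp (- (e * t)\<^sup>2 / 2)))
            = complex_of_real (sqrt (2 * pi) / e * exp (- (x / e)\<^sup>2 / 2))"
proof -
  have int: "integrable lborel (\<lambda>t. iexp (t * y) * complex_of_real (exp (- t\<^sup>2 / 2)))" for y
  proof -
    have "integrable lborel (\<lambda>t. sqrt (2 * pi) * std_normal_density t)"
      by (intro integrable_mult_right integrable_normal_density) auto
    then have "integrable lborel (\<lambda>t::real. exp (- t\<^sup>2 / 2))"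
      by (simp add: std_normal_density_def)
    then show ?thesis
      by (rule Bochner_Integration.integrable_bound) (auto simp: norm_mult)
  qed
  have val: "(LINT t|lborel. iexp (t * y) * complex_of_real (exp (- t\<^sup>2 / 2)))
               = complex_of_real (sqrt (2 * pi) * exp (- y\<^sup>2 / 2))" for y
  proof -
    have "complex_of_real (exp (- y\<^sup>2 / 2)) = char std_normal_distribution y"
      by (simp add: char_std_normal_distribution)
    also have "\<dots> = (LINT t|lborel. std_normal_density t *\<^sub>R iexp (y * t))"
      unfolding char_def by (subst integral_density) (auto simp: normal_density_nonneg)
    also have "\<dots> = (LINT t|lborel. (1 / sqrt (2 * pi)) *\<^sub>R (iexp (t * y) * complex_of_real (exp (- t\<^sup>2 / 2))))"
      by (intro Bochner_Integration.integral_cong)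
         (auto simp: std_normal_density_def scaleR_conv_of_real mult_ac)
    finally show ?thesis
      by (simp add: scaleR_conv_of_real field_simps)
  qed
  have eq: "iexp (t * x) * complex_of_real (exp (- (e * t)\<^sup>2 / 2)) =
     iexp ((0 + e * t) * (x / e)) * complex_of_real (exp (- (0 + e * t)\<^sup>2 / 2))" for t
    using assms by simp
  show "integrable lborel (\<lambda>t. iexp (t * x) * complex_of_real (exp (- (e * t)\<^sup>2 / 2)))"
    unfolding eq using assms
    by (intro lborel_integrable_real_affine int) auto
  have "(LINT t|lborel. iexp (t * (x / e)) * complex_of_real (exp (- t\<^sup>2 / 2))) =
      \<bar>e\<bar> *\<^sub>R (LINT t|lborel. iexp ((0 + e * t) * (x / e)) * complex_of_real (exp (- (0 + e * t)\<^sup>2 / 2)))"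
    using assms by (intro lborel_integral_real_affine) auto
  then have "complex_of_real (sqrt (2 * pi) * exp (- (x / e)\<^sup>2 / 2)) =
      e *\<^sub>R (LINT t|lborel. iexp (t * x) * complex_of_real (exp (- (e * t)\<^sup>2 / 2)))"
    unfolding val eq[symmetric] using assms by simp
  then show "(LINT t|lborel. iexp (t * x) * complex_of_real (exp (- (e * t)\<^sup>2 / 2)))
            = complex_of_real (sqrt (2 * pi) / e * exp (- (x / e)\<^sup>2 / 2))"
    using assms by (simp add: scaleR_conv_of_real field_simps)
qed

text \<open>Gaussian summability: the factor \<open>G e\<close> makes the double integral absolutely
  convergent, so the order can be exchanged, and the substitution v = u + e z leaves a fixed
  Gaussian integrated against g(u + e z). Dominated convergence as e tends to 0 then works on both
  sides, with majorant |h| on one and a constant times the Gaussian on the other.\<close>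

theorem Fourier_inversion:
  fixes g :: "real \<Rightarrow> complex"
  assumes cont: "continuous_on UNIV g"
    and bnd: "\<And>v. norm (g v) \<le> B"
    and int: "integrable lborel g"
    and int_hat: "integrable lborel (\<lambda>t. LINT v|lborel. g v * iexp (- (t * v)))"
  shows "(LINT t|lborel. (LINT v|lborel. g v * iexp (- (t * v))) * iexp (t * u)) = 2 * pi * g u"
proof -
  define h where "h t = (LINT v|lborel. g v * iexp (- (t * v)))" for t
  have [measurable]: "g \<in> borel_measurable borel"
    using cont by (rule borel_measurable_continuous_onI)
  have h_meas [measurable]: "h \<in> borel_measurable borel"
    unfolding h_def using borel_measurable_integrable[OF int_hat] by simp
  have h_int: "integrable lborel h"
    unfolding h_def by (rule int_hat)
  define G where "G e t = complex_of_real (exp (- (e * t)\<^sup>2 / 2))" for e t :: real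
  have G_meas [measurable]: "G e \<in> borel_measurable borel" for e
    unfolding G_def by measurable
  have G1: "norm (G e t) \<le> 1" for e t
    by (simp add: G_def)
  have smooth: "(LINT t|lborel. h t * iexp (t * u) * G e t) =
      (LINT z|lborel. sqrt (2 * pi) *\<^sub>R (g (u + e * z) * G 1 z))" if "e > 0" for e
  proof -
    have Gi: "integrable lborel (G e)"
      using gaussian_integral_iexp(1)[OF that, of 0] by (simp add: G_def[abs_def])
    have "(LINT t|lborel. h t * iexp (t * u) * G e t) =
      (LINT t|lborel. (LINT v|lborel. (g v * iexp (- (t * v))) * (iexp (t * u) * G e t)))"
    proof -
      have "h t * iexp (t * u) * G e t = (LINT v|lborel. (g v * iexp (- (t * v))) * (iexp (t * u) * G e t))" for t
        unfolding h_def integral_mult_left_zero by (simp only: mult.assoc)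
      then show ?thesis by (simp only:)
    qed
    also have "\<dots> = (LINT v|lborel. (LINT t|lborel. (g v * iexp (- (t * v))) * (iexp (t * u) * G e t)))"
    proof (rule lborel_pair.Fubini_integral)
      show "integrable (lborel \<Otimes>\<^sub>M lborel) (\<lambda>(v, t). (g v * iexp (- (t * v))) * (iexp (t * u) * G e t))"
      proof (rule lborel_pair.Fubini_integrable)
        have n: "norm (case (x, y) of (v, t) \<Rightarrow> g v * iexp (- (t * v)) * (iexp (t * u) * G e t)) =
           norm (g x) * norm (G e y)" for x y
          by (simp add: norm_mult)
        show "integrable lborel (\<lambda>x. LINT y|lborel. norm (case (x, y) of (v, t) \<Rightarrow> g v * iexp (- (t * v)) * (iexp (t * u) * G e t)))"
          unfolding n using int Gi by simp
        show "AE x in lborel. integrable lborel (\<lambda>y. case (x, y) of (v, t) \<Rightarrow> g v * iexp (- (t * v)) * (iexp (t * u) * G e t))"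
        proof (rule AE_I2)
          fix x
          show "integrable lborel (\<lambda>y. case (x, y) of (v, t) \<Rightarrow> g v * iexp (- (t * v)) * (iexp (t * u) * G e t))"
            by (rule Bochner_Integration.integrable_bound[of _ "\<lambda>y. norm (g x) * norm (G e y)"])
               (use Gi in \<open>auto simp: norm_mult\<close>)
        qed
      qed measurable
    qed
    also have "\<dots> = (LINT v|lborel. g v * (sqrt (2 * pi) / e * exp (- ((u - v) / e)\<^sup>2 / 2)))"
    proof (rule Bochner_Integration.integral_cong[OF refl])
      fix v
      have "(LINT t|lborel. (g v * iexp (- (t * v))) * (iexp (t * u) * G e t)) =
         (LINT t|lborel. g v * (iexp (t * (u - v)) * complex_of_real (exp (- (e * t)\<^sup>2 / 2))))"
        by (intro Bochner_Integration.integral_cong)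
           (auto simp: G_def exp_add[symmetric] algebra_simps exp_diff exp_minus field_simps)
      also have "\<dots> = g v * (LINT t|lborel. iexp (t * (u - v)) * complex_of_real (exp (- (e * t)\<^sup>2 / 2)))"
        by simp
      also have "\<dots> = g v * complex_of_real (sqrt (2 * pi) / e * exp (- ((u - v) / e)\<^sup>2 / 2))"
        by (subst gaussian_integral_iexp(2)[OF that]) simp
      finally show "(LINT t|lborel. (g v * iexp (- (t * v))) * (iexp (t * u) * G e t)) =
          g v * complex_of_real (sqrt (2 * pi) / e * exp (- ((u - v) / e)\<^sup>2 / 2))" .
    qed
    also have "\<dots> = \<bar>e\<bar> *\<^sub>R (LINT z|lborel. g (u + e * z) *
        complex_of_real (sqrt (2 * pi) / e * exp (- ((u - (u + e * z)) / e)\<^sup>2 / 2)))"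
      using that by (intro lborel_integral_real_affine) auto
    also have "\<dots> = (LINT z|lborel. \<bar>e\<bar> *\<^sub>R (g (u + e * z) *
        complex_of_real (sqrt (2 * pi) / e * exp (- ((u - (u + e * z)) / e)\<^sup>2 / 2))))"
      by simp
    also have "\<dots> = (LINT z|lborel. sqrt (2 * pi) *\<^sub>R (g (u + e * z) * G 1 z))"
      using that by (intro Bochner_Integration.integral_cong)
        (auto simp: G_def scaleR_conv_of_real)
    finally show ?thesis .
  qed
  define en where "en n = 1 / real (Suc n)" for n
  have en_pos: "en n > 0" for n by (simp add: en_def)
  have en_lim: "en \<longlonglongrightarrow> 0"
    unfolding en_def using LIMSEQ_inverse_real_of_nat by (simp add: inverse_eq_divide)
  have "(\<lambda>n. LINT t|lborel. h t * iexp (t * u) * G (en n) t) \<longlonglongrightarrow> (LINT t|lborel. h t * iexp (t * u))"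
  proof (rule integral_dominated_convergence[where w = "\<lambda>t. norm (h t)"])
    show "AE t in lborel. (\<lambda>n. h t * iexp (t * u) * G (en n) t) \<longlonglongrightarrow> h t * iexp (t * u)"
    proof (rule AE_I2)
      fix t
      have "(\<lambda>n. h t * iexp (t * u) * G (en n) t) \<longlonglongrightarrow> h t * iexp (t * u) * complex_of_real (exp (- (0 * t)\<^sup>2 / 2))"
        unfolding G_def by (intro tendsto_intros en_lim) auto
      then show "(\<lambda>n. h t * iexp (t * u) * G (en n) t) \<longlonglongrightarrow> h t * iexp (t * u)"
        by simp
    qed
    show "AE t in lborel. norm (h t * iexp (t * u) * G (en n) t) \<le> norm (h t)" for n
      using G1 by (auto simp: norm_mult mult_left_le)
  qed (use h_int in auto)
  moreover have "(\<lambda>n. LINT z|lborel. sqrt (2 * pi) *\<^sub>R (g (u + en n * z) * G 1 z))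
      \<longlonglongrightarrow> (LINT z|lborel. sqrt (2 * pi) *\<^sub>R (g u * G 1 z))"
  proof (rule integral_dominated_convergence[where w = "\<lambda>t. sqrt (2 * pi) * B * norm (G 1 t)"])
    show "AE z in lborel. (\<lambda>n. sqrt (2 * pi) *\<^sub>R (g (u + en n * z) * G 1 z)) \<longlonglongrightarrow> sqrt (2 * pi) *\<^sub>R (g u * G 1 z)"
    proof (rule AE_I2)
      fix z
      have "(\<lambda>n. u + en n * z) \<longlonglongrightarrow> u + 0 * z"
        by (intro tendsto_intros en_lim)
      then have "(\<lambda>n. g (u + en n * z)) \<longlonglongrightarrow> g u"
        using cont by (intro continuous_on_tendsto_compose[of UNIV g]) auto
      then show "(\<lambda>n. sqrt (2 * pi) *\<^sub>R (g (u + en n * z) * G 1 z)) \<longlonglongrightarrow> sqrt (2 * pi) *\<^sub>R (g u * G 1 z)"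
        by (intro tendsto_intros)
    qed
    show "AE t in lborel. norm (sqrt (2 * pi) *\<^sub>R (g (u + en n * t) * G 1 t)) \<le> sqrt (2 * pi) * B * norm (G 1 t)" for n
      using bnd by (auto simp: norm_mult mult.assoc intro!: mult_left_mono mult_right_mono)
    show "integrable lborel (\<lambda>t. sqrt (2 * pi) * B * norm (G 1 t))"
      using gaussian_integral_iexp(1)[of 1 0] unfolding G_def
      by (intro integrable_mult_right integrable_norm) simp
  qed auto
  ultimately have "(LINT t|lborel. h t * iexp (t * u)) = (LINT z|lborel. sqrt (2 * pi) *\<^sub>R (g u * G 1 z))"
    unfolding smooth[OF en_pos] by (rule LIMSEQ_unique)
  also have "\<dots> = sqrt (2 * pi) *\<^sub>R (g u * (LINT z|lborel. G 1 z))"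
    by simp
  also have "(LINT z|lborel. G 1 z) = sqrt (2 * pi)"
    using gaussian_integral_iexp(2)[of 1 0] by (simp add: G_def)
  finally have "(LINT t|lborel. h t * iexp (t * u)) = (sqrt (2 * pi) * sqrt (2 * pi)) *\<^sub>R g u"
    by (simp only: scaleR_conv_of_real of_real_mult mult_ac)
  also have "sqrt (2 * pi) * sqrt (2 * pi) = 2 * pi"
    by (rule real_sqrt_mult_self[THEN trans]) simp
  finally show ?thesis
    unfolding h_def by (simp add: scaleR_conv_of_real)
qed

lemma integral_exp_half_line:
  fixes z :: complex
  assumes "Re z > 0"
  shows "integrable lborel (\<lambda>v. indicator {0<..} v *\<^sub>R exp (- (z * of_real v)))"
    and "(LINT v|lborel. indicator {0<..} v *\<^sub>R exp (- (z * of_real v))) = 1 / z"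
proof -
  have z0: "z \<noteq> 0" using assms by auto
  have "set_integrable lborel {0<..} (\<lambda>v. exp (- (v * Re z)))"
    by (rule integrable_I0i_exp_mscale) fact
  then show int: "integrable lborel (\<lambda>v. indicator {0<..} v *\<^sub>R exp (- (z * of_real v)))"
    unfolding set_integrable_def
    by (rule Bochner_Integration.integrable_bound) (auto simp: indicator_def mult_ac)
  have "(LBINT v=0..\<infinity>. exp (- (z * of_real v))) = 0 - (- 1 / z)"
  proof (rule interval_integral_FTC_integrable[where F = "\<lambda>v. - exp (- (z * of_real v)) / z"])
    show "((\<lambda>v. - exp (- (z * of_real v)) / z) has_vector_derivative exp (- (z * of_real x))) (at x)" for x
    proof -
      have "((\<lambda>v. - exp (- (z * v)) / z) has_field_derivative exp (- (z * of_real x))) (at (of_real x))"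
        using z0 by (auto intro!: derivative_eq_intros)
      then show ?thesis
        by (rule has_vector_derivative_real_field)
    qed
    show "isCont (\<lambda>v. exp (- (z * of_real v))) x" for x
      by (intro continuous_intros)
    show "set_integrable lborel (einterval 0 \<infinity>) (\<lambda>v. exp (- (z * of_real v)))"
      using int unfolding set_integrable_def by (simp add: einterval_def greaterThan_def zero_ereal_def)
    have "((\<lambda>v. - exp (- (z * of_real v)) / z) \<longlongrightarrow> - exp (- (z * of_real 0)) / z) (at_right 0)"
      by (intro tendsto_intros) (use z0 in auto)
    then show "(((\<lambda>v. - exp (- (z * of_real v)) / z) \<circ> real_of_ereal) \<longlongrightarrow> - 1 / z) (at_right 0)"
      unfolding ereal_tendsto_simps zero_ereal_def by simp
    have "((\<lambda>v. exp (- (z * complex_of_real v)) * (-1 / z)) \<longlongrightarrow> 0) at_top"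
    proof (rule tendsto_mult_left_zero, rule tendsto_norm_zero_cancel)
      have "((\<lambda>v. exp (- (Re z * v))) \<longlongrightarrow> 0) at_top"
        using assms by real_asymp
      then show "((\<lambda>v. norm (exp (- (z * complex_of_real v)))) \<longlongrightarrow> 0) at_top"
        by simp
    qed
    then show "(((\<lambda>v. - exp (- (z * of_real v)) / z) \<circ> real_of_ereal) \<longlongrightarrow> 0) (at_left \<infinity>)"
      unfolding ereal_tendsto_simps by simp
  qed auto
  then show "(LINT v|lborel. indicator {0<..} v *\<^sub>R exp (- (z * of_real v))) = 1 / z"
    unfolding interval_lebesgue_integral_def set_lebesgue_integral_def
    by (simp add: einterval_def greaterThan_def zero_ereal_def)
qed

text \<open>The maxima make the kernel vanish for \<open>v \<le> 0\<close> and visibly continuous.\<close>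

definition perron_kernel :: "real \<Rightarrow> real \<Rightarrow> real" where
  "perron_kernel c v = (1 - exp (- max v 0)) * exp (- (c * max v 0))"

text \<open>The Fourier transform of \<open>perron_kernel c\<close>: with s = c + i t, the partial
  fractions 1/s - 1/(s + 1) are the transforms of the two exponentials exp(-c v) and exp(-(c + 1) v)
  on v > 0.\<close>

definition perron_hat :: "real \<Rightarrow> real \<Rightarrow> complex" where
  "perron_hat c t = 1 / (Complex c t * (Complex c t + 1))"

text \<open>The bound does not depend on c, which allows one majorant for all lines to the right of
  \<open>Re s = 1\<close>.\<close>

lemma perron_hat_bound:
  assumes "c \<ge> 1"
  shows "norm (perron_hat c t) \<le> 1 / (1 + t\<^sup>2)"
proof -
  have *: "1 + t\<^sup>2 \<le> (norm (Complex c' t))\<^sup>2" if "c' \<ge> 1" for c'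
    using that by (simp add: cmod_power2 one_le_power)
  have "sqrt (1 + t\<^sup>2) \<le> norm (Complex c' t)" if "c' \<ge> 1" for c'
    using *[OF that] by (simp add: real_le_lsqrt)
  from this[of c] this[of "c + 1"] assms
  have "sqrt (1 + t\<^sup>2) * sqrt (1 + t\<^sup>2) \<le> norm (Complex c t) * norm (Complex (c + 1) t)"
    by (intro mult_mono) auto
  moreover have "Complex c t + 1 = Complex (c + 1) t"
    by (simp add: complex_eq_iff)
  ultimately have "1 + t\<^sup>2 \<le> norm (Complex c t * (Complex c t + 1))"
    by (simp add: norm_mult)
  moreover have "0 < 1 + t\<^sup>2" by (simp add: add_pos_nonneg)
  ultimately show ?thesis
    unfolding perron_hat_def norm_divide by (simp add: frac_le)
qed

lemma integrable_one_over_one_plus_square: "integrable lborel (\<lambda>t::real. 1 / (1 + t\<^sup>2))"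
  using integrable_inverse_1_plus_square by (simp add: set_integrable_def inverse_eq_divide)

lemma perron_hat_measurable [measurable]: "perron_hat c \<in> borel_measurable borel"
proof -
  have "(\<lambda>t. Complex c t) = (\<lambda>t. of_real c + \<i> * of_real t)"
    by (auto simp: complex_eq_iff)
  then have [measurable]: "(\<lambda>t. Complex c t) \<in> borel_measurable borel"
    by simp
  show ?thesis unfolding perron_hat_def by measurable
qed

lemma integrable_perron_hat: 
  assumes "c \<ge> 1"
  shows "integrable lborel (perron_hat c)"
  using integrable_one_over_one_plus_square
  by (rule Bochner_Integration.integrable_bound) (use perron_hat_bound[OF assms] in auto)

lemma perron_kernel_inversion:
  assumes "c \<ge> 1"
  shows "(LINT t|lborel. perron_hat c t * iexp (t * u)) = 2 * pi * perron_kernel c u"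
proof -
  have eq: "complex_of_real (perron_kernel c v) * iexp (- (t * v)) =
     indicator {0<..} v *\<^sub>R exp (- (Complex c t * of_real v)) - indicator {0<..} v *\<^sub>R exp (- ((Complex c t + 1) * of_real v))" for t v
  proof (cases "v > 0")
    case True
    have "Complex c t = of_real c + \<i> * of_real t" by (simp add: complex_eq_iff)
    with True show ?thesis
      by (simp add: perron_kernel_def exp_of_real[symmetric] exp_add[symmetric] ring_distribs exp_minus exp_diff field_simps flip: exp_of_real)
  qed (simp add: perron_kernel_def max_def)
  have pos: "Re (Complex c t) > 0" "Re (Complex c t + 1) > 0" for t using assms by auto
  note I = integral_exp_half_line[OF pos(1)] integral_exp_half_line[OF pos(2)]
  have hat: "(LINT v|lborel. complex_of_real (perron_kernel c v) * iexp (- (t * v))) = perron_hat c t" for t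
  proof -
    have nz: "Complex c t \<noteq> 0" "Complex c t + 1 \<noteq> 0"
      using assms by (auto simp: complex_eq_iff)
    show ?thesis unfolding eq perron_hat_def
      using nz by (subst Bochner_Integration.integral_diff) (auto simp: I divide_simps)
  qed
  have int: "integrable lborel (\<lambda>v. complex_of_real (perron_kernel c v))"
    using Bochner_Integration.integrable_diff[OF I(1)[of 0] I(3)[of 0]] eq[of _ 0] by simp
  have bnd: "norm (complex_of_real (perron_kernel c v)) \<le> 1" for v
  proof -
    have "\<bar>1 - exp (- max v 0)\<bar> * \<bar>exp (- (c * max v 0))\<bar> \<le> 1 * 1"
      using assms by (intro mult_mono) auto
    then show ?thesis unfolding norm_of_real by (simp add: perron_kernel_def abs_mult)
  qed
  have cont: "continuous_on UNIV (\<lambda>v. complex_of_real (perron_kernel c v))"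
    unfolding perron_kernel_def by (intro continuous_intros)
  show ?thesis
    using Fourier_inversion[OF cont bnd int, of u] integrable_perron_hat[OF assms] unfolding hat by simp
qed

text \<open>The measure is arbitrary so that the formula applies to counting measure, for the
  Dirichlet series, and to Lebesgue measure, for the comparison function. Fubini is immediate: the
  absolute value of the integrand is a function of x times a function of t, both integrable.\<close>

theorem perron_formula:
  fixes a w :: "'a \<Rightarrow> real"
  assumes "sigma_finite_measure M" "c \<ge> 1"
    and [measurable]: "w \<in> borel_measurable M" "a \<in> borel_measurable M"
    and int: "integrable M (\<lambda>x. a x * exp (- (c * w x)))"
  defines "A \<equiv> \<lambda>t. LINT x|M. complex_of_real (a x) * exp (- (Complex c t * of_real (w x)))"
  shows "integrable lborel (\<lambda>t. perron_hat c t * iexp (t * u) * A t)"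
    and "(LINT t|lborel. perron_hat c t * iexp (t * u) * A t) =
           2 * pi * (LINT x|M. a x * exp (- (c * w x)) * perron_kernel c (u - w x))"
proof -
  interpret M: sigma_finite_measure M by fact
  interpret P: pair_sigma_finite M lborel ..
  have C: "Complex c t = of_real c + \<i> * of_real t" for t by (simp add: complex_eq_iff)
  define f where "f x t = complex_of_real (a x * exp (- (c * w x))) * (perron_hat c t * iexp (t * (u - w x)))" for x t
  have [measurable]: "case_prod f \<in> borel_measurable (M \<Otimes>\<^sub>M lborel)"
    unfolding f_def by measurable
  have n: "norm (f x t) = \<bar>a x * exp (- (c * w x))\<bar> * norm (perron_hat c t)" for x t
    by (simp add: f_def norm_mult abs_mult)
  have "integrable (M \<Otimes>\<^sub>M lborel) (case_prod f)"
  proof (rule P.Fubini_integrable)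
    show "integrable M (\<lambda>x. LINT y|lborel. norm (case (x, y) of (x, xa) \<Rightarrow> f x xa))"
      using integrable_perron_hat[OF assms(2)] int by (simp add: n)
    show "AE x in M. integrable lborel (\<lambda>y. case (x, y) of (x, xa) \<Rightarrow> f x xa)"
    proof (rule AE_I2)
      fix x
      have "integrable lborel (\<lambda>t. norm (a x * exp (- (c * w x))) * norm (perron_hat c t))"
        using integrable_perron_hat[OF assms(2)] by simp
      then show "integrable lborel (\<lambda>y. case (x, y) of (x, xa) \<Rightarrow> f x xa)"
        by (rule Bochner_Integration.integrable_bound) (auto simp: n, simp add: f_def)
    qed
  qed measurable
  note fub = P.integrable_snd[OF this] P.Fubini_integral[OF this]
  have 1: "(LINT x|M. f x t) = perron_hat c t * iexp (t * u) * A t" for t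
  proof -
    have "f x t = (perron_hat c t * iexp (t * u)) * (complex_of_real (a x) * exp (- (Complex c t * of_real (w x))))" for x
      unfolding f_def C
      by (simp add: exp_of_real[symmetric] ring_distribs exp_diff exp_minus exp_add field_simps flip: exp_of_real)
    then show ?thesis unfolding A_def by simp
  qed
  have 2: "(LINT t|lborel. f x t) = complex_of_real (2 * pi * (a x * exp (- (c * w x)) * perron_kernel c (u - w x)))" for x
    unfolding f_def using perron_kernel_inversion[OF assms(2), of "u - w x"] by simp
  show "integrable lborel (\<lambda>t. perron_hat c t * iexp (t * u) * A t)"
    using fub(1) by (simp add: 1)
  show "(LINT t|lborel. perron_hat c t * iexp (t * u) * A t) =
           2 * pi * (LINT x|M. a x * exp (- (c * w x)) * perron_kernel c (u - w x))"
    using fub(2) unfolding 1 2 integral_complex_of_real by simp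
qed

section \<open>Euler products\<close>

text \<open>Series run over all naturals; the value 0 at 0 takes the index 0 out of them.\<close>

definition completely_multiplicative :: "(nat \<Rightarrow> complex) \<Rightarrow> bool" where
  "completely_multiplicative u \<longleftrightarrow> u 0 = 0 \<and> u 1 = 1 \<and> (\<forall>m n. u (m * n) = u m * u n)"

text \<open>The sieve of Eratosthenes: the sum of u(n) over the surviving multiples of a further
  prime q is u(q) times the sum over all survivors, so the factor 1 - u(q) deletes them.\<close>

lemma sifted_sum:
  fixes u :: "nat \<Rightarrow> complex"
  assumes u: "completely_multiplicative u" and sm: "summable (\<lambda>n. norm (u n))"
    and "finite P" "\<And>p. p \<in> P \<Longrightarrow> prime p"
  shows "(\<Sum>n. u n) * (\<Prod>p\<in>P. 1 - u p) = (\<Sum>n. if \<exists>p\<in>P. p dvd n then 0 else u n)"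
  using assms(3,4)
proof (induction P rule: finite_induct)
  case empty
  then show ?case by simp
next
  case (insert q P)
  define v where "v n = (if \<exists>p\<in>P. p dvd n then 0 else u n)" for n
  have sv: "summable v"
    by (rule summable_norm_cancel, rule summable_comparison_test'[OF sm, of 0]) (simp add: v_def)
  have q: "prime q" using insert by auto
  define w where "w n = (if q dvd n then v n else 0)" for n
  have sw: "summable w"
    by (rule summable_norm_cancel, rule summable_comparison_test'[OF sm, of 0]) (simp add: v_def w_def)
  have mono: "strict_mono (\<lambda>n. q * n)"
    using q by (intro strict_monoI) (simp add: prime_gt_0_nat)
  have "w (q * n) = u q * v n" for n
  proof -
    have "p dvd q * n \<longleftrightarrow> p dvd n" if "p \<in> P" for p
    proof -
      have "prime p" "p \<noteq> q" using insert that by auto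
      then have "coprime p q" using q by (simp add: primes_coprime)
      then show ?thesis by (simp add: coprime_dvd_mult_right_iff)
    qed
    then show ?thesis
      using u by (auto simp: w_def v_def completely_multiplicative_def)
  qed
  then have "u q * (\<Sum>n. v n) = (\<Sum>n. w (q * n))"
    using sv by (simp add: suminf_mult)
  also have "\<dots> = (\<Sum>n. w n)"
    by (rule suminf_mono_reindex[OF mono]) (auto simp: w_def image_iff)
  finally have "(1 - u q) * (\<Sum>n. v n) = (\<Sum>n. v n) - (\<Sum>n. w n)"
    by (simp add: algebra_simps)
  also have "\<dots> = (\<Sum>n. v n - w n)"
    by (rule suminf_diff[OF sv sw])
  also have "(\<lambda>n. v n - w n) = (\<lambda>n. if \<exists>p\<in>insert q P. p dvd n then 0 else u n)"
    by (auto simp: v_def w_def fun_eq_iff)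
  finally have "(1 - u q) * (\<Sum>n. v n) = (\<Sum>n. if \<exists>p\<in>insert q P. p dvd n then 0 else u n)" .
  moreover have "(\<Sum>n. u n) * (\<Prod>p\<in>P. 1 - u p) = (\<Sum>n. v n)"
    unfolding v_def using insert.IH insert.prems by blast
  moreover have "S * (\<Prod>p\<in>insert q P. 1 - u p) = (1 - u q) * (S * (\<Prod>p\<in>P. 1 - u p))" for S
    using insert.hyps by simp
  ultimately show ?case by (simp only:)
qed

text \<open>After sieving by all primes up to N only n = 1 and integers beyond N survive, so the
  deviation from 1 is at most a tail of the absolutely convergent series. Keeping the sum as a
  factor, rather than inverting the product, makes later comparisons free of division.\<close>

theorem euler_product:
  fixes u :: "nat \<Rightarrow> complex"
  assumes u: "completely_multiplicative u" and sm: "summable (\<lambda>n. norm (u n))"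
  shows "(\<lambda>N. (\<Sum>n. u n) * (\<Prod>p | prime p \<and> p \<le> N. 1 - u p)) \<longlonglongrightarrow> 1"
proof -
  let ?E = "\<lambda>N. (\<Sum>n. u n) * (\<Prod>p | prime p \<and> p \<le> N. 1 - u p)"
  define T where "T N = (\<Sum>n. norm (u n)) - (\<Sum>n<Suc N. norm (u n))" for N
  have "(\<lambda>N. \<Sum>n<N. norm (u n)) \<longlonglongrightarrow> (\<Sum>n. norm (u n))"
    using sm by (rule summable_LIMSEQ)
  then have "(\<lambda>N. \<Sum>n<Suc N. norm (u n)) \<longlonglongrightarrow> (\<Sum>n. norm (u n))"
    by (rule LIMSEQ_Suc)
  then have "T \<longlonglongrightarrow> (\<Sum>n. norm (u n)) - (\<Sum>n. norm (u n))"
    unfolding T_def by (intro tendsto_intros)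
  then have T0: "T \<longlonglongrightarrow> 0" by simp
  have "norm (?E N - 1) \<le> T N" if "N \<ge> 1" for N
  proof -
    define P where "P = {p. prime p \<and> p \<le> N}"
    have fP: "finite P" unfolding P_def by (rule finite_subset[of _ "{..N}"]) auto
    define v where "v n = (if \<exists>p\<in>P. p dvd n then 0 else u n)" for n
    define d where "d n = (if n = 1 then 1 else 0 :: complex)" for n :: nat
    have sv: "summable v"
      by (rule summable_norm_cancel, rule summable_comparison_test'[OF sm, of 0]) (simp add: v_def)
    have sd: "d sums 1" unfolding d_def using sums_single[of 1 "\<lambda>_. 1::complex"] by (simp add: eq_commute)
    have b: "norm (v n - d n) \<le> (if n < Suc N then 0 else norm (u n))" for n
    proof (cases "n \<le> 1")
      case True
      then consider "n = 0" | "n = 1" by linarith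
      then show ?thesis
        using u that by cases (auto simp: v_def d_def completely_multiplicative_def P_def)
    next
      case False
      then obtain p where "prime p" "p dvd n"
        using prime_factor_nat[of n] by auto
      moreover have "p \<le> n" using \<open>p dvd n\<close> False by (intro dvd_imp_le) auto
      ultimately show ?thesis
        using False by (auto simp: v_def d_def P_def)
    qed
    have s1: "(\<lambda>n. if n < Suc N then norm (u n) else 0) sums (\<Sum>n<Suc N. norm (u n))"
      using sums_If_finite[of "\<lambda>n. n < Suc N" "\<lambda>n. norm (u n)"] by (simp add: lessThan_def)
    have "(\<lambda>n. norm (u n) - (if n < Suc N then norm (u n) else 0)) sums T N"
      unfolding T_def by (intro sums_diff summable_sums sm s1)
    also have "(\<lambda>n. norm (u n) - (if n < Suc N then norm (u n) else 0)) = (\<lambda>n. if n < Suc N then 0 else norm (u n))"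
      by auto
    finally have s2: "(\<lambda>n. if n < Suc N then 0 else norm (u n)) sums T N" .
    have sn: "summable (\<lambda>n. norm (v n - d n))"
      by (rule summable_comparison_test'[OF sums_summable[OF s2], of 0]) (use b in auto)
    have "?E N - 1 = (\<Sum>n. v n) - (\<Sum>n. d n)"
      using sifted_sum[OF u sm fP] sd unfolding v_def P_def by (simp add: sums_iff)
    also have "\<dots> = (\<Sum>n. v n - d n)"
      by (rule suminf_diff[OF sv sums_summable[OF sd]])
    also have "norm \<dots> \<le> (\<Sum>n. norm (v n - d n))"
      by (rule summable_norm[OF sn])
    also have "\<dots> \<le> T N"
      using suminf_le[OF b sn sums_summable[OF s2]] s2 by (simp add: sums_iff)
    finally show ?thesis .
  qed
  then have "eventually (\<lambda>N. norm (?E N - 1) \<le> T N) sequentially"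
    by (auto simp: eventually_sequentially)
  then have "(\<lambda>N. ?E N - 1) \<longlonglongrightarrow> 0"
    by (rule Lim_null_comparison) (rule T0)
  then show ?thesis by (rule Lim_null[THEN iffD2])
qed

text \<open>Since \<open>0 powr z = 0\<close>, the value at n = 0 is 0 for every s, which makes this
  completely multiplicative in n.\<close>

definition npow :: "nat \<Rightarrow> complex \<Rightarrow> complex" where
  "npow n s = of_nat n powr (-s)"

lemma npow_mult: "npow (m * n) s = npow m s * npow n s"
  unfolding npow_def of_nat_mult by (rule powr_times_real) auto

lemma npow_0 [simp]: "npow 0 s = 0" and npow_1 [simp]: "npow (Suc 0) s = 1" "npow 1 s = 1"
  by (auto simp: npow_def)

lemma norm_npow: "norm (npow n s) = real n powr (- Re s)"
  unfolding npow_def by (subst norm_powr_real_powr) auto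

lemma npow_of_real: "npow n (of_real x) = of_real (real n powr (- x))"
  unfolding npow_def using powr_of_real[of "real n" "- x"] by simp

lemma npow_has_field_derivative:
  "(npow n has_field_derivative (- of_real (ln (real n)) * npow n s)) (at s)"
proof (cases "n = 0")
  case False
  have "npow n = (\<lambda>s. exp (- s * of_real (ln (real n))))"
    using False by (simp add: npow_def powr_def fun_eq_iff Ln_of_nat)
  then show ?thesis
    by (auto intro!: derivative_eq_intros)
qed (simp add: npow_def[abs_def])

lemma holomorphic_npow [holomorphic_intros]: "npow n holomorphic_on A"
  unfolding holomorphic_on_def field_differentiable_def
proof (intro ballI exI)
  show "(npow n has_field_derivative (- of_real (ln (real n)) * npow n x)) (at x within A)" for x
    by (rule has_field_derivative_at_within[OF npow_has_field_derivative])
qed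

lemma summable_npow:
  assumes "Re s > 1" "\<And>n. norm (c n) \<le> 1"
  shows "summable (\<lambda>n. norm (c n * npow n s))"
proof (rule summable_comparison_test'[of _ 0])
  show "summable (\<lambda>n. real n powr (- Re s))"
    using assms by (simp add: summable_real_powr_iff)
  show "norm (norm (c n * npow n s)) \<le> real n powr (- Re s)" for n
    using assms(2)[of n] by (simp add: norm_mult norm_npow mult_left_le_one_le)
qed

lemma summable_ln_powr:
  assumes "c > 1"
  shows "summable (\<lambda>n. ln (real n) * real n powr (- c))"
proof (rule summable_comparison_test'[of _ 0])
  \<comment> \<open>Half of the excess c - 1 pays for the logarithm via ln n \<le> n^a / a; the
    other half keeps the series convergent.\<close>
  define a where "a = (c - 1) / 2"
  have a: "a > 0" "- c = - (1 + a) - a" using assms by (auto simp: a_def field_simps)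
  show "summable (\<lambda>n. real n powr (- (1 + a)) / a)"
    using a by (intro summable_divide) (simp add: summable_real_powr_iff)
  show "norm (ln (real n) * real n powr (- c)) \<le> real n powr (- (1 + a)) / a" for n
  proof (cases "n = 0")
    case False
    then have "ln (real n) \<le> real n powr a / a" using a by (intro ln_powr_bound) auto
    then have "ln (real n) * real n powr (- c) \<le> real n powr a / a * real n powr (- c)"
      by (intro mult_right_mono) auto
    also have "\<dots> = real n powr (- (1 + a)) / a"
    proof -
      have "a + - c = - (1 + a)" using a(2) by simp
      then show ?thesis by (simp only: powr_add[symmetric] times_divide_eq_left)
    qed
    finally show ?thesis using False by (simp add: abs_mult)
  qed (use a in auto)
qed

lemma holomorphic_on_suminf:
  fixes f :: "nat \<Rightarrow> complex \<Rightarrow> complex"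
  assumes S: "open S"
    and hol: "\<And>n. f n holomorphic_on S"
    and bnd: "\<And>x. x \<in> S \<Longrightarrow> \<exists>d h. 0 < d \<and> summable h \<and> (\<forall>n. \<forall>y\<in>ball x d \<inter> S. norm (f n y) \<le> h n)"
  shows "(\<lambda>s. \<Sum>n. f n s) holomorphic_on S"
proof -
  have "\<exists>g g'. \<forall>x\<in>S. (\<lambda>n. f n x) sums g x \<and> (\<lambda>n. deriv (f n) x) sums g' x \<and> (g has_field_derivative g' x) (at x)"
  proof (rule series_and_derivative_comparison_local[OF S])
    show "(f n has_field_derivative deriv (f n) x) (at x)" if "x \<in> S" for n x
      using holomorphic_derivI[OF hol S that] .
    show "\<exists>d h. 0 < d \<and> summable h \<and> (\<forall>\<^sub>F n in sequentially. \<forall>y\<in>ball x d \<inter> S. norm (f n y) \<le> h n)" if x: "x \<in> S" for x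
    proof -
      obtain d h where "0 < d" "summable h" "\<forall>n. \<forall>y\<in>ball x d \<inter> S. norm (f n y) \<le> h n"
        using bnd[OF x] by blast
      then show ?thesis by (intro exI[of _ d] exI[of _ h]) simp
    qed
  qed
  then obtain g g' where g: "\<And>x. x \<in> S \<Longrightarrow> (\<lambda>n. f n x) sums g x \<and> (g has_field_derivative g' x) (at x)"
    by blast
  then have "g holomorphic_on S"
    using S by (auto simp: holomorphic_on_open)
  then show ?thesis
    by (rule holomorphic_transform) (use g in \<open>simp add: sums_iff\<close>)
qed

text \<open>
  An interpolation between the trivial bound \<open>2 n\<^sup>-\<^sup>\<sigma>\<close> and the mean value bound \<open>2 |s| n\<^sup>-\<^sup>\<sigma>\<^sup>-\<^sup>1\<close>; a small \<open>\<theta>\<close> yields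
  both convergence to the left of \<open>Re s = 1\<close> and slow growth in \<open>s\<close>.
\<close>

lemma powr_diff_bound:
  fixes n y :: real
  assumes "n \<ge> 1" "n \<le> y" "y \<le> n + 2" "Re s \<ge> 0" "0 \<le> \<theta>" "\<theta> \<le> 1"
  shows "norm (of_real n powr (-s) - of_real y powr (-s)) \<le> 2 * (1 + norm s) powr \<theta> * n powr (- Re s - \<theta>)"
proof -
  let ?X = "(1 + norm s) / n"
  have mono: "x powr (- a) \<le> n powr (- a)" if "x \<ge> n" "a \<ge> 0" for x a
    using assms that by (intro powr_mono2') auto
  have "norm (of_real y powr (-s) - of_real n powr (-s)) \<le> norm s * n powr (- Re s - 1) * norm (of_real y - complex_of_real n)"
  proof (rule field_differentiable_bound[where S = "closed_segment (of_real n) (of_real y)"])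
    fix z assume z: "z \<in> closed_segment (complex_of_real n) (of_real y)"
    then obtain x where x: "z = of_real x" "x \<ge> n"
      using assms(2) by (auto simp: closed_segment_of_real closed_segment_eq_real_ivl)
    have nz: "z \<notin> \<real>\<^sub>\<le>\<^sub>0" using x assms by (auto simp: complex_nonpos_Reals_iff)
    then show "((\<lambda>z. z powr (-s)) has_field_derivative (-s) * z powr (-s - 1)) (at z within closed_segment (of_real n) (of_real y))"
      by (rule has_field_derivative_at_within[OF has_field_derivative_powr])
    have "norm (z powr (-s - 1)) = x powr (- (Re s + 1))"
      using x assms by (subst norm_powr_real_powr) auto
    also have "\<dots> \<le> n powr (- (Re s + 1))" using x assms by (intro mono) auto
    finally show "norm ((-s) * z powr (-s - 1)) \<le> norm s * n powr (- Re s - 1)"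
      by (simp add: norm_mult mult_left_mono)
  qed auto
  also have "norm (of_real y - complex_of_real n) = y - n"
    using assms(2) by (simp flip: of_real_diff)
  also have "norm s * n powr (- Re s - 1) * (y - n) \<le> (1 + norm s) * n powr (- Re s - 1) * 2"
    using assms by (intro mult_mono) auto
  also have "\<dots> = 2 * n powr (- Re s) * ?X"
    using assms by (simp add: powr_diff field_simps)
  finally have 1: "norm (of_real n powr (-s) - of_real y powr (-s)) \<le> 2 * n powr (- Re s) * ?X"
    by (simp add: norm_minus_commute)
  have "norm (of_real n powr (-s) - of_real y powr (-s)) \<le> norm (of_real n powr (-s)) + norm (complex_of_real y powr (-s))"
    by (rule norm_triangle_ineq4)
  also have "\<dots> = n powr (- Re s) + y powr (- Re s)"
    using assms by (simp add: norm_powr_real_powr)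
  also have "\<dots> \<le> 2 * n powr (- Re s)" using mono[of y "Re s"] assms by simp
  finally have 2: "norm (of_real n powr (-s) - of_real y powr (-s)) \<le> 2 * n powr (- Re s) * 1" by simp
  have X0: "?X > 0" using assms by (simp add: add_pos_nonneg)
  \<comment> \<open>Up to the common factor 2 n^(-Re s), the two bounds are 1 and \<open>?X\<close>;
    the smaller one is at most any power of \<open>?X\<close> with exponent between 0 and 1.\<close>
  have "min 1 ?X \<le> ?X powr \<theta>"
  proof (cases "?X \<le> 1")
    case True
    then have "?X powr 1 \<le> ?X powr \<theta>" using X0 assms by (intro powr_mono') auto
    with X0 have "?X \<le> ?X powr \<theta>" by (simp only: powr_one) 
    then show ?thesis by (rule min.coboundedI2)
  next
    case False
    then have "1 powr \<theta> \<le> ?X powr \<theta>" using assms by (intro powr_mono2) auto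
    then show ?thesis by auto
  qed
  then have "2 * n powr (- Re s) * min 1 ?X \<le> 2 * n powr (- Re s) * ?X powr \<theta>"
    by (intro mult_left_mono) auto
  also have "?X powr \<theta> = (1 + norm s) powr \<theta> * n powr (- \<theta>)"
    using assms by (simp add: powr_divide powr_minus_divide)
  also have "2 * n powr (- Re s) * \<dots> = 2 * (1 + norm s) powr \<theta> * n powr (- Re s - \<theta>)"
    by (simp add: powr_diff powr_minus divide_inverse)
  finally show ?thesis using 1 2 by (auto simp: min_def split: if_splits)
qed

section \<open>Analytic continuation\<close>

definition chi4 :: "nat \<Rightarrow> real" where
  "chi4 n = (if n mod 4 = 1 then 1 else if n mod 4 = 3 then -1 else 0)"

definition split_number :: "nat \<Rightarrow> bool" where
  "split_number n \<longleftrightarrow> n > 0 \<and> (\<forall>p. prime p \<longrightarrow> p dvd n \<longrightarrow> p mod 4 = 1)"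

definition split_ind :: "nat \<Rightarrow> real" where
  "split_ind n = of_bool (split_number n)"

lemma split_ind_le_1: "norm (complex_of_real (split_ind n)) \<le> 1"
  by (simp add: split_ind_def)

lemma chi4_le_1: "norm (complex_of_real (chi4 n)) \<le> 1"
  by (simp add: chi4_def)

lemma chi4_mult: "chi4 (m * n) = chi4 m * chi4 n"
proof -
  have m: "m mod 4 = 0 \<or> m mod 4 = 1 \<or> m mod 4 = 2 \<or> m mod 4 = 3"
    and n: "n mod 4 = 0 \<or> n mod 4 = 1 \<or> n mod 4 = 2 \<or> n mod 4 = 3" by auto
  have "(m * n) mod 4 = (m mod 4) * (n mod 4) mod 4" by (simp add: mod_mult_eq)
  with m n show ?thesis unfolding chi4_def by (elim disjE) simp_all
qed

lemma split_number_mult: "split_number (m * n) \<longleftrightarrow> split_number m \<and> split_number n"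
  by (auto simp: split_number_def prime_dvd_mult_iff)

lemma completely_multiplicative_npow: "completely_multiplicative (\<lambda>n. npow n s)"
  by (simp add: completely_multiplicative_def npow_mult)

lemma completely_multiplicative_twist:
  assumes "c 1 = 1" "\<And>m n. c (m * n) = c m * c n"
  shows "completely_multiplicative (\<lambda>n. complex_of_real (c n) * npow n s)"
  using assms by (simp add: completely_multiplicative_def npow_mult)

lemma npow_add: "npow n (a + b) = npow n a * npow n b"
  unfolding npow_def minus_add_distrib by (rule powr_add)

lemma prime_mod_4_cases:
  assumes "prime (p::nat)"
  obtains "p = 2" | "p mod 4 = 1" "p \<noteq> 2" | "p mod 4 = 3" "p \<noteq> 2"
proof (cases "p = 2")
  case False
  then have "p > 2" using prime_ge_2_nat[OF assms] by simp
  then have "odd p" using assms by (rule prime_odd_nat[rotated])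
  then have "p mod 4 = 1 \<or> p mod 4 = 3" by presburger
  then show ?thesis using False that by blast
qed (use that in blast)

text \<open>With \<theta> = 1/16 in \<open>powr_diff_bound\<close>, the terms of the two continued
  series decay like n^(-Re s - 1/16), which is summable exactly for Re s > 15/16.\<close>

definition half_plane :: "complex set" where "half_plane = {s. Re s > 15/16}"

lemma open_half_plane: "open half_plane"
  unfolding half_plane_def by (rule open_halfspace_Re_gt)

text \<open>With n = k + 1 and s \<noteq> 1, this is (s - 1) times the difference between n^(-s) and
  the integral of y^(-s) over [n, n + 1]. The two last summands telescope over k.\<close>

definition zterm :: "nat \<Rightarrow> complex \<Rightarrow> complex" where
  "zterm k s = (s - 1) * npow (k + 1) s + npow (k + 2) (s - 1) - npow (k + 1) (s - 1)"

text \<open>Pairing the opposite signs of the character makes the series converge absolutely to the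
  left of \<open>Re s = 1\<close>.\<close>

definition lterm :: "nat \<Rightarrow> complex \<Rightarrow> complex" where
  "lterm k s = npow (4 * k + 1) s - npow (4 * k + 3) s"

definition pterm :: "nat \<Rightarrow> complex \<Rightarrow> complex" where
  "pterm p s = (if prime p \<and> p mod 4 = 3 then Ln (1 - npow p (2 * s)) else 0)"

text \<open>
  The continuations of \<open>(s - 1) \<zeta>(s)\<close> and \<open>L(s, \<chi>)\<close>, and the product of \<open>1 - p\<^sup>-\<^sup>2\<^sup>s\<close> over the primes
  \<open>p \<equiv> 3 (mod 4)\<close>.  Clearing the pole before summing makes all terms of the first series entire.
\<close>

definition zeta_cleared :: "complex \<Rightarrow> complex" where "zeta_cleared s = 1 + (\<Sum>k. zterm k s)"
definition L_chi4 :: "complex \<Rightarrow> complex" where "L_chi4 s = (\<Sum>k. lterm k s)"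
definition inert_prod :: "complex \<Rightarrow> complex" where "inert_prod s = exp (\<Sum>p. pterm p s)"
definition cleared_square :: "complex \<Rightarrow> complex" where
  "cleared_square s = zeta_cleared s * L_chi4 s * (1 - npow 2 s) * inert_prod s"

lemma holomorphic_npow_comp [holomorphic_intros]:
  "f holomorphic_on A \<Longrightarrow> (\<lambda>s. npow n (f s)) holomorphic_on A"
  using holomorphic_on_compose_gen[of f A "npow n" UNIV] holomorphic_npow by (auto simp: o_def)

text \<open>The term is an increment of the function \<open>\<phi>\<close> below over an interval of
  length 1, and the derivative (s - 1) (n^(-s) - z^(-s)) is small by
  \<open>powr_diff_bound\<close>.\<close>

lemma zterm_bound:
  assumes "Re s \<ge> 0" "0 \<le> \<theta>" "\<theta> \<le> 1"
  shows "norm (zterm k s) \<le> norm (s - 1) * (2 * (1 + norm s) powr \<theta> * real (k + 1) powr (- Re s - \<theta>))"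
proof -
  let ?n = "real (k + 1)"
  define \<phi> where "\<phi> z = (s - 1) * of_real ?n powr (-s) * z + z powr (1 - s)" for z :: complex
  have "norm (\<phi> (of_real (?n + 1)) - \<phi> (of_real ?n)) \<le> 
    (norm (s - 1) * (2 * (1 + norm s) powr \<theta> * ?n powr (- Re s - \<theta>))) * norm (of_real (?n + 1) - complex_of_real ?n)"
  proof (rule field_differentiable_bound[where S = "closed_segment (of_real ?n) (of_real (?n + 1))"])
    fix z assume z: "z \<in> closed_segment (complex_of_real ?n) (of_real (?n + 1))"
    then obtain x where x: "z = of_real x" "x \<ge> ?n" "x \<le> ?n + 1"
      unfolding closed_segment_of_real by (auto simp: closed_segment_eq_real_ivl)
    then have nz: "z \<notin> \<real>\<^sub>\<le>\<^sub>0" by (auto simp: complex_nonpos_Reals_iff)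
    have "(\<phi> has_field_derivative ((s - 1) * of_real ?n powr (-s) + (1 - s) * z powr (1 - s - 1))) (at z)"
      unfolding \<phi>_def using nz
      by (intro DERIV_add has_field_derivative_powr) (auto intro!: derivative_eq_intros)
    also have "(s - 1) * of_real ?n powr (-s) + (1 - s) * z powr (1 - s - 1) = (s - 1) * (of_real ?n powr (-s) - of_real x powr (-s))"
      by (simp add: x(1) algebra_simps)
    finally have "(\<phi> has_field_derivative (s - 1) * (of_real ?n powr (-s) - of_real (Re z) powr (-s))) (at z)"
      unfolding x(1) by simp
    then show "(\<phi> has_field_derivative (s - 1) * (of_real ?n powr (-s) - of_real (Re z) powr (-s))) (at z within closed_segment (of_real ?n) (of_real (?n + 1)))"
      by (rule has_field_derivative_at_within)
    show "norm ((s - 1) * (of_real ?n powr (-s) - of_real (Re z) powr (-s))) \<le> norm (s - 1) * (2 * (1 + norm s) powr \<theta> * ?n powr (- Re s - \<theta>))"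
      unfolding norm_mult[of "s - 1"] using x assms by (intro mult_left_mono powr_diff_bound) auto
  qed auto
  moreover have "\<phi> (of_real (?n + 1)) - \<phi> (of_real ?n) = zterm k s"
    by (simp add: \<phi>_def zterm_def npow_def algebra_simps)
  ultimately show ?thesis by simp
qed

lemma lterm_bound:
  assumes "Re s \<ge> 0" "0 \<le> \<theta>" "\<theta> \<le> 1"
  shows "norm (lterm k s) \<le> 2 * (1 + norm s) powr \<theta> * real (k + 1) powr (- Re s - \<theta>)"
proof -
  have "norm (lterm k s) \<le> 2 * (1 + norm s) powr \<theta> * real (4 * k + 1) powr (- Re s - \<theta>)"
    using powr_diff_bound[of "real (4 * k + 1)" "real (4 * k + 3)" s \<theta>] assms
    by (simp add: lterm_def npow_def)
  also have "\<dots> \<le> 2 * (1 + norm s) powr \<theta> * real (k + 1) powr (- Re s - \<theta>)"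
    using assms by (intro mult_left_mono powr_mono2') auto
  finally show ?thesis .
qed

text \<open>The primes concerned are at least 3, so |p^(-2s)| \<le> 1/3. This keeps 1 - p^(-2s) off
  the branch cut and within the range where |Ln(1 - z)| \<le> 2 |z|.\<close>

lemma pterm_bound:
  assumes "Re s \<ge> 1/2"
  shows "norm (pterm p s) \<le> 2 * real p powr (- 2 * Re s)"
    and "prime p \<Longrightarrow> p mod 4 = 3 \<Longrightarrow> norm (npow p (2 * s)) < 1 / 2"
proof -
  show *: "norm (npow p (2 * s)) < 1 / 2" if "p mod 4 = 3" for p
  proof -
    have p: "p \<ge> 3" using mod_less_eq_dividend[of p 4] that by simp
    have "norm (npow p (2 * s)) = real p powr (- (2 * Re s))" by (simp add: norm_npow)
    also have "\<dots> \<le> real p powr (-1)" using p assms by (intro powr_mono) auto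
    also have "\<dots> < 1 / 2" using p by (simp add: powr_minus_divide)
    finally show ?thesis .
  qed
  show "norm (pterm p s) \<le> 2 * real p powr (- 2 * Re s)"
    using norm_Ln_le[of "- npow p (2 * s)"] * by (auto simp: pterm_def norm_npow)
qed

lemma summable_shift_powr:
  assumes "a < -1"
  shows "summable (\<lambda>k. real (k + 1) powr a)"
  using assms summable_real_powr_iff[of a] summable_Suc_iff[of "\<lambda>k. real k powr a"] by simp

lemma half_plane_nbhd:
  assumes "x \<in> half_plane"
  obtains d where "d > 0" "d \<le> 1" "\<And>y. y \<in> ball x d \<Longrightarrow> Re y \<ge> 15/16 + d \<and> norm y \<le> norm x + 1"
proof -
  define d where "d = min 1 ((Re x - 15/16) / 2)"
  have "d > 0" "d \<le> 1" using assms by (auto simp: d_def half_plane_def)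
  moreover have "Re y \<ge> 15/16 + d \<and> norm y \<le> norm x + 1" if "y \<in> ball x d" for y
  proof -
    have n: "norm (x - y) < d" using that by (simp add: dist_norm)
    have "Re x - Re y < d" using complex_Re_le_cmod[of "x - y"] n by simp
    moreover have "d \<le> (Re x - 15/16) / 2" unfolding d_def by (rule min.cobounded2)
    moreover have "norm y \<le> norm x + norm (x - y)"
      by (metis norm_minus_commute norm_triangle_sub)
    ultimately show ?thesis using n \<open>d \<le> 1\<close> by simp
  qed
  ultimately show ?thesis using that by blast
qed

lemma holomorphic_zeta_cleared: "zeta_cleared holomorphic_on half_plane"
proof -
  have "(\<lambda>s. \<Sum>k. zterm k s) holomorphic_on half_plane"
  proof (rule holomorphic_on_suminf[OF open_half_plane])
    show "zterm n holomorphic_on half_plane" for n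
      unfolding zterm_def[abs_def] by (intro holomorphic_intros)
    fix x assume "x \<in> half_plane"
    then obtain d where d: "d > 0" "d \<le> 1" "\<And>y. y \<in> ball x d \<Longrightarrow> Re y \<ge> 15/16 + d \<and> norm y \<le> norm x + 1"
      using half_plane_nbhd by metis
    define h where "h k = (norm x + 2) * (2 * (2 + norm x) powr (1/16) * real (k + 1) powr (- (1 + d)))" for k
    have "summable h" unfolding h_def
      using d by (intro summable_mult summable_shift_powr) auto
    moreover have "norm (zterm n y) \<le> h n" if "y \<in> ball x d" for n y
    proof -
      have "norm (zterm n y) \<le> norm (y - 1) * (2 * (1 + norm y) powr (1/16) * real (n + 1) powr (- Re y - 1/16))"
        using d(1) d(3)[OF that] by (intro zterm_bound) auto
      also have "\<dots> \<le> (norm x + 2) * (2 * (2 + norm x) powr (1/16) * real (n + 1) powr (- (1 + d)))"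
        using d(3)[OF that] norm_triangle_ineq4[of y 1]
        by (intro mult_mono powr_mono2 powr_mono) auto
      finally show ?thesis unfolding h_def .
    qed
    ultimately show "\<exists>d h. 0 < d \<and> summable h \<and> (\<forall>n. \<forall>y\<in>ball x d \<inter> half_plane. norm (zterm n y) \<le> h n)"
      using d(1) by blast
  qed
  then show ?thesis unfolding zeta_cleared_def[abs_def] by (intro holomorphic_intros)
qed

lemma holomorphic_L_chi4: "L_chi4 holomorphic_on half_plane"
proof -
  have "(\<lambda>s. \<Sum>k. lterm k s) holomorphic_on half_plane"
  proof (rule holomorphic_on_suminf[OF open_half_plane])
    show "lterm n holomorphic_on half_plane" for n
      unfolding lterm_def[abs_def] by (intro holomorphic_intros)
    fix x assume "x \<in> half_plane"
    then obtain d where d: "d > 0" "d \<le> 1" "\<And>y. y \<in> ball x d \<Longrightarrow> Re y \<ge> 15/16 + d \<and> norm y \<le> norm x + 1"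
      using half_plane_nbhd by metis
    define h where "h k = 2 * (2 + norm x) powr (1/16) * real (k + 1) powr (- (1 + d))" for k
    have "summable h" unfolding h_def
      using d by (intro summable_mult summable_shift_powr) auto
    moreover have "norm (lterm n y) \<le> h n" if "y \<in> ball x d" for n y
    proof -
      have "norm (lterm n y) \<le> 2 * (1 + norm y) powr (1/16) * real (n + 1) powr (- Re y - 1/16)"
        using d(1) d(3)[OF that] by (intro lterm_bound) auto
      also have "\<dots> \<le> 2 * (2 + norm x) powr (1/16) * real (n + 1) powr (- (1 + d))"
        using d(3)[OF that]
        by (intro mult_mono powr_mono2 powr_mono) auto
      finally show ?thesis unfolding h_def .
    qed
    ultimately show "\<exists>d h. 0 < d \<and> summable h \<and> (\<forall>n. \<forall>y\<in>ball x d \<inter> half_plane. norm (lterm n y) \<le> h n)"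
      using d(1) by blast
  qed
  then show ?thesis unfolding L_chi4_def[abs_def] .
qed

lemma holomorphic_inert_prod: "inert_prod holomorphic_on half_plane"
proof -
  have "(\<lambda>s. \<Sum>k. pterm k s) holomorphic_on half_plane"
  proof (rule holomorphic_on_suminf[OF open_half_plane])
    show "pterm p holomorphic_on half_plane" for p
    proof (cases "prime p \<and> p mod 4 = 3")
      case True
      have "1 - npow p (2 * s) \<notin> \<real>\<^sub>\<le>\<^sub>0" if "s \<in> half_plane" for s
      proof -
        have "norm (npow p (2 * s)) < 1/2"
          using True that by (intro pterm_bound) (auto simp: half_plane_def)
        then have "Re (npow p (2 * s)) < 1 / 2" using complex_Re_le_cmod[of "npow p (2 * s)"] by linarith
        then show ?thesis by (auto simp: complex_nonpos_Reals_iff)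
      qed
      then show ?thesis using True
        by (auto simp: pterm_def[abs_def] intro!: holomorphic_intros)
    next
      case False
      then have "pterm p = (\<lambda>_. 0)" by (auto simp: pterm_def)
      then show ?thesis by simp
    qed
    fix x assume "x \<in> half_plane"
    define h where "h k = 2 * real k powr (- 3/2)" for k
    have "summable h" unfolding h_def
      by (intro summable_mult) (simp add: summable_real_powr_iff)
    moreover have "norm (pterm n y) \<le> h n" if "y \<in> half_plane" for n y
    proof -
      have y: "Re y > 15/16" using that by (simp add: half_plane_def)
      have "norm (pterm n y) \<le> 2 * real n powr (- 2 * Re y)"
        using y by (intro pterm_bound) auto
      also have "\<dots> \<le> h n"
        using y by (cases "n = 0") (auto simp: h_def intro!: powr_mono)
      finally show ?thesis .
    qed
    ultimately show "\<exists>d h. 0 < d \<and> summable h \<and> (\<forall>n. \<forall>y\<in>ball x d \<inter> half_plane. norm (pterm n y) \<le> h n)"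
      by (intro exI[of _ 1] exI[of _ h]) auto
  qed
  then show ?thesis unfolding inert_prod_def[abs_def] by (intro holomorphic_intros)
qed

lemma holomorphic_cleared_square: "cleared_square holomorphic_on half_plane"
  unfolding cleared_square_def[abs_def] 
  by (intro holomorphic_intros holomorphic_zeta_cleared holomorphic_L_chi4 holomorphic_inert_prod)

text \<open>Taking \<theta> = 1/16, the zeta factor and the L factor each cost |s|^(1/16), and
  clearing the pole costs one more |s|: together 9/8. On Re s \<ge> 31/32 the remaining series is
  dominated by the exponent -(31/32 + 1/16) = -33/32; the Euler product over inert primes is
  bounded.\<close>

lemma cleared_square_bound: "\<exists>C>0. \<forall>s. Re s \<ge> 31/32 \<longrightarrow> norm (cleared_square s) \<le> C * (1 + norm s) powr (9/8)"
proof -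
  define A where "A = (\<Sum>k. real (k + 1) powr (- 33/32))"
  define B where "B = (\<Sum>k. real k powr (- 3/2))"
  have sA: "summable (\<lambda>k. real (k + 1) powr (- 33/32))" by (rule summable_shift_powr) simp
  have sB: "summable (\<lambda>k. real k powr (- 3/2))" by (simp add: summable_real_powr_iff)
  have A0: "A \<ge> 0" unfolding A_def using sA by (rule suminf_nonneg) simp
  have bnd: "norm (cleared_square s) \<le> ((1 + 4 * A) * (2 * A) * 2 * exp (2 * B)) * (1 + norm s) powr (9/8)" if s: "Re s \<ge> 31/32" for s
  proof -
    define x where "x = 1 + norm s"
    have x: "x \<ge> 1" by (simp add: x_def)
    have lt: "norm (lterm k s) \<le> (2 * x powr (1/16)) * real (k + 1) powr (- 33/32)" for k
    proof -
      have "norm (lterm k s) \<le> 2 * x powr (1/16) * real (k + 1) powr (- Re s - 1/16)"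
        using s unfolding x_def by (intro lterm_bound) auto
      also have "\<dots> \<le> 2 * x powr (1/16) * real (k + 1) powr (- 33/32)"
        using s by (intro mult_left_mono powr_mono) auto
      finally show ?thesis .
    qed
    have "norm (L_chi4 s) \<le> (\<Sum>k. (2 * x powr (1/16)) * real (k + 1) powr (- 33/32))"
      unfolding L_chi4_def using lt sA by (intro norm_suminf_le summable_mult)
    also have "\<dots> = 2 * A * x powr (1/16)" unfolding A_def using sA by (simp add: suminf_mult)
    finally have L: "norm (L_chi4 s) \<le> 2 * A * x powr (1/16)" .
    have n1: "norm (s - 1) \<le> x" using norm_triangle_ineq4[of s 1] by (simp add: x_def)
    have zt: "norm (zterm k s) \<le> (2 * x * x powr (1/16)) * real (k + 1) powr (- 33/32)" for k
    proof -
      have "norm (zterm k s) \<le> norm (s - 1) * (2 * x powr (1/16) * real (k + 1) powr (- Re s - 1/16))"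
        using s unfolding x_def by (intro zterm_bound) auto
      also have "\<dots> \<le> x * (2 * x powr (1/16) * real (k + 1) powr (- 33/32))"
        using s n1 x by (intro mult_mono powr_mono) auto
      finally show ?thesis by (simp add: mult_ac)
    qed
    have "norm (\<Sum>k. zterm k s) \<le> (\<Sum>k. (2 * x * x powr (1/16)) * real (k + 1) powr (- 33/32))"
      using zt sA by (intro norm_suminf_le summable_mult)
    also have "\<dots> = 2 * A * (x * x powr (1/16))" unfolding A_def using sA by (simp add: suminf_mult)
    finally have "norm (zeta_cleared s) \<le> 1 + 2 * A * (x * x powr (1/16))"
      unfolding zeta_cleared_def using norm_triangle_ineq[of 1 "\<Sum>k. zterm k s"] by simp
    also have "\<dots> \<le> (x * x powr (1/16)) + 4 * A * (x * x powr (1/16))"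
    proof (intro add_mono mult_right_mono)
      have "1 * 1 \<le> x * x powr (1/16)" using x by (intro mult_mono ge_one_powr_ge_zero) auto
      then show "1 \<le> x * x powr (1/16)" by simp
    qed (use A0 x in auto)
    also have "\<dots> = (1 + 4 * A) * (x * x powr (1/16))" by (simp add: algebra_simps)
    finally have Z: "norm (zeta_cleared s) \<le> (1 + 4 * A) * (x * x powr (1/16))" .
    have "norm (npow 2 s) \<le> 1" using s powr_mono[of "- Re s" 0 2] by (simp add: norm_npow)
    then have n2: "norm (1 - npow 2 s) \<le> 2" using norm_triangle_ineq4[of 1 "npow 2 s"] by simp
    have pt: "norm (pterm n s) \<le> 2 * real n powr (- 3/2)" for n
    proof -
      have "norm (pterm n s) \<le> 2 * real n powr (- 2 * Re s)"
        using s by (intro pterm_bound) auto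
      also have "\<dots> \<le> 2 * real n powr (- 3/2)"
        using s by (cases "n = 0") (auto intro!: powr_mono)
      finally show ?thesis .
    qed
    have "norm (\<Sum>p. pterm p s) \<le> (\<Sum>n. 2 * real n powr (- 3/2))"
      using pt sB by (intro norm_suminf_le summable_mult)
    also have "\<dots> = 2 * B" unfolding B_def using sB by (rule suminf_mult)
    finally have "norm (inert_prod s) \<le> exp (2 * B)"
      unfolding inert_prod_def using complex_Re_le_cmod[of "\<Sum>p. pterm p s"] by simp
    then have "norm (cleared_square s) \<le> ((1 + 4 * A) * (x * x powr (1/16))) * (2 * A * x powr (1/16)) * 2 * exp (2 * B)"
      unfolding cleared_square_def norm_mult using Z L n2 A0 x by (intro mult_mono) auto
    also have "\<dots> = ((1 + 4 * A) * (2 * A) * 2 * exp (2 * B)) * (x powr 1 * x powr (1/16) * x powr (1/16))"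
      using x by simp
    also have "x powr 1 * x powr (1/16) * x powr (1/16) = x powr (9/8)"
      by (simp only: powr_add[symmetric]) simp
    finally show ?thesis unfolding x_def .
  qed
  show ?thesis
  proof (intro exI[of _ "(1 + 4 * A) * (2 * A) * 2 * exp (2 * B) + 1"] conjI allI impI)
    show "0 < (1 + 4 * A) * (2 * A) * 2 * exp (2 * B) + 1" using A0 by (simp add: add_nonneg_pos)
    fix s :: complex assume "Re s \<ge> 31/32"
    then show "norm (cleared_square s) \<le> ((1 + 4 * A) * (2 * A) * 2 * exp (2 * B) + 1) * (1 + norm s) powr (9/8)"
      using bnd[of s] by (simp add: ring_distribs add_increasing2)
  qed
qed

text \<open>Cauchy's estimate on circles of radius 1/32, which reach at most back to
  \<open>Re s = 31/32\<close>; the growth exponent is inherited.\<close>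

lemma deriv_cleared_square_bound: "\<exists>C>0. \<forall>s. Re s \<ge> 1 \<longrightarrow> norm (deriv cleared_square s) \<le> C * (1 + norm s) powr (9/8)"
proof -
  obtain C where C: "C > 0" "\<And>s. Re s \<ge> 31/32 \<Longrightarrow> norm (cleared_square s) \<le> C * (1 + norm s) powr (9/8)"
    using cleared_square_bound by blast
  have "norm (deriv cleared_square s) \<le> (32 * C * 2 powr (9/8)) * (1 + norm s) powr (9/8)" if s: "Re s \<ge> 1" for s
  proof -
    have re: "Re z \<ge> 31/32 \<and> norm z \<le> norm s + 1" if "norm (s - z) \<le> 1/32" for z
    proof -
      have "Re s - Re z \<le> 1/32" using complex_Re_le_cmod[of "s - z"] that by simp
      moreover have "norm z \<le> norm s + norm (s - z)"
        by (metis norm_minus_commute norm_triangle_sub)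
      ultimately show ?thesis using s that by linarith
    qed
    have sub: "cball s (1/32) \<subseteq> half_plane"
      using re by (force simp: half_plane_def dist_norm)
    have "norm ((deriv ^^ 1) cleared_square s) \<le> fact 1 * (C * (2 * (1 + norm s)) powr (9/8)) / (1/32) ^ 1"
    proof (rule Cauchy_inequality)
      show "cleared_square holomorphic_on ball s (1/32)" "continuous_on (cball s (1/32)) cleared_square"
        using holomorphic_on_subset[OF holomorphic_cleared_square sub] holomorphic_on_subset[OF _ ball_subset_cball]
        by (auto intro: holomorphic_on_imp_continuous_on)
      fix z assume "norm (s - z) = 1/32"
      then have z: "Re z \<ge> 31/32 \<and> norm z \<le> norm s + 1" using re by simp
      then have "norm (cleared_square z) \<le> C * (1 + norm z) powr (9/8)" using C by blast
      also have "\<dots> \<le> C * (2 * (1 + norm s)) powr (9/8)"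
      proof -
        have "1 + a \<le> 2 * (1 + b)" if "a \<le> b + 1" "0 \<le> b" for a b :: real
          using that by simp
        then have "1 + norm z \<le> 2 * (1 + norm s)" using z by (meson norm_ge_zero)
        then show ?thesis using C(1) by (intro mult_left_mono powr_mono2) auto
      qed
      finally show "norm (cleared_square z) \<le> C * (2 * (1 + norm s)) powr (9/8)" .
    qed simp
    also have "(2 * (1 + norm s)) powr (9/8) = 2 powr (9/8) * (1 + norm s) powr (9/8)"
      by (rule powr_mult)
    finally show ?thesis by (simp add: mult_ac)
  qed
  then show ?thesis using C(1) by (intro exI[of _ "32 * C * 2 powr (9/8)"]) auto
qed

section \<open>The square of the generating series\<close>

definition split_series :: "complex \<Rightarrow> complex" where
  "split_series s = (\<Sum>n. of_real (split_ind n) * npow n s)"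

text \<open>For Re s > 1 the powers n^(1-s) tend to 0, so the telescoping part of the terms sums to
  -1, and the leading 1 of \<open>zeta_cleared\<close> compensates it.\<close>

lemma zeta_cleared_eq:
  assumes "Re s > 1"
  shows "zeta_cleared s = (s - 1) * (\<Sum>n. npow n s)"
proof -
  have sm: "summable (\<lambda>n. npow n s)"
    using summable_norm_cancel[OF summable_npow[OF assms, of "\<lambda>_. 1"]] by simp
  then have "(\<lambda>n. npow n s) sums (\<Sum>n. npow n s)" by (rule summable_sums)
  then have 1: "(\<lambda>k. npow (Suc k) s) sums (\<Sum>n. npow n s)"
    by (subst sums_Suc_iff) simp
  have "(\<lambda>k. norm (npow (Suc k) (s - 1))) \<longlonglongrightarrow> 0"
    unfolding norm_npow using assms by real_asymp
  then have "(\<lambda>k. npow (Suc k) (s - 1)) \<longlonglongrightarrow> 0" by (rule tendsto_norm_zero_cancel)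
  then have "(\<lambda>k. npow (Suc (Suc k)) (s - 1) - npow (Suc k) (s - 1)) sums (0 - npow (Suc 0) (s - 1))"
    by (rule telescope_sums)
  then have "(\<lambda>k. (s - 1) * npow (Suc k) s + (npow (Suc (Suc k)) (s - 1) - npow (Suc k) (s - 1))) sums
     ((s - 1) * (\<Sum>n. npow n s) + (0 - npow (Suc 0) (s - 1)))"
    by (intro sums_add sums_mult 1)
  then have "(\<lambda>k. zterm k s) sums ((s - 1) * (\<Sum>n. npow n s) - 1)"
    by (simp add: zterm_def[abs_def] add_diff_eq)
  then show ?thesis by (simp add: zeta_cleared_def sums_iff)
qed

lemma L_chi4_eq:
  assumes "Re s > 1"
  shows "L_chi4 s = (\<Sum>n. of_real (chi4 n) * npow n s)"
proof -
  let ?f = "\<lambda>n. of_real (chi4 n) * npow n s"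
  have sm: "summable ?f"
    using summable_norm_cancel[OF summable_npow[OF assms, of "\<lambda>n. of_real (chi4 n)"]] chi4_le_1 by simp
  have "(\<lambda>n. sum ?f {n * 4..<n * 4 + 4}) sums (\<Sum>n. ?f n)"
    by (rule sums_group[OF summable_sums[OF sm]]) simp
  also have "(\<lambda>n. sum ?f {n * 4..<n * 4 + 4}) = (\<lambda>k. lterm k s)"
  proof
    fix k :: nat
    have "{k * 4..<k * 4 + 4} = {4 * k, 4 * k + 1, 4 * k + 2, 4 * k + 3}" by auto
    moreover have "chi4 (4 * k) = 0" "chi4 (4 * k + 1) = 1" "chi4 (4 * k + 2) = 0" "chi4 (4 * k + 3) = -1"
    proof -
      have "4 * k mod 4 = 0" "(4 * k + 1) mod 4 = 1" "(4 * k + 2) mod 4 = 2" "(4 * k + 3) mod 4 = 3"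
        by presburger+
      then show "chi4 (4 * k) = 0" "chi4 (4 * k + 1) = 1" "chi4 (4 * k + 2) = 0" "chi4 (4 * k + 3) = -1"
        by (simp_all only: chi4_def) simp_all
    qed
    ultimately show "sum ?f {k * 4..<k * 4 + 4} = lterm k s"
      by (simp add: lterm_def)
  qed
  finally show ?thesis by (simp add: L_chi4_def sums_iff)
qed

lemma split_number_prime:
  assumes "prime p"
  shows "split_number p \<longleftrightarrow> p mod 4 = 1"
proof
  assume "p mod 4 = 1"
  moreover have "q = p" if "prime q" "q dvd p" for q
    using that assms by (simp add: primes_dvd_imp_eq)
  ultimately show "split_number p"
    using prime_gt_0_nat[OF assms] by (auto simp: split_number_def)
qed (use assms in \<open>auto simp: split_number_def\<close>)

text \<open>At primes 1 modulo 4 all three Euler factors coincide; at primes 3 modulo 4 the left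
  side is (1 - z)(1 + z) = 1 - z^2; at 2 only the zeta factor is present.\<close>

lemma euler_factor_identity:
  assumes p: "prime p"
  shows "(1 - npow p s) * (1 - of_real (chi4 p) * npow p s) =
    (1 - of_real (split_ind p) * npow p s)\<^sup>2 * ((if p = 2 then 1 - npow 2 s else 1) *
      (if p mod 4 = 3 then 1 - npow p (2 * s) else 1))"
proof -
  have sq: "npow p (2 * s) = npow p s * npow p s"
    using npow_add[of p s s] by (simp only: mult_2)
  from p show ?thesis
  proof (cases rule: prime_mod_4_cases)
    case 1
    then have "chi4 p = 0" "split_ind p = 0"
      using split_number_prime[OF p] by (simp_all add: chi4_def split_ind_def)
    then show ?thesis using 1 by simp
  next
    case 2
    then have "chi4 p = 1" "split_ind p = 1"
      using split_number_prime[OF p] by (simp_all add: chi4_def split_ind_def)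
    then show ?thesis using 2 by (simp add: power2_eq_square)
  next
    case 3
    then have "chi4 p = -1" "split_ind p = 0"
      using split_number_prime[OF p] by (simp_all add: chi4_def split_ind_def)
    then show ?thesis using 3 by (simp add: sq ring_distribs)
  qed
qed

lemma inert_prod_product:
  assumes "Re s \<ge> 1/2" "summable (\<lambda>p. pterm p s)"
  shows "(\<lambda>N. \<Prod>p | prime p \<and> p \<le> N. if p mod 4 = 3 then 1 - npow p (2 * s) else 1) \<longlonglongrightarrow> inert_prod s"
proof -
  have "(\<lambda>N. \<Sum>p<Suc N. pterm p s) \<longlonglongrightarrow> (\<Sum>p. pterm p s)"
    by (rule LIMSEQ_Suc[OF summable_LIMSEQ[OF assms(2)]])
  then have "(\<lambda>N. exp (\<Sum>p<Suc N. pterm p s)) \<longlonglongrightarrow> inert_prod s"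
    unfolding inert_prod_def by (rule tendsto_exp)
  moreover have "exp (\<Sum>p<Suc N. pterm p s) = (\<Prod>p | prime p \<and> p \<le> N. if p mod 4 = 3 then 1 - npow p (2 * s) else 1)" for N
  proof -
    have e: "exp (pterm p s) = (if prime p \<and> p mod 4 = 3 then 1 - npow p (2 * s) else 1)" for p
    proof (cases "prime p \<and> p mod 4 = 3")
      case True
      then have "norm (npow p (2 * s)) < 1/2" using assms(1) by (intro pterm_bound) auto
      then have "npow p (2 * s) \<noteq> 1" by auto
      then show ?thesis using True by (simp add: pterm_def)
    qed (auto simp: pterm_def)
    have "exp (\<Sum>p<Suc N. pterm p s) = (\<Prod>p<Suc N. exp (pterm p s))"
      by (rule exp_sum) simp
    also have "\<dots> = (\<Prod>p | prime p \<and> p \<le> N. if p mod 4 = 3 then 1 - npow p (2 * s) else 1)"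
      unfolding e by (rule prod.mono_neutral_cong_right) auto
    finally show ?thesis .
  qed
  ultimately show ?thesis by simp
qed

lemma summable_pterm:
  assumes "Re s > 1/2"
  shows "summable (\<lambda>p. pterm p s)"
proof (rule summable_norm_cancel, rule summable_comparison_test'[of _ 0])
  show "summable (\<lambda>p. 2 * real p powr (- 2 * Re s))"
    using assms by (intro summable_mult) (simp add: summable_real_powr_iff)
  show "norm (norm (pterm p s)) \<le> 2 * real p powr (- 2 * Re s)" for p
    using pterm_bound(1)[of s p] assms by simp
qed

lemma euler_product_split_series:
  assumes "Re s > 1"
  shows "(\<lambda>N. split_series s * (\<Prod>p | prime p \<and> p \<le> N. 1 - of_real (split_ind p) * npow p s)) \<longlonglongrightarrow> 1"
  unfolding split_series_def
proof (rule euler_product)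
  show "completely_multiplicative (\<lambda>n. complex_of_real (split_ind n) * npow n s)"
    by (rule completely_multiplicative_twist) (auto simp: split_ind_def split_number_mult, simp add: split_number_def)
  show "summable (\<lambda>n. norm (complex_of_real (split_ind n) * npow n s))"
    by (rule summable_npow[OF assms split_ind_le_1])
qed

text \<open>The truncated products of zeta and L, each multiplied by its sum, tend to 1, so after
  multiplication by F^2 the limit is F^2. Regrouping the same finite products factor by factor lets
  F absorb its own truncated product twice, and the other side of the identity appears as the
  limit.\<close>

lemma split_series_squared:
  assumes s: "Re s > 1"
  shows "(split_series s)\<^sup>2 * (s - 1) = cleared_square s"
proof -
  define PN where "PN N = {p. prime p \<and> p \<le> N}" for N :: nat
  have fin: "finite (PN N)" for N by (rule finite_subset[of _ "{..N}"]) (auto simp: PN_def)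
  define a where "a N = (\<Prod>p\<in>PN N. 1 - of_real (split_ind p) * npow p s)" for N
  define P where "P N = (\<Prod>p\<in>PN N. if p mod 4 = 3 then 1 - npow p (2 * s) else 1)" for N
  define z where "z = (\<Sum>n. npow n s)"
  have F: "(\<lambda>N. split_series s * a N) \<longlonglongrightarrow> 1"
    unfolding a_def PN_def by (rule euler_product_split_series[OF s])
  have Z: "(\<lambda>N. z * (\<Prod>p\<in>PN N. 1 - npow p s)) \<longlonglongrightarrow> 1"
    unfolding PN_def z_def using summable_npow[OF s, of "\<lambda>_. 1"]
    by (intro euler_product completely_multiplicative_npow) simp
  have L: "(\<lambda>N. L_chi4 s * (\<Prod>p\<in>PN N. 1 - of_real (chi4 p) * npow p s)) \<longlonglongrightarrow> 1"
    unfolding PN_def L_chi4_eq[OF s]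
    by (intro euler_product completely_multiplicative_twist summable_npow[OF s chi4_le_1] chi4_mult) (simp add: chi4_def)
  have P: "P \<longlonglongrightarrow> inert_prod s"
    unfolding P_def[abs_def] PN_def using s by (intro inert_prod_product summable_pterm) auto
  have "(\<lambda>N. (z * (\<Prod>p\<in>PN N. 1 - npow p s)) * (L_chi4 s * (\<Prod>p\<in>PN N. 1 - of_real (chi4 p) * npow p s)) * (split_series s)\<^sup>2) \<longlonglongrightarrow> 1 * 1 * (split_series s)\<^sup>2"
    by (intro tendsto_mult Z L tendsto_const)
  \<comment> \<open>For N < 2 the prime 2 is absent and the factor 1 - 2^(-s) would not
    occur.\<close>
  moreover have "(z * (\<Prod>p\<in>PN N. 1 - npow p s)) * (L_chi4 s * (\<Prod>p\<in>PN N. 1 - of_real (chi4 p) * npow p s)) * (split_series s)\<^sup>2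
      = z * L_chi4 s * (1 - npow 2 s) * (split_series s * a N)\<^sup>2 * P N" if "N \<ge> 2" for N
  proof -
    have "(\<Prod>p\<in>PN N. 1 - npow p s) * (\<Prod>p\<in>PN N. 1 - of_real (chi4 p) * npow p s) =
      (\<Prod>p\<in>PN N. (1 - of_real (split_ind p) * npow p s)\<^sup>2 * ((if p = 2 then 1 - npow 2 s else 1) *
      (if p mod 4 = 3 then 1 - npow p (2 * s) else 1)))"
      unfolding prod.distrib[symmetric] 
      by (intro prod.cong refl euler_factor_identity) (simp add: PN_def)
    also have "\<dots> = (a N)\<^sup>2 * ((\<Prod>p\<in>PN N. if p = 2 then 1 - npow 2 s else 1) * P N)"
      unfolding prod.distrib a_def P_def by (simp add: prod_power_distrib)
    also have "(\<Prod>p\<in>PN N. if p = 2 then 1 - npow 2 s else 1) = 1 - npow 2 s"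
      using that fin[of N] by (subst prod.delta) (auto simp: PN_def)
    finally have "(\<Prod>p\<in>PN N. 1 - npow p s) * (\<Prod>p\<in>PN N. 1 - of_real (chi4 p) * npow p s) = (a N)\<^sup>2 * ((1 - npow 2 s) * P N)" .
    moreover have "(z * A) * (L_chi4 s * B) * (split_series s)\<^sup>2 = z * L_chi4 s * (split_series s)\<^sup>2 * (A * B)" for A B
      by (simp add: mult_ac)
    ultimately show ?thesis by (simp add: power_mult_distrib mult_ac)
  qed
  ultimately have A: "(\<lambda>N. z * L_chi4 s * (1 - npow 2 s) * (split_series s * a N)\<^sup>2 * P N) \<longlonglongrightarrow> (split_series s)\<^sup>2"
    by (subst tendsto_cong[where g = "\<lambda>N. (z * (\<Prod>p\<in>PN N. 1 - npow p s)) * (L_chi4 s * (\<Prod>p\<in>PN N. 1 - of_real (chi4 p) * npow p s)) * (split_series s)\<^sup>2"])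
       (auto simp: eventually_sequentially intro!: exI[of _ 2])
  have B: "(\<lambda>N. z * L_chi4 s * (1 - npow 2 s) * (split_series s * a N)\<^sup>2 * P N) \<longlonglongrightarrow> z * L_chi4 s * (1 - npow 2 s) * 1\<^sup>2 * inert_prod s"
    by (intro tendsto_intros F P)
  have "(split_series s)\<^sup>2 = z * L_chi4 s * (1 - npow 2 s) * inert_prod s"
    using LIMSEQ_unique[OF A B] by simp
  then show ?thesis
    using zeta_cleared_eq[OF s] by (simp add: cleared_square_def z_def mult_ac)
qed

section \<open>Values of the continued functions at 1\<close>

lemma zeta_cleared_1: "zeta_cleared 1 = 1"
proof -
  have "npow (Suc k) 0 = 1" for k by (simp add: npow_def del: of_nat_Suc)
  then have "zterm k 1 = 0" for k by (simp add: zterm_def)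
  then show ?thesis by (simp add: zeta_cleared_def)
qed

text \<open>Leibniz' series 1 - 1/3 + 1/5 - ... for pi/4, taken two terms at a time, has exactly the
  terms \<open>lterm k 1\<close>.\<close>

lemma L_chi4_1: "L_chi4 1 = of_real (pi / 4)"
proof -
  let ?f = "\<lambda>k. (-1) ^ k * 1 / real (k * 2 + 1)"
  have "summable ?f" using summable_arctan_series[of 1] by simp
  then have "?f sums (pi / 4)" unfolding pi_series by (rule summable_sums)
  then have "(\<lambda>n. sum ?f {n * 2..<n * 2 + 2}) sums (pi / 4)"
    by (rule sums_group) simp
  then have "(\<lambda>n. complex_of_real (sum ?f {n * 2..<n * 2 + 2})) sums of_real (pi / 4)"
    by (rule sums_of_real)
  also have "(\<lambda>n. complex_of_real (sum ?f {n * 2..<n * 2 + 2})) = (\<lambda>k. lterm k 1)"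
  proof
    fix k :: nat
    have "{k * 2..<k * 2 + 2} = {2 * k, 2 * k + 1}" by auto
    then have "sum ?f {k * 2..<k * 2 + 2} = real (4 * k + 1) powr (-1) - real (4 * k + 3) powr (-1)"
      by (simp add: powr_minus_divide)
    moreover have "lterm k 1 = of_real (real (4 * k + 1) powr (-1) - real (4 * k + 3) powr (-1))"
      unfolding lterm_def of_real_diff npow_of_real[symmetric] by simp
    ultimately show "complex_of_real (sum ?f {k * 2..<k * 2 + 2}) = lterm k 1" by simp
  qed
  finally show ?thesis by (simp add: L_chi4_def sums_iff)
qed

text \<open>The trigonometric inequality for one Euler factor. Expanding -ln |1 - r w| for w = 1, u,
  u^2 and writing v = u^n, the n-th coefficient is r^n / n times 3 + 4 Re v + Re v^2 = 2 (1 + Re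
  v)^2.\<close>

lemma factor_3_4_1:
  fixes r :: real and u :: complex
  assumes "0 \<le> r" "r < 1" "norm u = 1"
  shows "(1 - r) ^ 3 * norm (1 - r * u) ^ 4 * norm (1 - r * u\<^sup>2) \<le> 1"
proof -
  have nr: "norm (of_real r * w) < 1" if "norm w = 1" for w :: complex
    using assms that by (simp add: norm_mult)
  have u2: "norm (u\<^sup>2) = 1" using assms by (simp add: norm_power)
  \<comment> \<open>The index n = 0 contributes 0, since division by zero gives 0.\<close>
  have L: "(\<lambda>n. Re ((of_real r * w) ^ n / of_nat n)) sums (- ln (norm (1 - of_real r * w)))" if w: "norm w = 1" for w :: complex
  proof -
    have "(\<lambda>n. (- 1) ^ Suc n / of_nat n * (- (of_real r * w)) ^ n) sums Ln (1 + (- (of_real r * w)))"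
      by (rule Ln_series) (use nr[OF w] in simp)
    then have "(\<lambda>n. - ((- 1) ^ Suc n / of_nat n * (- (of_real r * w)) ^ n)) sums (- Ln (1 - of_real r * w))"
      using sums_minus by fastforce
    moreover have "- ((- 1) ^ Suc n / of_nat n * (- (of_real r * w)) ^ n) = (of_real r * w) ^ n / of_nat n" for n
    proof -
      have "(- (of_real r * w)) ^ n = (-1) ^ n * (of_real r * w) ^ n" by (rule power_minus)
      moreover have "(-1) ^ n * (-1) ^ n = (1::complex)" by (simp flip: power_mult_distrib)
      ultimately show ?thesis by (simp add: mult.assoc[symmetric])
    qed
    ultimately have "(\<lambda>n. (of_real r * w) ^ n / of_nat n) sums (- Ln (1 - of_real r * w))" by (simp only:)
    then have "(\<lambda>n. Re ((of_real r * w) ^ n / of_nat n)) sums Re (- Ln (1 - of_real r * w))" by (rule sums_Re)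
    moreover have "1 - of_real r * w \<noteq> 0" using nr[OF w] by auto
    ultimately show ?thesis by simp
  qed
  have pos: "0 < norm (1 - of_real r * w)" if "norm w = 1" for w :: complex
    using nr[OF that] by auto
  have one: "norm (1 - complex_of_real r * 1) = 1 - r"
  proof -
    have "1 - complex_of_real r * 1 = complex_of_real (1 - r)" by simp
    then show ?thesis using assms by (simp only: norm_of_real)
  qed
  have S: "(\<lambda>n. 3 * Re ((complex_of_real r * 1) ^ n / of_nat n) + 4 * Re ((of_real r * u) ^ n / of_nat n) + Re ((of_real r * u\<^sup>2) ^ n / of_nat n))
     sums (3 * (- ln (norm (1 - complex_of_real r * 1))) + 4 * (- ln (norm (1 - of_real r * u))) + (- ln (norm (1 - of_real r * u\<^sup>2))))"
    by (intro sums_add sums_mult L[OF norm_one] L[OF assms(3)] L[OF u2])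
  have N: "0 \<le> 3 * Re ((complex_of_real r * 1) ^ n / of_nat n) + 4 * Re ((of_real r * u) ^ n / of_nat n) + Re ((of_real r * u\<^sup>2) ^ n / of_nat n)" for n
  proof -
    define v where "v = u ^ n"
    have "norm v = 1" using assms by (simp add: v_def norm_power)
    then have "(Re v)\<^sup>2 + (Im v)\<^sup>2 = 1" by (simp add: cmod_def)
    then have "Re (v\<^sup>2) = 2 * (Re v)\<^sup>2 - 1" by (simp add: power2_eq_square)
    then have "3 + 4 * Re v + Re (v\<^sup>2) = 2 * (1 + Re v)\<^sup>2" by (simp add: power2_eq_square algebra_simps)
    then have "0 \<le> (r ^ n / real n) * (3 + 4 * Re v + Re (v\<^sup>2))" using assms by simp
    also have "\<dots> = 3 * Re ((complex_of_real r * 1) ^ n / of_nat n) + 4 * Re ((of_real r * u) ^ n / of_nat n) + Re ((of_real r * u\<^sup>2) ^ n / of_nat n)"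
    proof -
      have rw: "Re ((of_real r * w) ^ n / of_nat n) = (r ^ n / real n) * Re (w ^ n)" for w
      proof -
        have "(of_real r * w) ^ n / of_nat n = (r ^ n / real n) *\<^sub>R w ^ n" by (simp add: power_mult_distrib scaleR_conv_of_real)
        then show ?thesis by (simp only: scaleR_complex.sel)
      qed
      have "(u\<^sup>2) ^ n = v\<^sup>2" by (simp add: v_def flip: power_mult, simp add: mult.commute)
      then show ?thesis unfolding rw by (simp add: v_def divide_inverse algebra_simps)
    qed
    finally show ?thesis .
  qed
  have "0 \<le> 3 * (- ln (norm (1 - complex_of_real r * 1))) + 4 * (- ln (norm (1 - of_real r * u))) + (- ln (norm (1 - of_real r * u\<^sup>2)))"
    by (rule sums_le[OF N sums_zero S])
  then have "ln ((1 - r) ^ 3 * norm (1 - r * u) ^ 4 * norm (1 - r * u\<^sup>2)) \<le> 0"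
    using pos[of u] pos[of "u\<^sup>2"] assms u2 unfolding one by (simp add: ln_mult ln_realpow)
  moreover have "0 < (1 - r) ^ 3 * norm (1 - r * u) ^ 4 * norm (1 - r * u\<^sup>2)"
    using pos[of u] pos[of "u\<^sup>2"] assms u2 by simp
  ultimately show ?thesis by (simp only: ln_le_zero_iff)
qed

text \<open>The single-factor inequality is multiplied over the split primes up to N, the other
  factors being 1; each truncated product times its value of F tends to 1 in norm.\<close>

lemma split_series_3_4_1:
  assumes c: "c > 1"
  shows "1 \<le> norm (split_series (of_real c)) ^ 3 * norm (split_series (Complex c t)) ^ 4 * norm (split_series (Complex c (2 * t)))"
proof -
  define PN where "PN N = {p. prime p \<and> p \<le> N}" for N :: nat
  define a where "a s N = (\<Prod>p\<in>PN N. 1 - of_real (split_ind p) * npow p s)" for s N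
  have F: "(\<lambda>N. norm (split_series s * a s N)) \<longlonglongrightarrow> 1" if "Re s > 1" for s
    using tendsto_norm[OF euler_product_split_series[OF that]] unfolding a_def PN_def by simp
  have lim: "(\<lambda>N. norm (split_series (of_real c) * a (of_real c) N) ^ 3 * norm (split_series (Complex c t) * a (Complex c t) N) ^ 4 *
    norm (split_series (Complex c (2 * t)) * a (Complex c (2 * t)) N)) \<longlonglongrightarrow> 1 ^ 3 * 1 ^ 4 * 1"
    using c by (intro tendsto_intros F) auto
  have "norm (a (of_real c) N) ^ 3 * norm (a (Complex c t) N) ^ 4 * norm (a (Complex c (2 * t)) N) \<le> 1" for N
  proof -
    have "norm (1 - of_real (split_ind p) * npow p (of_real c)) ^ 3 * norm (1 - of_real (split_ind p) * npow p (Complex c t)) ^ 4 *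
       norm (1 - of_real (split_ind p) * npow p (Complex c (2 * t))) \<le> 1" if "p \<in> PN N" for p
    proof (cases "split_number p")
      case True
      define r where "r = real p powr (- c)"
      define u where "u = npow p (\<i> * t)"
      have p: "p \<ge> 2" using that by (simp add: PN_def prime_ge_2_nat)
      have "r < 1" "0 \<le> r" using p c by (auto simp: r_def powr_minus_divide)
      moreover have "norm u = 1" using p by (simp add: u_def norm_npow)
      moreover have r: "npow p (of_real c) = of_real r" by (simp add: npow_of_real r_def)
      moreover have "npow p (Complex c t) = of_real r * u"
      proof -
        have "Complex c t = of_real c + \<i> * t" by (simp add: complex_eq_iff)
        then show ?thesis by (simp only: npow_add r u_def)
      qed
      moreover have "npow p (Complex c (2 * t)) = of_real r * u\<^sup>2"
      proof -
        have "Complex c (2 * t) = of_real c + (\<i> * t + \<i> * t)" by (simp add: complex_eq_iff)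
        then show ?thesis by (simp only: npow_add r u_def power2_eq_square)
      qed
      moreover have "norm (1 - complex_of_real r) = 1 - r"
      proof -
        have "1 - complex_of_real r = complex_of_real (1 - r)" by simp
        then show ?thesis using \<open>r < 1\<close> by (simp only: norm_of_real)
      qed
      ultimately show ?thesis using factor_3_4_1[of r u] True by (simp add: split_ind_def)
    qed (simp add: split_ind_def)
    then have "(\<Prod>p\<in>PN N. norm (1 - of_real (split_ind p) * npow p (of_real c)) ^ 3 * norm (1 - of_real (split_ind p) * npow p (Complex c t)) ^ 4 *
       norm (1 - of_real (split_ind p) * npow p (Complex c (2 * t)))) \<le> 1"
      by (intro prod_le_1) auto
    then show ?thesis
      by (simp add: a_def prod_norm[symmetric] prod.distrib prod_power_distrib)
  qed
  then have "norm (split_series (of_real c) * a (of_real c) N) ^ 3 * norm (split_series (Complex c t) * a (Complex c t) N) ^ 4 *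
    norm (split_series (Complex c (2 * t)) * a (Complex c (2 * t)) N) \<le>
    norm (split_series (of_real c)) ^ 3 * norm (split_series (Complex c t)) ^ 4 * norm (split_series (Complex c (2 * t)))" for N
    using mult_left_mono[of "norm (a (of_real c) N) ^ 3 * norm (a (Complex c t) N) ^ 4 * norm (a (Complex c (2 * t)) N)" 1
      "norm (split_series (of_real c)) ^ 3 * norm (split_series (Complex c t)) ^ 4 * norm (split_series (Complex c (2 * t)))"]
    by (simp add: norm_mult power_mult_distrib mult_ac)
  with lim show ?thesis
    by (intro LIMSEQ_le_const2[OF lim[simplified]]) auto
qed

section \<open>Bounds for the derivative on vertical lines\<close>

definition split_log_series :: "complex \<Rightarrow> complex" where
  "split_log_series s = (\<Sum>n. of_real (split_ind n * ln (real n)) * npow n s)"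

lemma split_series_has_field_derivative:
  assumes "Re s > 1"
  shows "(split_series has_field_derivative (- split_log_series s)) (at s)"
proof -
  define c where "c = (1 + Re s) / 2"
  have c: "c > 1" "c < Re s" using assms by (auto simp: c_def)
  define S where "S = {z. Re z > c}"
  have "open S" unfolding S_def by (rule open_halfspace_Re_gt)
  have sS: "s \<in> S" using c by (simp add: S_def)
  have "summable (\<lambda>n. real n powr (- c))" using c by (simp add: summable_real_powr_iff)
  then obtain g g' where g: "\<forall>x\<in>S. (\<lambda>n. of_real (split_ind n) * npow n x) sums g x \<and>
      (\<lambda>n. of_real (split_ind n) * (- of_real (ln (real n)) * npow n x)) sums g' x \<and> (g has_field_derivative g' x) (at x)"
  proof (rule series_and_derivative_comparison[OF \<open>open S\<close>])
    show "((\<lambda>x. of_real (split_ind n) * npow n x) has_field_derivative of_real (split_ind n) * (- of_real (ln (real n)) * npow n x)) (at x)" for n x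
      by (rule DERIV_cmult[OF npow_has_field_derivative])
    have "norm (of_real (split_ind n) * npow n x) \<le> real n powr (- c)" if "x \<in> S" for n x
    proof -
      have "norm (of_real (split_ind n) * npow n x) \<le> 1 * norm (npow n x)"
        unfolding norm_mult by (intro mult_right_mono split_ind_le_1) simp
      also have "\<dots> \<le> real n powr (- c)"
        using that by (cases "n = 0") (auto simp: norm_npow S_def intro!: powr_mono)
      finally show ?thesis .
    qed
    then show "\<forall>\<^sub>F n in sequentially. \<forall>x\<in>S. norm (of_real (split_ind n) * npow n x) \<le> real n powr (- c)"
      by simp
  qed blast
  have Fg: "split_series x = g x" if "x \<in> S" for x
    using g that by (auto simp: split_series_def sums_iff)
  have "(\<lambda>n. - (of_real (split_ind n) * (- of_real (ln (real n)) * npow n s))) sums (- g' s)"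
    using g sS by (intro sums_minus) blast
  then have "(\<lambda>n. of_real (split_ind n * ln (real n)) * npow n s) sums (- g' s)"
    by (simp add: mult.assoc)
  then have "g' s = - split_log_series s" by (simp add: split_log_series_def sums_iff)
  with g sS have "(g has_field_derivative (- split_log_series s)) (at s)" by metis
  then show ?thesis
    by (rule has_field_derivative_transform_within_open[OF _ \<open>open S\<close> sS]) (simp add: Fg)
qed

lemma cleared_square_has_field_derivative:
  assumes "s \<in> half_plane"
  shows "(cleared_square has_field_derivative deriv cleared_square s) (at s)"
  by (rule holomorphic_derivI[OF holomorphic_cleared_square open_half_plane assms])

text \<open>The derivative of F^2 (s - 1), where F' is minus the logarithmic series. Solving for
  that series leaves only quantities controlled by the continuation, apart from one division by
  F.\<close>

lemma split_series_split_log_series_relation: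
  assumes "Re s > 1"
  shows "(split_series s)\<^sup>2 - 2 * split_series s * split_log_series s * (s - 1) = deriv cleared_square s"
proof -
  let ?S = "{s. Re s > 1}"
  have "open ?S" by (rule open_halfspace_Re_gt)
  have "((\<lambda>s. (split_series s)\<^sup>2 * (s - 1)) has_field_derivative ((split_series s)\<^sup>2 - 2 * split_series s * split_log_series s * (s - 1))) (at s)"
    by (rule derivative_eq_intros split_series_has_field_derivative[OF assms] refl)+ simp
  then have "(cleared_square has_field_derivative ((split_series s)\<^sup>2 - 2 * split_series s * split_log_series s * (s - 1))) (at s)"
    by (rule has_field_derivative_transform_within_open[OF _ \<open>open ?S\<close>]) (use assms split_series_squared in auto)
  then show ?thesis by (simp add: DERIV_imp_deriv)
qed

text \<open>Squaring the inequality permits the substitution |F|^2 = |r(s)| / |s - 1| with r =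
  \<open>cleared_square\<close>. At the real point this costs (c - 1)^(-3). The other two points
  contribute |t|^(-4) and |t|^(9/8 - 1), and 5 - 9/8 = 31/8.\<close>

lemma cleared_square_lower_bound_aux:
  assumes d: "d > 0"
  shows "\<exists>K>0. \<forall>c t. 1 < c \<and> c \<le> 2 \<and> \<bar>t\<bar> \<ge> d \<longrightarrow>
     K * (c - 1) ^ 3 * (1 + \<bar>t\<bar>) powr (31/8) \<le> norm (cleared_square (Complex c t)) ^ 4"
proof -
  obtain C where C: "C > 0" "\<And>s. Re s \<ge> 31/32 \<Longrightarrow> norm (cleared_square s) \<le> C * (1 + norm s) powr (9/8)"
    using cleared_square_bound by blast
  \<comment> \<open>The largest e with |t| \<ge> e (1 + |t|) for all |t| \<ge> d.\<close>
  define e where "e = d / (1 + d)"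
  have e: "e > 0" using d by (simp add: e_def)
  define R where "R = C * 3 powr (9/8)"
  define B where "B = C * 3 powr (9/8)"
  have RB: "R > 0" "B > 0" using C by (auto simp: R_def B_def)
  show ?thesis
  proof (intro exI[of _ "e ^ 5 / (R ^ 3 * B)"] conjI allI impI)
    show "0 < e ^ 5 / (R ^ 3 * B)" using e RB by simp
    fix c t :: real assume ct: "1 < c \<and> c \<le> 2 \<and> d \<le> \<bar>t\<bar>"
    have cts: "1 < c" "c \<le> 2" "d \<le> \<bar>t\<bar>" using ct by auto
    define x where "x = 1 + \<bar>t\<bar>"
    define s where "s = Complex c t"
    define s2 where "s2 = Complex c (2 * t)"
    have x: "x \<ge> 1" by (simp add: x_def)
    have te: "\<bar>t\<bar> \<ge> e * x"
    proof -
      have "d * (1 + \<bar>t\<bar>) \<le> \<bar>t\<bar> * (1 + d)" using ct d by (simp add: algebra_simps)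
      then show ?thesis using d by (simp add: e_def x_def field_simps)
    qed
    have n: "norm (s - 1) \<ge> e * x" "norm (s2 - 1) \<ge> e * x"
    proof -
      have "\<bar>t\<bar> \<le> norm (s - 1)" using abs_Im_le_cmod[of "s - 1"] by (simp add: s_def)
      then show "norm (s - 1) \<ge> e * x" using te by simp
      have "\<bar>2 * t\<bar> \<le> norm (s2 - 1)" using abs_Im_le_cmod[of "s2 - 1"] by (simp add: s2_def)
      moreover have "\<bar>t\<bar> \<le> \<bar>2 * t\<bar>" by simp
      ultimately show "norm (s2 - 1) \<ge> e * x" using te by simp
    qed
    have ex: "e * x > 0" using e x by simp
    have rc: "norm (cleared_square (of_real c)) \<le> R"
    proof -
      have "norm (cleared_square (of_real c)) \<le> C * (1 + norm (complex_of_real c)) powr (9/8)" using ct by (intro C(2)) simp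
      also have "\<dots> \<le> C * 3 powr (9/8)" using ct C(1) by (intro mult_left_mono powr_mono2) auto
      finally show ?thesis by (simp add: R_def)
    qed
    have r2: "norm (cleared_square s2) \<le> B * x powr (9/8)"
    proof -
      have "norm s2 \<le> \<bar>c\<bar> + \<bar>2 * t\<bar>" unfolding s2_def using cmod_le[of "Complex c (2 * t)"] by simp
      then have *: "1 + norm s2 \<le> 3 * x" using cts by (simp add: x_def abs_mult)
      have "norm (cleared_square s2) \<le> C * (1 + norm s2) powr (9/8)" using ct by (intro C(2)) (simp add: s2_def)
      also have "\<dots> \<le> C * (3 * x) powr (9/8)" using * C(1) by (intro mult_left_mono powr_mono2) auto
      also have "(3 * x) powr (9/8) = 3 powr (9/8) * x powr (9/8)" by (rule powr_mult)
      finally show ?thesis by (simp add: B_def)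
    qed
    have Fsq: "norm (split_series z) ^ 2 = norm (cleared_square z) / norm (z - 1)" if "Re z > 1" for z
    proof -
      have "norm (split_series z) ^ 2 * norm (z - 1) = norm (cleared_square z)"
        unfolding split_series_squared[OF that, symmetric] by (simp add: norm_mult norm_power)
      moreover have "norm (z - 1) \<noteq> 0" using that by auto
      ultimately show ?thesis by (simp add: eq_divide_eq)
    qed
    have "1 \<le> (norm (split_series (of_real c)) ^ 3 * norm (split_series s) ^ 4 * norm (split_series s2))\<^sup>2"
      unfolding s_def s2_def using split_series_3_4_1[of c t] ct by (simp add: one_le_power)
    also have "\<dots> = (norm (split_series (of_real c)) ^ 2) ^ 3 * (norm (split_series s) ^ 2) ^ 4 * norm (split_series s2) ^ 2"
      by (simp add: power_mult_distrib flip: power_mult)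
    also have "\<dots> = (norm (cleared_square (of_real c)) / norm (complex_of_real c - 1)) ^ 3 * (norm (cleared_square s) / norm (s - 1)) ^ 4 * (norm (cleared_square s2) / norm (s2 - 1))"
      using ct by (subst (1 2 3) Fsq) (auto simp: s_def s2_def)
    also have "norm (complex_of_real c - 1) = c - 1"
    proof -
      have "complex_of_real c - 1 = complex_of_real (c - 1)" by simp
      then show ?thesis using cts by (simp only: norm_of_real)
    qed
    also have "(norm (cleared_square (of_real c)) / (c - 1)) ^ 3 * (norm (cleared_square s) / norm (s - 1)) ^ 4 * (norm (cleared_square s2) / norm (s2 - 1))
       \<le> (R / (c - 1)) ^ 3 * (norm (cleared_square s) / (e * x)) ^ 4 * (B * x powr (9/8) / (e * x))"
      using rc r2 n ex ct RB by (intro mult_mono power_mono frac_le divide_right_mono) auto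
    also have "\<dots> = norm (cleared_square s) ^ 4 * ((R ^ 3 * B / e ^ 5) * (x powr (9/8) / x ^ 5) / (c - 1) ^ 3)"
      using e x ct by (simp add: field_simps power_mult_distrib eval_nat_numeral)
    also have "x powr (9/8) / x ^ 5 = 1 / x powr (31/8)"
    proof -
      have "x ^ 5 = x powr (9/8) * x powr (31/8)"
      proof -
        have "x powr (9/8) * x powr (31/8) = x powr 5" by (simp add: powr_add[symmetric])
        also have "\<dots> = x ^ 5" using x by simp
        finally show ?thesis by (rule sym)
      qed
      then show ?thesis using x by simp
    qed
    finally have "1 \<le> norm (cleared_square s) ^ 4 * (R ^ 3 * B / e ^ 5 * (1 / x powr (31 / 8)) / (c - 1) ^ 3)" .
    then show "e ^ 5 / (R ^ 3 * B) * (c - 1) ^ 3 * (1 + \<bar>t\<bar>) powr (31 / 8) \<le> norm (cleared_square (Complex c t)) ^ 4"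
      using e RB ct x unfolding s_def[symmetric] x_def[symmetric] by (simp add: field_simps)
  qed
qed

text \<open>
  The bound of the preceding lemma degenerates as \<open>c \<rightarrow> 1\<close>; it is used at distance \<open>h\<close> from the line
  \<open>Re s = 1\<close>, with \<open>h\<close> so small that the derivative bound loses at most half of it on the way back.
\<close>

lemma cleared_square_lower_bound:
  assumes d: "d > 0"
  shows "\<exists>k>0. \<forall>c t. 1 < c \<and> c \<le> 2 \<and> \<bar>t\<bar> \<ge> d \<longrightarrow> k * (1 + \<bar>t\<bar>) powr (1/2) \<le> norm (cleared_square (Complex c t))"
proof -
  obtain K where K: "K > 0" "\<And>c t. 1 < c \<Longrightarrow> c \<le> 2 \<Longrightarrow> \<bar>t\<bar> \<ge> d \<Longrightarrow>
     K * (c - 1) ^ 3 * (1 + \<bar>t\<bar>) powr (31/8) \<le> norm (cleared_square (Complex c t)) ^ 4"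
    using cleared_square_lower_bound_aux[OF d] by blast
  obtain C where C: "C > 0" "\<And>s. Re s \<ge> 1 \<Longrightarrow> norm (deriv cleared_square s) \<le> C * (1 + norm s) powr (9/8)"
    using deriv_cleared_square_bound by blast
  define C1 where "C1 = C * 3 powr (9/8)"
  have C1: "C1 > 0" using C by (simp add: C1_def)
  \<comment> \<open>The condition on q says that (2 q C1)^4 \<le> K q^3 = k^4. Then the loss q C1 on
    the way back to the line is at most half of the gain k.\<close>
  define q where "q = min 1 (K / (16 * C1 ^ 4))"
  have q: "q > 0" "q \<le> 1" "q \<le> K / (16 * C1 ^ 4)" using K C1 by (auto simp: q_def)
  define k where "k = root 4 (K * q ^ 3)"
  have k: "k > 0" "k ^ 4 = K * q ^ 3" using K q by (auto simp: k_def)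
  have qk: "q * C1 \<le> k / 2"
  proof -
    have "(2 * q * C1) ^ 4 = q ^ 3 * (q * (16 * C1 ^ 4))" by (simp add: power_mult_distrib eval_nat_numeral)
    also have "\<dots> \<le> q ^ 3 * K" using q C1 by (intro mult_left_mono) (auto simp: field_simps)
    also have "\<dots> = k ^ 4" using k by simp
    finally have "2 * q * C1 \<le> k" using power_mono_iff[of "2 * q * C1" k 4] q C1 k by simp
    then show ?thesis by simp
  qed
  show ?thesis
  proof (intro exI[of _ "k / 2"] conjI allI impI)
    show "0 < k / 2" using k by simp
    fix c t :: real assume ct: "1 < c \<and> c \<le> 2 \<and> d \<le> \<bar>t\<bar>"
    have cts: "1 < c" "c \<le> 2" "d \<le> \<bar>t\<bar>" using ct by auto
    define x where "x = 1 + \<bar>t\<bar>"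
    have x: "x \<ge> 1" by (simp add: x_def)
    \<comment> \<open>The exponent -5/8 balances both effects: at distance h the lower bound is (h^3
      x^(31/8))^(1/4), of size x^(1/2), and moving by h changes the function by at most x^(9/8) h,
      again of size x^(1/2).\<close>
    define h where "h = q * x powr (-5/8)"
    have h0: "h > 0" using q x by (simp add: h_def)
    have "x powr (-5/8) \<le> x powr 0" using x by (intro powr_mono) auto
    then have "h \<le> 1 * 1" unfolding h_def using q x by (intro mult_mono) auto
    then have h1: "h \<le> 1" by simp
    \<comment> \<open>A point already at distance h or more stays where it is; only closer ones are
      pushed to the right.\<close>
    define c' where "c' = max c (1 + h)"
    have c': "1 < c'" "c' \<le> 2" "1 + h \<le> c'" "c \<le> c'" "c' - c \<le> h" using ct h0 h1 by (auto simp: c'_def)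
    have "(k * x powr (1/2)) ^ 4 = K * q ^ 3 * x powr 2"
      using k x by (simp add: power_mult_distrib powr_power)
    also have "x powr 2 = (x powr (-5/8)) ^ 3 * x powr (31/8)"
      using x by (simp add: powr_power powr_add[symmetric])
    also have "K * q ^ 3 * \<dots> = K * h ^ 3 * x powr (31/8)"
      by (simp add: h_def power_mult_distrib)
    also have "\<dots> \<le> K * (c' - 1) ^ 3 * x powr (31/8)"
      using K c' h0 by (intro mult_right_mono mult_left_mono power_mono) auto
    also have "\<dots> \<le> norm (cleared_square (Complex c' t)) ^ 4"
      unfolding x_def using c' ct by (intro K) auto
    finally have "k * x powr (1/2) \<le> norm (cleared_square (Complex c' t))"
      using power_mono_iff[of "k * x powr (1/2)" "norm (cleared_square (Complex c' t))" 4] k by simp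
    moreover have "norm (cleared_square (Complex c' t) - cleared_square (Complex c t)) \<le> C1 * x powr (9/8) * norm (Complex c' t - Complex c t)"
    proof (rule field_differentiable_bound[where S = "closed_segment (Complex c t) (Complex c' t)"])
      fix z assume "z \<in> closed_segment (Complex c t) (Complex c' t)"
      then obtain u where u: "0 \<le> u" "u \<le> 1" "z = (1 - u) *\<^sub>R Complex c t + u *\<^sub>R Complex c' t"
        by (auto simp: closed_segment_def)
      have Imz: "Im z = t" by (simp add: u algebra_simps)
      have Rez: "Re z = c + u * (c' - c)" by (simp add: u algebra_simps)
      have "0 \<le> u * (c' - c)" "u * (c' - c) \<le> 1 * (c' - c)"
        using u c' mult_right_mono[of u 1 "c' - c"] by simp_all
      then have z: "1 \<le> Re z" "Re z \<le> 2" using Rez ct c' by auto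
      have "z \<in> half_plane" using z by (simp add: half_plane_def)
      then show "(cleared_square has_field_derivative deriv cleared_square z) (at z within closed_segment (Complex c t) (Complex c' t))"
        by (rule has_field_derivative_at_within[OF cleared_square_has_field_derivative])
      have "norm z \<le> \<bar>Re z\<bar> + \<bar>Im z\<bar>" by (rule cmod_le)
      then have *: "1 + norm z \<le> 3 * x" using z Imz by (simp add: x_def)
      have "norm (deriv cleared_square z) \<le> C * (1 + norm z) powr (9/8)" using z by (intro C(2)) simp
      also have "\<dots> \<le> C * (3 * x) powr (9/8)" using * C(1) by (intro mult_left_mono powr_mono2) auto
      also have "(3 * x) powr (9/8) = 3 powr (9/8) * x powr (9/8)" by (rule powr_mult)
      finally show "norm (deriv cleared_square z) \<le> C1 * x powr (9/8)" by (simp add: C1_def)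
    qed auto
    moreover have "norm (Complex c' t - Complex c t) \<le> h"
    proof -
      have "Complex c' t - Complex c t = of_real (c' - c)" by (simp add: complex_eq_iff)
      then show ?thesis using c' by (simp only: norm_of_real)
    qed
    then have "C1 * x powr (9/8) * norm (Complex c' t - Complex c t) \<le> C1 * x powr (9/8) * h"
      using C1 by (intro mult_left_mono) auto
    moreover have "C1 * x powr (9/8) * h = (q * C1) * (x powr (9/8) * x powr (-5/8))" by (simp add: h_def)
    moreover have "x powr (9/8) * x powr (-5/8) = x powr (1/2)" by (simp add: powr_add[symmetric])
    moreover have "(q * C1) * x powr (1/2) \<le> (k / 2) * x powr (1/2)" using qk by (intro mult_right_mono) auto
    moreover have "norm (cleared_square (Complex c' t)) \<le> norm (cleared_square (Complex c t)) + norm (cleared_square (Complex c' t) - cleared_square (Complex c t))"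
      by (rule norm_triangle_sub)
    ultimately have "k * x powr (1/2) \<le> norm (cleared_square (Complex c t)) + (k / 2) * x powr (1/2)"
      by (smt (verit, best))
    moreover have "k * x powr (1/2) = 2 * ((k / 2) * x powr (1/2))" by simp
    ultimately show "k / 2 * (1 + \<bar>t\<bar>) powr (1/2) \<le> norm (cleared_square (Complex c t))"
      unfolding x_def[symmetric] by linarith
  qed
qed

text \<open>Exponents in terms of x = 1 + |t|: the numerator F^2 - r' is at most x^(9/8); the lower
  bound x^(1/2) for r gives |F| at least of size x^(-1/4), as |s - 1| \<le> x; and |s - 1| itself
  has size x. This yields 9/8 + 1/4 - 1 = 3/8, uniformly up to the line
  \<open>Re s = 1\<close>.\<close>

lemma split_log_series_bound_away:
  assumes d: "d > 0"
  shows "\<exists>C>0. \<forall>c t. 1 < c \<and> c \<le> 2 \<and> \<bar>t\<bar> \<ge> d \<longrightarrow> norm (split_log_series (Complex c t)) \<le> C * (1 + \<bar>t\<bar>) powr (3/8)"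
proof -
  obtain k where k: "k > 0" "\<And>c t. 1 < c \<Longrightarrow> c \<le> 2 \<Longrightarrow> \<bar>t\<bar> \<ge> d \<Longrightarrow> k * (1 + \<bar>t\<bar>) powr (1/2) \<le> norm (cleared_square (Complex c t))"
    using cleared_square_lower_bound[OF d] by blast
  obtain C where C: "C > 0" "\<And>s. Re s \<ge> 31/32 \<Longrightarrow> norm (cleared_square s) \<le> C * (1 + norm s) powr (9/8)"
    using cleared_square_bound by blast
  obtain C' where C': "C' > 0" "\<And>s. Re s \<ge> 1 \<Longrightarrow> norm (deriv cleared_square s) \<le> C' * (1 + norm s) powr (9/8)"
    using deriv_cleared_square_bound by blast
  define e where "e = d / (1 + d)"
  have e: "e > 0" using d by (simp add: e_def)
  define A where "A = (C' * 3 powr (9/8) + C * 3 powr (9/8) / e) / (2 * sqrt k * e)"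
  have A: "A > 0" using C C' e k by (simp add: A_def add_pos_pos)
  show ?thesis
  proof (intro exI[of _ A] conjI allI impI A)
    fix c t :: real assume ct: "1 < c \<and> c \<le> 2 \<and> d \<le> \<bar>t\<bar>"
    have cts: "1 < c" "c \<le> 2" "d \<le> \<bar>t\<bar>" using ct by auto
    define x where "x = 1 + \<bar>t\<bar>"
    define s where "s = Complex c t"
    have s: "Re s > 1" "Re s = c" using ct by (auto simp: s_def)
    have x: "x \<ge> 1" by (simp add: x_def)
    have "d * (1 + \<bar>t\<bar>) \<le> \<bar>t\<bar> * (1 + d)" using ct d by (simp add: algebra_simps)
    then have "e * x \<le> \<bar>t\<bar>" using d by (simp add: e_def x_def field_simps)
    then have n: "e * x \<le> norm (s - 1)" using abs_Im_le_cmod[of "s - 1"] by (simp add: s_def)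
    have nx: "norm (s - 1) \<le> x"
      using cmod_le[of "s - 1"] ct by (simp add: s_def x_def)
    have n0: "norm (s - 1) > 0" by (rule less_le_trans[OF _ n]) (use e x in simp)
    have "norm s \<le> \<bar>c\<bar> + \<bar>t\<bar>" unfolding s_def using cmod_le[of "Complex c t"] by simp
    then have *: "1 + norm s \<le> 3 * x" using cts by (simp add: x_def)
    have pw: "B * (1 + norm s) powr (9/8) \<le> (B * 3 powr (9/8)) * x powr (9/8)" if "B > 0" for B
    proof -
      have "B * (1 + norm s) powr (9/8) \<le> B * (3 * x) powr (9/8)"
        using * that by (intro mult_left_mono powr_mono2) auto
      then show ?thesis by (simp only: powr_mult mult.assoc)
    qed
    have r: "norm (cleared_square s) \<le> (C * 3 powr (9/8)) * x powr (9/8)"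
      using C(2)[of s] pw[OF C(1)] s ct by simp
    have r': "norm (deriv cleared_square s) \<le> (C' * 3 powr (9/8)) * x powr (9/8)"
      using C'(2)[of s] pw[OF C'(1)] s ct by simp
    have Fs: "norm (split_series s) ^ 2 * norm (s - 1) = norm (cleared_square s)"
      unfolding split_series_squared[OF s(1), symmetric] by (simp add: norm_mult norm_power)
    have F2u: "norm (split_series s) ^ 2 \<le> (C * 3 powr (9/8) / e) * x powr (9/8)"
    proof -
      have "norm (split_series s) ^ 2 * (e * 1) \<le> norm (split_series s) ^ 2 * norm (s - 1)"
      proof (intro mult_left_mono)
        have "e * 1 \<le> e * x" using e x by (intro mult_left_mono) auto
        then show "e * 1 \<le> norm (s - 1)" using n by (rule order_trans)
      qed simp
      also have "\<dots> \<le> (C * 3 powr (9/8)) * x powr (9/8)" using Fs r by simp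
      finally show ?thesis using e by (simp add: field_simps)
    qed
    have Fl: "sqrt k * x powr (-1/4) \<le> norm (split_series s)"
    proof (rule power2_le_imp_le)
      have "k * x powr (1/2) \<le> norm (split_series s) ^ 2 * x"
        using k(2)[of c t] ct Fs nx mult_left_mono[OF nx, of "norm (split_series s) ^ 2"] by (simp add: s_def x_def)
      then have "k * x powr (1/2) / x \<le> norm (split_series s) ^ 2" using x by (simp add: field_simps)
      moreover have "x powr (1/2) / x = (x powr (-1/4)) ^ 2"
        using x powr_diff[of x "1/2" 1] by (simp add: powr_power)
      ultimately have "k * (x powr (-1/4)) ^ 2 \<le> norm (split_series s) ^ 2"
        by (simp only: times_divide_eq_right[symmetric])
      moreover have "(sqrt k)\<^sup>2 = k" using k by simp
      ultimately show "(sqrt k * x powr (-1/4))\<^sup>2 \<le> (norm (split_series s))\<^sup>2"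
        by (simp only: power_mult_distrib)
    qed simp
    have "2 * split_series s * (s - 1) * split_log_series s = (split_series s)\<^sup>2 - deriv cleared_square s"
      using split_series_split_log_series_relation[OF s(1)] by (simp add: algebra_simps)
    then have "norm (2 * split_series s * (s - 1) * split_log_series s) = norm ((split_series s)\<^sup>2 - deriv cleared_square s)"
      by (rule arg_cong)
    then have "2 * norm (split_series s) * norm (s - 1) * norm (split_log_series s) = norm ((split_series s)\<^sup>2 - deriv cleared_square s)"
      by (simp only: norm_mult norm_numeral)
    also have "\<dots> \<le> norm (split_series s) ^ 2 + norm (deriv cleared_square s)"
      using norm_triangle_ineq4[of "(split_series s)\<^sup>2" "deriv cleared_square s"] by (simp add: norm_power)
    also have "\<dots> \<le> (C' * 3 powr (9/8) + C * 3 powr (9/8) / e) * x powr (9/8)"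
      using r' F2u by (simp add: ring_distribs)
    finally have up: "2 * norm (split_series s) * norm (s - 1) * norm (split_log_series s) \<le> (C' * 3 powr (9/8) + C * 3 powr (9/8) / e) * x powr (9/8)" .
    have "2 * (sqrt k * x powr (-1/4)) * (e * x) * norm (split_log_series s) \<le> 2 * norm (split_series s) * norm (s - 1) * norm (split_log_series s)"
      using Fl n e x k by (intro mult_mono) auto
    then have "(2 * sqrt k * e) * (x powr (-1/4) * x) * norm (split_log_series s) \<le> (C' * 3 powr (9/8) + C * 3 powr (9/8) / e) * x powr (9/8)"
      using up by (simp add: mult_ac)
    moreover have "x powr (-1/4) * x = x powr (3/4)" using powr_add[of x "-1/4" 1] x by simp
    then have "(2 * sqrt k * e) * (x powr (-1/4) * x) * norm (split_log_series s) = ((2 * sqrt k * e) * norm (split_log_series s)) * x powr (3/4)"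
      by (simp only: mult_ac)
    moreover have "x powr (9/8) = x powr (3/8) * x powr (3/4)"
      by (simp add: powr_add[symmetric])
    then have "(C' * 3 powr (9/8) + C * 3 powr (9/8) / e) * x powr (9/8) = ((C' * 3 powr (9/8) + C * 3 powr (9/8) / e) * x powr (3/8)) * x powr (3/4)"
      by (simp only: mult.assoc)
    ultimately have "((2 * sqrt k * e) * norm (split_log_series s)) * x powr (3/4) \<le> ((C' * 3 powr (9/8) + C * 3 powr (9/8) / e) * x powr (3/8)) * x powr (3/4)"
      by (simp only:)
    then have "(2 * sqrt k * e) * norm (split_log_series s) \<le> (C' * 3 powr (9/8) + C * 3 powr (9/8) / e) * x powr (3/8)"
      by (rule mult_right_le_imp_le) (use x in simp)
    then show "norm (split_log_series (Complex c t)) \<le> A * (1 + \<bar>t\<bar>) powr (3/8)"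
      using k e unfolding A_def s_def[symmetric] x_def[symmetric] by (simp add: field_simps)
  qed
qed

section \<open>The singularity at 1\<close>

text \<open>
  Near \<open>1\<close>, the series equals \<open>sqrt(r(s)) / sqrt(s - 1)\<close> up to a locally constant sign, which positivity on
  the real axis determines.
\<close>

lemma csqrt_quotient:
  "\<exists>a>0. \<exists>d>0. \<exists>B>0. a ^ 2 = Re (cleared_square 1) \<and> (\<forall>s. Re s > 1 \<and> norm (s - 1) < d \<longrightarrow>
     norm (split_log_series s - of_real (a / 2) / csqrt (s - 1) ^ 3) \<le> B / sqrt (norm (s - 1)))"
proof -
  have r1: "cleared_square 1 = of_real (pi / 8) * inert_prod 1"
    by (simp add: cleared_square_def zeta_cleared_1 L_chi4_1 npow_def powr_minus_divide)
  have P1: "inert_prod 1 \<in> \<real> \<and> Re (inert_prod 1) > 0"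
  proof -
    have "pterm p 1 \<in> \<real>" for p
    proof (cases "prime p \<and> p mod 4 = 3")
      case True
      have "npow p (2 * 1) = of_real (real p powr (-2))" using npow_of_real[of p 2] by simp
      moreover have "norm (npow p (2 * 1)) < 1/2" using True by (intro pterm_bound) auto
      ultimately have "real p powr (-2) < 1/2" by simp
      then have "Ln (1 - npow p (2 * 1)) = of_real (ln (1 - real p powr (-2)))"
        using \<open>npow p (2 * 1) = _\<close> Ln_of_real[of "1 - real p powr (-2)"] by simp
      then show ?thesis using True by (simp add: pterm_def)
    qed (auto simp: pterm_def)
    then have "pterm p 1 = of_real (Re (pterm p 1))" for p by (simp add: of_real_Re)
    then have "(\<Sum>p. pterm p 1) = (\<Sum>p. of_real (Re (pterm p 1)))" by (rule suminf_cong)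
    also have "\<dots> = of_real (\<Sum>p. Re (pterm p 1))"
      using summable_Re[OF summable_pterm[of 1]] by (simp add: suminf_of_real)
    finally have "inert_prod 1 = of_real (exp (\<Sum>p. Re (pterm p 1)))" by (simp add: inert_prod_def exp_of_real)
    then show ?thesis by simp
  qed
  define \<rho> where "\<rho> = Re (cleared_square 1)"
  have rr: "cleared_square 1 = of_real \<rho>" and rp: "\<rho> > 0"
    using P1 by (auto simp: r1 \<rho>_def complex_is_Real_iff complex_eq_iff)
  define a where "a = sqrt \<rho>"
  have a: "a > 0" "a ^ 2 = \<rho>" using rp by (auto simp: a_def)
  define q where "q s = csqrt (cleared_square s)" for s
  have q1: "q 1 = of_real a" using rp by (simp add: q_def rr a_def)
  have "isCont cleared_square 1"
    using holomorphic_on_imp_continuous_on[OF holomorphic_cleared_square] open_half_plane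
    by (simp add: continuous_on_eq_continuous_at half_plane_def)
  then have "((\<lambda>s. Re (cleared_square s)) \<longlongrightarrow> \<rho>) (at 1)" unfolding isCont_def \<rho>_def by (rule tendsto_Re)
  then have "eventually (\<lambda>s. Re (cleared_square s) > 0) (at 1)" using rp by (rule order_tendstoD)
  then have "eventually (\<lambda>s. Re (cleared_square s) > 0) (nhds 1)"
    using rp by (simp add: eventually_nhds_conv_at \<rho>_def)
  then obtain e where e: "e > 0" "\<And>s. dist s 1 < e \<Longrightarrow> Re (cleared_square s) > 0"
    unfolding eventually_nhds_metric by blast
  \<comment> \<open>The radius 1/32 keeps the closed disc inside \<open>half_plane\<close>; e/2
    keeps the real part of \<open>cleared_square\<close> positive, so that its square root is
    holomorphic there.\<close>
  define d where "d = min (e / 2) (1/32)"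
  have d: "d > 0" "d < e" "d \<le> 1/32" using e by (auto simp: d_def)
  have hp: "s \<in> half_plane" if "norm (s - 1) \<le> d" for s
    using abs_Re_le_cmod[of "s - 1"] that d by (simp add: half_plane_def)
  have Rp: "Re (cleared_square s) > 0" if "norm (s - 1) \<le> d" for s
    using that d by (intro e) (simp add: dist_norm)
  define q' where "q' s = deriv cleared_square s / (2 * csqrt (cleared_square s))" for s
  have qder: "(q has_field_derivative q' s) (at s)" if "norm (s - 1) \<le> d" for s
  proof -
    have nz: "cleared_square s \<notin> \<real>\<^sub>\<le>\<^sub>0" using Rp[OF that] by (auto simp: complex_nonpos_Reals_iff)
    have "((\<lambda>s. csqrt (cleared_square s)) has_field_derivative inverse (2 * csqrt (cleared_square s)) * deriv cleared_square s) (at s)"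
      by (rule DERIV_chain2[OF has_field_derivative_csqrt[OF nz] cleared_square_has_field_derivative[OF hp[OF that]]])
    moreover have "inverse (2 * csqrt (cleared_square s)) * deriv cleared_square s = q' s"
      unfolding q'_def divide_inverse by (rule mult.commute)
    moreover have "(\<lambda>s. csqrt (cleared_square s)) = q" by (simp add: q_def fun_eq_iff)
    ultimately show ?thesis by (simp only:)
  qed
  have "continuous_on (cball 1 d) q'"
  proof -
    have c1: "continuous_on (cball 1 d) (deriv cleared_square)"
      using holomorphic_on_imp_continuous_on[OF holomorphic_deriv[OF holomorphic_cleared_square open_half_plane]]
      by (rule continuous_on_subset) (auto simp: dist_norm norm_minus_commute intro!: hp)
    have c2: "continuous_on (cball 1 d) (\<lambda>s. csqrt (cleared_square s))"
      using qder unfolding q_def[abs_def]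
      by (intro continuous_at_imp_continuous_on ballI DERIV_isCont) (auto simp: dist_norm norm_minus_commute)
    have "csqrt (cleared_square s) \<noteq> 0" if "s \<in> cball 1 d" for s
      using Rp[of s] that by (auto simp: dist_norm norm_minus_commute)
    then show ?thesis unfolding q'_def by (intro continuous_on_divide c1 c2 continuous_intros) auto
  qed
  then have "compact (q' ` cball 1 d)" by (rule compact_continuous_image) simp
  then obtain B where B: "B > 0" "\<And>s. norm (s - 1) \<le> d \<Longrightarrow> norm (q' s) \<le> B"
    using compact_imp_bounded[of "q' ` cball 1 d"] unfolding bounded_pos
    by (auto simp: dist_norm norm_minus_commute)
  have qa: "norm (q s - of_real a) \<le> B * norm (s - 1)" if "norm (s - 1) \<le> d" for s
    unfolding q1[symmetric]
  proof (rule field_differentiable_bound[where S = "cball 1 d" and f' = q'])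
    show "(q has_field_derivative q' z) (at z within cball 1 d)" if "z \<in> cball 1 d" for z
      by (rule has_field_derivative_at_within[OF qder]) (use that in \<open>simp add: dist_norm norm_minus_commute\<close>)
  qed (use that B d in \<open>auto simp: dist_norm norm_minus_commute\<close>)
  \<comment> \<open>A half disc, convex and hence connected. The quotient \<open>w\<close> is
    continuous on it with w^2 = 1, so its finite range forces it to be constant.\<close>
  define V where "V = ball 1 d \<inter> {s::complex. Re s > 1}"
  have V: "open V" "connected V"
    unfolding V_def by (auto intro!: open_Int open_halfspace_Re_gt convex_connected convex_Int convex_halfspace_Re_gt)
  have Vd: "norm (s - 1) \<le> d" "Re s > 1" if "s \<in> V" for s
    using that by (auto simp: V_def dist_norm norm_minus_commute)
  define w where "w s = split_series s * csqrt (s - 1) / q s" for s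
  have q0: "q s \<noteq> 0" if "s \<in> V" for s
    using Rp[OF Vd(1)[OF that]] by (auto simp: q_def)
  have p0: "s - 1 \<notin> \<real>\<^sub>\<le>\<^sub>0" if "s \<in> V" for s
    using Vd(2)[OF that] by (auto simp: complex_nonpos_Reals_iff)
  have pder: "((\<lambda>s. csqrt (s - 1)) has_field_derivative inverse (2 * csqrt (s - 1)) * 1) (at s)" if "s \<in> V" for s
  proof -
    have "((\<lambda>s. s - 1) has_field_derivative 1) (at s)" by (auto intro!: derivative_eq_intros)
    then show ?thesis
      by (rule DERIV_chain2[where g = "\<lambda>s. s - 1", OF has_field_derivative_csqrt[OF p0[OF that]]])
  qed
  have pn: "csqrt (s - 1) \<noteq> 0" if "s \<in> V" for s using p0[OF that] by auto
  have w2: "w s = 1 \<or> w s = -1" if "s \<in> V" for s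
  proof -
    have "(w s)\<^sup>2 = 1"
      using split_series_squared[OF Vd(2)[OF that]] q0[OF that]
      by (simp add: w_def power_divide power_mult_distrib) (simp add: q_def)
    then show ?thesis by (simp add: power2_eq_1_iff)
  qed
  have wcont: "continuous_on V w"
    unfolding w_def
  proof (intro continuous_on_divide continuous_on_mult)
    show "continuous_on V split_series"
      by (intro continuous_at_imp_continuous_on ballI DERIV_isCont[OF split_series_has_field_derivative[OF Vd(2)]])
    show "continuous_on V (\<lambda>s. csqrt (s - 1))"
      by (intro continuous_at_imp_continuous_on ballI DERIV_isCont[OF pder])
    show "continuous_on V q"
      by (intro continuous_at_imp_continuous_on ballI DERIV_isCont[OF qder[OF Vd(1)]])
  qed (use q0 in auto)
  have "w ` V \<subseteq> {1, -1}" using w2 by auto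
  then have "finite (w ` V)" by (rule finite_subset) simp
  then have const: "w constant_on V"
    using continuous_finite_range_constant[OF V(2) wcont] by simp
  \<comment> \<open>A real point of the half disc: the series and sqrt(s - 1) are nonnegative there,
    and the square root \<open>q\<close> has positive real part, which excludes the sign -1.\<close>
  define s0 where "s0 = complex_of_real (1 + d / 2)"
  have s0: "s0 \<in> V" using d by (simp add: s0_def V_def dist_norm)
  have "w s0 = 1"
  proof (rule ccontr)
    assume "w s0 \<noteq> 1"
    then have "w s0 = -1" using w2[OF s0] by simp
    then have eq: "split_series s0 * csqrt (s0 - 1) = - q s0" using q0[OF s0] by (simp add: w_def field_simps)
    have "split_series s0 = of_real (\<Sum>n. split_ind n * real n powr (- (1 + d / 2)))"
    proof -
      have "summable (\<lambda>n. complex_of_real (split_ind n) * npow n s0)"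
        using summable_norm_cancel[OF summable_npow[of s0 "\<lambda>n. complex_of_real (split_ind n)"]] split_ind_le_1 d by (simp add: s0_def)
      moreover have t: "complex_of_real (split_ind n) * npow n s0 = of_real (split_ind n * real n powr (- (1 + d / 2)))" for n
        unfolding s0_def npow_of_real by simp
      ultimately show ?thesis unfolding split_series_def t
        by (subst suminf_of_real) (simp_all only: summable_of_real_iff)
    qed
    moreover have "0 \<le> (\<Sum>n. split_ind n * real n powr (- (1 + d / 2)))"
    proof (rule suminf_nonneg)
      show "summable (\<lambda>n. split_ind n * real n powr (- (1 + d / 2)))"
        by (rule summable_comparison_test'[of "\<lambda>n. real n powr (- (1 + d / 2))" 0])
           (use d in \<open>auto simp: summable_real_powr_iff split_ind_def\<close>)
    qed (simp add: split_ind_def)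
    moreover have "csqrt (s0 - 1) = of_real (sqrt (d / 2))"
    proof -
      have "s0 - 1 = complex_of_real (d / 2)" by (simp add: s0_def)
      then have "csqrt (s0 - 1) = csqrt (complex_of_real (d / 2))" by (rule arg_cong)
      also have "\<dots> = of_real (sqrt (d / 2))" by (subst csqrt_of_real_nonneg) (use d in auto)
      finally show ?thesis .
    qed
    ultimately have "Re (split_series s0 * csqrt (s0 - 1)) \<ge> 0" using d by simp
    moreover have "Re (q s0) > 0"
      using Rp[OF Vd(1)[OF s0]] by (simp add: q_def add_nonneg_pos)
    ultimately show False using eq by simp
  qed
  then have w1: "w s = 1" if "s \<in> V" for s
    using const that s0 unfolding constant_on_def by force
  have Feq: "split_series s = q s / csqrt (s - 1)" if "s \<in> V" for s
    using w1[OF that] q0[OF that] pn[OF that] by (simp add: w_def field_simps)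
  have Deq: "split_log_series s = q s / (2 * csqrt (s - 1) ^ 3) - q' s / csqrt (s - 1)" if s: "s \<in> V" for s
  proof -
    have "((\<lambda>s. q s / csqrt (s - 1)) has_field_derivative
       (q' s * csqrt (s - 1) - q s * (inverse (2 * csqrt (s - 1)) * 1)) / (csqrt (s - 1) * csqrt (s - 1))) (at s)"
      by (rule DERIV_divide[OF qder[OF Vd(1)[OF s]] pder[OF s] pn[OF s]])
    then have "(split_series has_field_derivative
       (q' s * csqrt (s - 1) - q s * (inverse (2 * csqrt (s - 1)) * 1)) / (csqrt (s - 1) * csqrt (s - 1))) (at s)"
      by (rule has_field_derivative_transform_within_open[OF _ V(1) s]) (simp add: Feq)
    from DERIV_unique[OF this split_series_has_field_derivative[OF Vd(2)[OF s]]]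
    have "split_log_series s = - ((q' s * csqrt (s - 1) - q s * (inverse (2 * csqrt (s - 1)) * 1)) / (csqrt (s - 1) * csqrt (s - 1)))"
      by simp
    also have "\<dots> = q s / (2 * csqrt (s - 1) ^ 3) - q' s / csqrt (s - 1)"
      using pn[OF s] by (simp add: field_simps power3_eq_cube)
    finally show ?thesis .
  qed
  \<comment> \<open>Replacing q(s) by q(1) = a in the first term of \<open>Deq\<close> costs O(|s -
    1|) / |s - 1|^(3/2), the same order |s - 1|^(-1/2) as the second term.\<close>
  have "norm (split_log_series s - of_real (a / 2) / csqrt (s - 1) ^ 3) \<le> 2 * B / sqrt (norm (s - 1))" if s: "Re s > 1" "norm (s - 1) < d" for s
  proof -
    have sV: "s \<in> V" using s by (simp add: V_def dist_norm norm_minus_commute)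
    define p where "p = csqrt (s - 1)"
    define y where "y = sqrt (norm (s - 1))"
    have y0: "y > 0" using s by (auto simp: y_def)
    have y2: "y ^ 2 = norm (s - 1)" by (simp add: y_def)
    have np: "norm p = y" by (simp add: p_def y_def norm_csqrt)
    have "split_log_series s - of_real (a / 2) / p ^ 3 = (q s - of_real a) / (2 * p ^ 3) - q' s / p"
      unfolding Deq[OF sV] p_def by (simp add: diff_divide_distrib)
    also have "norm \<dots> \<le> norm (q s - of_real a) / (2 * y ^ 3) + norm (q' s) / y"
      using norm_triangle_ineq4[of "(q s - of_real a) / (2 * p ^ 3)" "q' s / p"]
      by (simp add: norm_divide norm_mult norm_power np)
    also have "\<dots> \<le> (B * y ^ 2) / (2 * y ^ 3) + B / y"
      using qa[of s] B(2)[of s] s y0 unfolding y2 by (intro add_mono divide_right_mono) auto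
    also have "\<dots> \<le> 2 * B / y"
      using y0 B(1) by (simp add: field_simps eval_nat_numeral)
    finally show ?thesis by (simp add: p_def y_def)
  qed
  then show ?thesis using a d B(1) unfolding \<rho>_def
    by (intro exI[of _ a] exI[of _ d] exI[of _ "2 * B"] conjI) auto
qed

section \<open>The Laplace transform of the square root\<close>

lemma has_bochner_integral_powr_exp:
  fixes x a :: real
  assumes x: "x > 0" and a: "a > -1"
  shows "has_bochner_integral lborel (\<lambda>u. indicator {0..} u * (u powr a * exp (- (x * u)))) (Gamma (a + 1) / x powr (a + 1))"
proof -
  let ?f = "\<lambda>t::real. indicator {0..} t * (t powr a * exp (- t))"
  have "((\<lambda>t. t powr (a + 1 - 1) / exp t) has_integral Gamma (a + 1)) {0..}"
    using a by (intro Gamma_integral_real) simp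
  also have "(\<lambda>t. t powr (a + 1 - 1) / exp t) = (\<lambda>t. t powr a * exp (- t))"
    by (simp add: fun_eq_iff exp_minus divide_inverse)
  finally have "((\<lambda>t. if t \<in> {0..} then t powr a * exp (- t) else 0) has_integral Gamma (a + 1)) UNIV"
    by (subst has_integral_restrict_UNIV)
  also have "(\<lambda>t. if t \<in> {0..} then t powr a * exp (- t) else 0) = ?f"
    by (auto simp: fun_eq_iff)
  finally have "integral\<^sup>N lborel ?f = ennreal (Gamma (a + 1))"
    by (intro nn_integral_has_integral_lborel) auto
  then have "has_bochner_integral lborel ?f (Gamma (a + 1))"
    using a by (intro has_bochner_integral_nn_integral) (auto intro!: Gamma_real_nonneg)
  then have "has_bochner_integral lborel (\<lambda>u. ?f (0 + x * u)) (Gamma (a + 1) /\<^sub>R \<bar>x\<bar>)"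
    using x by (subst (asm) lborel_has_bochner_integral_real_affine_iff[of x _ _ 0]) auto
  then have "has_bochner_integral lborel (\<lambda>u. ?f (0 + x * u) * inverse (x powr a)) (Gamma (a + 1) /\<^sub>R \<bar>x\<bar> * inverse (x powr a))"
    by (rule has_bochner_integral_mult_left)
  also have "(\<lambda>u. ?f (0 + x * u) * inverse (x powr a)) = (\<lambda>u. indicator {0..} u * (u powr a * exp (- (x * u))))"
    using x by (auto simp: fun_eq_iff indicator_def zero_le_mult_iff powr_mult)
  also have "Gamma (a + 1) /\<^sub>R \<bar>x\<bar> * inverse (x powr a) = Gamma (a + 1) / x powr (a + 1)"
    using x by (simp add: powr_add divide_inverse)
  finally show ?thesis .
qed

text \<open>For real z this is a Gamma integral. For complex z put y = x - z with x real: expanding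
  exp(y u) and integrating term by term against exp(-x u) gives Gamma values that form the binomial
  series of (1 - y/x)^(-3/2) = (z/x)^(-3/2). Its convergence at |y|/x < 1 also justifies the
  interchange.\<close>

lemma sqrt_laplace:
  fixes z :: complex
  assumes z: "Re z > 0"
  shows "integrable lborel (\<lambda>u. indicator {0..} u *\<^sub>R (of_real (sqrt u) * exp (- (z * of_real u))))"
    and "(LINT u|lborel. indicator {0..} u *\<^sub>R (of_real (sqrt u) * exp (- (z * of_real u)))) = of_real (sqrt pi / 2) / csqrt z ^ 3"
proof -
  \<comment> \<open>Chosen such that x Re z = |z|^2, whence |x - z|^2 = x^2 - |z|^2 < x^2.\<close>
  define x where "x = (norm z)\<^sup>2 / Re z"
  have z0: "z \<noteq> 0" using z by auto
  have x: "x > 0" using z z0 by (simp add: x_def)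
  \<comment> \<open>The disks around large real \<open>x\<close> exhaust the half plane; expand \<open>exp (- z u)\<close> around such an \<open>x\<close>.\<close>
  define y where "y = of_real x - z"
  have nxy: "norm y < x"
  proof (rule power2_less_imp_less)
    have "(norm y)\<^sup>2 = x\<^sup>2 - 2 * x * Re z + (norm z)\<^sup>2"
      unfolding cmod_power2 by (simp add: y_def power2_eq_square algebra_simps)
    also have "x * Re z = (norm z)\<^sup>2" using z by (simp add: x_def)
    then have "x\<^sup>2 - 2 * x * Re z + (norm z)\<^sup>2 = x\<^sup>2 - (norm z)\<^sup>2" by (simp add: mult.assoc)
    also have "\<dots> < x\<^sup>2" using z0 by simp
    finally show "(norm y)\<^sup>2 < x\<^sup>2" .
  qed (use x in simp)
  define g where "g k u = indicator {0..} u * (u powr (real k + 1/2) * exp (- (x * u)))" for k :: nat and u :: real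
  have g: "has_bochner_integral lborel (g k) (Gamma (real k + 3/2) / x powr (real k + 3/2))" for k
    using has_bochner_integral_powr_exp[OF x, of "real k + 1/2"] unfolding g_def by (simp add: add.assoc)
  have Gam: "Gamma (real k + 3/2) = sqrt pi / 2 * pochhammer (3/2) k" for k
  proof -
    have G: "Gamma (3/2 :: real) = sqrt pi / 2"
    proof -
      have "(1/2 :: real) \<notin> \<int>\<^sub>\<le>\<^sub>0" by (auto elim!: nonpos_Ints_cases)
      from Gamma_plus1[OF this] show ?thesis by (simp add: Gamma_one_half_real)
    qed
    have "pochhammer (3/2 :: real) k = Gamma (3/2 + real k) / Gamma (3/2)"
      by (rule pochhammer_Gamma) (auto elim!: nonpos_Ints_cases)
    then show ?thesis unfolding G by (simp add: add.commute)
  qed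
  have binom: "(\<lambda>k. of_real (pochhammer (3/2) k / fact k) * w ^ k) sums ((1 - w) powr (-3/2))" if "norm w < 1" for w :: complex
  proof -
    have "(\<lambda>k. ((-3/2) gchoose k) * (- w) ^ k) sums ((1 + (- w)) powr (-3/2))"
      using that by (intro gen_binomial_complex) simp
    moreover have "((-3/2) gchoose k) * (- w) ^ k = of_real (pochhammer (3/2) k / fact k) * w ^ k" for k
    proof -
      have "(- w) ^ k = (-1) ^ k * w ^ k" by (rule power_minus)
      moreover have "(-1) ^ k * (-1) ^ k = (1 :: complex)" by (simp flip: power_mult_distrib)
      moreover have "((-3/2) gchoose k) = (-1) ^ k * pochhammer (3/2 :: complex) k / fact k"
        by (simp add: gbinomial_pochhammer)
      moreover have "pochhammer (3/2 :: complex) k = of_real (pochhammer (3/2) k)"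
        using pochhammer_of_real[of "3/2" k, where 'a = complex] by simp
      ultimately show ?thesis by (simp add: mult_ac)
    qed
    ultimately show ?thesis by simp
  qed
  define f where "f k u = (y ^ k / fact k) * of_real (g k u)" for k u
  have fint: "integrable lborel (f k)" for k
    unfolding f_def using g[of k] by (intro integrable_mult_right integrable_of_real) (simp add: has_bochner_integral_iff)
  have g0: "g k u \<ge> 0" for k u by (simp add: g_def)
  have fu: "(\<lambda>k. f k u) sums (indicator {0..} u *\<^sub>R (of_real (sqrt u) * exp (- (z * of_real u))))"
       and fs: "summable (\<lambda>k. norm (f k u))" for u
  proof -
    have eq: "f k u = (indicator {0..} u * (sqrt u * exp (- (x * u)))) *\<^sub>R ((y * of_real u) ^ k /\<^sub>R fact k)" for k
    proof (cases "u > 0")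
      case True
      have "u powr (real k + 1/2) = u ^ k * sqrt u" using True by (simp add: powr_add powr_realpow powr_half_sqrt)
      then show ?thesis
        using True unfolding f_def g_def by (simp add: scaleR_conv_of_real power_mult_distrib field_simps)
    next
      case False
      then show ?thesis by (cases "u = 0") (auto simp: f_def g_def)
    qed
    have "(\<lambda>k. f k u) sums ((indicator {0..} u * (sqrt u * exp (- (x * u)))) *\<^sub>R exp (y * of_real u))"
      unfolding eq by (intro sums_scaleR_right exp_converges)
    also have "(indicator {0..} u * (sqrt u * exp (- (x * u)))) *\<^sub>R exp (y * of_real u) = indicator {0..} u *\<^sub>R (of_real (sqrt u) * exp (- (z * of_real u)))"
    proof -
      have "complex_of_real (exp (- (x * u))) * exp (y * of_real u) = exp (- (z * of_real u))"
        unfolding exp_of_real[symmetric] exp_add[symmetric]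
        by (rule arg_cong[where f = exp]) (simp add: y_def algebra_simps)
      then show ?thesis by (simp add: scaleR_conv_of_real mult.assoc)
    qed
    finally show "(\<lambda>k. f k u) sums (indicator {0..} u *\<^sub>R (of_real (sqrt u) * exp (- (z * of_real u))))" .
    show "summable (\<lambda>k. norm (f k u))"
    proof -
      have "norm (f k u) = \<bar>indicator {0..} u * (sqrt u * exp (- (x * u)))\<bar> * norm ((y * of_real u) ^ k /\<^sub>R fact k)" for k
        unfolding eq by (rule norm_scaleR)
      then show ?thesis by (simp only: summable_mult summable_norm_exp)
    qed
  qed
  have xp: "x powr (real k + 3/2) = x powr (3/2) * x ^ k" for k
    using x by (simp add: powr_add powr_realpow)
  have nf: "(LINT u|lborel. norm (f k u)) = sqrt pi / 2 / x powr (3/2) * (pochhammer (3/2) k / fact k * (norm y / x) ^ k)" for k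
  proof -
    have "(LINT u|lborel. norm (f k u)) = (LINT u|lborel. (norm y ^ k / fact k) * g k u)"
      using g0 by (simp add: f_def norm_mult norm_divide norm_power)
    also have "\<dots> = (norm y ^ k / fact k) * (Gamma (real k + 3/2) / x powr (real k + 3/2))"
      using g[of k] by (simp add: has_bochner_integral_iff)
    finally show ?thesis unfolding Gam xp by (simp add: power_divide mult_ac)
  qed
  have fI: "integral\<^sup>L lborel (f k) = of_real (sqrt pi / 2 / x powr (3/2)) * (of_real (pochhammer (3/2) k / fact k) * (y / x) ^ k)" for k
  proof -
    have "integral\<^sup>L lborel (f k) = (y ^ k / fact k) * of_real (integral\<^sup>L lborel (g k))"
      unfolding f_def[abs_def] by simp
    also have "integral\<^sup>L lborel (g k) = Gamma (real k + 3/2) / x powr (real k + 3/2)"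
      using g[of k] by (simp add: has_bochner_integral_iff)
    finally show ?thesis unfolding Gam xp by (simp add: power_divide mult_ac)
  qed
  have sn: "summable (\<lambda>k. LINT u|lborel. norm (f k u))"
    unfolding nf
  proof (rule summable_mult)
    have "norm (complex_of_real (norm y / x)) < 1" using nxy x by (simp add: norm_divide)
    from sums_Re[OF binom[OF this]] show "summable (\<lambda>k. pochhammer (3/2) k / fact k * (norm y / x) ^ k)"
      unfolding of_real_power[symmetric] of_real_mult[symmetric] Re_complex_of_real by (rule sums_summable)
  qed
  have AE: "AE u in lborel. summable (\<lambda>k. norm (f k u))" using fs by simp
  have fsum: "(\<lambda>u. \<Sum>k. f k u) = (\<lambda>u. indicator {0..} u *\<^sub>R (of_real (sqrt u) * exp (- (z * of_real u))))"
    using fu by (simp add: sums_iff fun_eq_iff)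
  show "integrable lborel (\<lambda>u. indicator {0..} u *\<^sub>R (of_real (sqrt u) * exp (- (z * of_real u))))"
    using integrable_suminf[OF fint AE sn] unfolding fsum .
  have "(\<lambda>k. integral\<^sup>L lborel (f k)) sums (LINT u|lborel. indicator {0..} u *\<^sub>R (of_real (sqrt u) * exp (- (z * of_real u))))"
    using sums_integral[OF fint AE sn] unfolding fsum .
  moreover have "(\<lambda>k. integral\<^sup>L lborel (f k)) sums (of_real (sqrt pi / 2 / x powr (3/2)) * ((1 - y / x) powr (-3/2)))"
    unfolding fI using nxy x by (intro sums_mult binom) (simp add: norm_divide)
  ultimately have "(LINT u|lborel. indicator {0..} u *\<^sub>R (of_real (sqrt u) * exp (- (z * of_real u)))) =
     of_real (sqrt pi / 2 / x powr (3/2)) * ((1 - y / x) powr (-3/2))"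
    by (rule sums_unique2)
  also have "1 - y / x = z / x" using x by (simp add: y_def diff_divide_distrib)
  also have "(z / of_real x) powr (-3/2) = exp (-3/2 * (Ln z - of_real (ln x)))"
    using x z0 by (simp add: powr_def Ln_divide_of_real)
  also have "\<dots> = of_real (x powr (3/2)) / csqrt z ^ 3"
  proof -
    have "-3/2 * (Ln z - of_real (ln x)) = of_real (3/2 * ln x) - of_nat 3 * (Ln z / 2)"
      by (simp add: field_simps)
    moreover have "exp (of_real (3/2 * ln x)) = complex_of_real (x powr (3/2))"
      using x by (simp only: exp_of_real powr_def) simp
    moreover have "exp (of_nat 3 * (Ln z / 2)) = csqrt z ^ 3"
      using z0 by (simp only: exp_of_nat_mult csqrt_exp_Ln[OF z0])
    ultimately show ?thesis by (simp only: exp_diff)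
  qed
  finally show "(LINT u|lborel. indicator {0..} u *\<^sub>R (of_real (sqrt u) * exp (- (z * of_real u)))) = of_real (sqrt pi / 2) / csqrt z ^ 3"
    using x by simp
qed

section \<open>The weighted sum\<close>

text \<open>In the variable x = exp v the Perron kernel becomes the weight x - n, up to the factor
  x^(-(c+1)). Moving that factor to the other side is what costs x^2 when c is close to 1.\<close>

lemma kernel_identity:
  "exp (- (c * u)) * perron_kernel c (v - u) = exp (- ((c + 1) * v)) * max 0 (exp v - exp u)"
proof (cases "u \<le> v")
  case True
  have "exp (- (c * u)) * perron_kernel c (v - u) = (1 - exp (u - v)) * (exp (- (c * u)) * exp (- (c * (v - u))))"
    using True by (simp add: perron_kernel_def)
  also have "exp (- (c * u)) * exp (- (c * (v - u))) = exp (- (c * v))"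
    by (simp add: exp_add[symmetric] algebra_simps)
  also have "(1 - exp (u - v)) * exp (- (c * v)) = exp (- ((c + 1) * v)) * (exp v - exp u)"
    by (simp add: algebra_simps exp_add[symmetric])
  finally show ?thesis using True by simp
qed (simp add: perron_kernel_def)

lemma integrable_inverse_sqrt:
  assumes "d > 0"
  shows "integrable lborel (\<lambda>t::real. indicator {0<..<d} t * t powr (-1/2))"
proof -
  have "set_integrable lborel (einterval 0 (ereal d)) (\<lambda>t. t powr (-1/2))"
  proof (rule interval_integral_FTC_nonneg(1)[where F = "\<lambda>t. 2 * t powr (1/2)"])
    show "DERIV (\<lambda>t. 2 * t powr (1/2)) x :> x powr (-1/2)" if "0 < ereal x" for x
      using that by (auto intro!: derivative_eq_intros simp: zero_ereal_def)
    show "isCont (\<lambda>t. t powr (-1/2)) x" if "0 < ereal x" for x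
      using that by (auto intro!: continuous_intros simp: zero_ereal_def)
    have "((\<lambda>t. 2 * t powr (1/2)) \<longlongrightarrow> 0) (at_right (0::real))" by real_asymp
    then show "(((\<lambda>t. 2 * t powr (1/2)) \<circ> real_of_ereal) \<longlongrightarrow> 0) (at_right 0)"
      unfolding ereal_tendsto_simps zero_ereal_def by simp
    have "((\<lambda>t. 2 * t powr (1/2)) \<longlongrightarrow> 2 * d powr (1/2)) (at_left d)"
      using assms by (intro tendsto_intros) auto
    then show "(((\<lambda>t. 2 * t powr (1/2)) \<circ> real_of_ereal) \<longlongrightarrow> 2 * d powr (1/2)) (at_left (ereal d))"
      unfolding ereal_tendsto_simps by simp
  qed (use assms in auto)
  then show ?thesis
    by (simp add: set_integrable_def einterval_def zero_ereal_def greaterThanLessThan_def greaterThan_def lessThan_def Collect_conj_eq)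
qed

text \<open>The exponent is 3/8 - 2: growth of the logarithmic series against the decay of the
  kernel.\<close>

lemma integrable_shifted_power_tail: "integrable lborel (\<lambda>t::real. indicator {0<..} t * (1 + t) powr (-13/8))"
proof -
  have "set_integrable lborel (einterval 0 \<infinity>) (\<lambda>t. (1 + t) powr (-13/8))"
  proof (rule interval_integral_FTC_nonneg(1)[where F = "\<lambda>t. - (8/5) * (1 + t) powr (-5/8)"])
    show "DERIV (\<lambda>t. - (8/5) * (1 + t) powr (-5/8)) x :> (1 + x) powr (-13/8)" if "0 < ereal x" for x
      using that by (auto intro!: derivative_eq_intros simp: zero_ereal_def)
    show "isCont (\<lambda>t. (1 + t) powr (-13/8)) x" if "0 < ereal x" for x
      using that by (auto intro!: continuous_intros simp: zero_ereal_def)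
    have "((\<lambda>t. - (8/5) * (1 + t) powr (-5/8)) \<longlongrightarrow> - (8/5)) (at_right (0::real))" by real_asymp
    then show "(((\<lambda>t. - (8/5) * (1 + t) powr (-5/8)) \<circ> real_of_ereal) \<longlongrightarrow> - (8/5)) (at_right 0)"
      unfolding ereal_tendsto_simps zero_ereal_def by simp
    have "((\<lambda>t::real. - (8/5) * (1 + t) powr (-5/8)) \<longlongrightarrow> 0) at_top" by real_asymp
    then show "(((\<lambda>t. - (8/5) * (1 + t) powr (-5/8)) \<circ> real_of_ereal) \<longlongrightarrow> 0) (at_left \<infinity>)"
      unfolding ereal_tendsto_simps by simp
  qed auto
  then show ?thesis
    by (simp add: set_integrable_def einterval_def zero_ereal_def greaterThan_def)
qed

lemma integrable_even_extension:
  fixes h :: "real \<Rightarrow> real"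
  assumes "integrable lborel h"
  shows "integrable lborel (\<lambda>t. h t + h (- t))"
  using assms lborel_integrable_real_affine[OF assms, of "-1" 0] by simp

text \<open>Near t = 0 the remainder after subtraction is at most |s - 1|^(-1/2) \<le> |t|^(-1/2) up
  to a constant, elsewhere the bounds away from the singularity apply. Both estimates are uniform in
  c > 1; the exceptional point t = 0 is a null set.\<close>

lemma dominating_function:
  "\<exists>a>0. \<exists>d>0. \<exists>\<Phi>. a\<^sup>2 = Re (cleared_square 1) \<and> integrable lborel \<Phi> \<and>
     (\<forall>c t. 1 < c \<and> c < 1 + d \<and> t \<noteq> 0 \<longrightarrow>
       norm (perron_hat c t * (split_log_series (Complex c t) - of_real (a / 2) / csqrt (Complex c t - 1) ^ 3)) \<le> \<Phi> t)"
proof -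
  obtain a d B where a: "a > 0" "a\<^sup>2 = Re (cleared_square 1)" and d: "d > 0" and B: "B > 0"
    and near: "\<And>s. Re s > 1 \<Longrightarrow> norm (s - 1) < d \<Longrightarrow> norm (split_log_series s - of_real (a / 2) / csqrt (s - 1) ^ 3) \<le> B / sqrt (norm (s - 1))"
    using csqrt_quotient by blast
  \<comment> \<open>With c - 1 < e and |t| < e, the choice e \<le> d/2 gives |s - 1| < d, and e
    \<le> 1 keeps c \<le> 2.\<close>
  define e where "e = min 1 (d / 2)"
  have e: "e > 0" "e \<le> 1" "e \<le> d / 2" using d by (auto simp: e_def)
  obtain C where C: "C > 0" "\<And>c t. 1 < c \<Longrightarrow> c \<le> 2 \<Longrightarrow> \<bar>t\<bar> \<ge> e \<Longrightarrow> norm (split_log_series (Complex c t)) \<le> C * (1 + \<bar>t\<bar>) powr (3/8)"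
    using split_log_series_bound_away[OF e(1)] by blast
  \<comment> \<open>Bounds the subtracted term for |t| \<ge> e.\<close>
  define E where "E = (a / 2) / sqrt e ^ 3"
  have E: "E > 0" using a e by (simp add: E_def)
  \<comment> \<open>The factor 2 comes from (1 + |t|)^2 \<le> 2 (1 + t^2). The function lives on t >
    0 and is symmetrized in the next line.\<close>
  define h where "h t = B * (indicator {0<..<e} t * t powr (-1/2)) + (2 * (C + E)) * (indicator {0<..} t * (1 + t) powr (-13/8))" for t
  define \<Phi> where "\<Phi> t = h t + h (- t)" for t
  have h0: "h t \<ge> 0" for t using B C E by (auto simp: h_def)
  have Phi: "\<Phi> t \<ge> h \<bar>t\<bar>" for t
    using h0[of t] h0[of "-t"] by (cases "t \<ge> 0") (simp_all add: \<Phi>_def)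
  have "integrable lborel h"
    unfolding h_def using e
    by (intro Bochner_Integration.integrable_add integrable_mult_right integrable_inverse_sqrt integrable_shifted_power_tail)
  then have int: "integrable lborel \<Phi>"
    unfolding \<Phi>_def by (rule integrable_even_extension)
  have main: "norm (perron_hat c t * (split_log_series (Complex c t) - of_real (a / 2) / csqrt (Complex c t - 1) ^ 3)) \<le> \<Phi> t"
    if c: "1 < c" "c < 1 + e" and t: "t \<noteq> 0" for c t
  proof -
    define s where "s = Complex c t"
    define D where "D = split_log_series s - of_real (a / 2) / csqrt (s - 1) ^ 3"
    have s1: "\<bar>t\<bar> \<le> norm (s - 1)" using abs_Im_le_cmod[of "s - 1"] by (simp add: s_def)
    have s2: "norm (s - 1) \<le> (c - 1) + \<bar>t\<bar>" using cmod_le[of "s - 1"] c by (simp add: s_def)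
    have ph: "norm (perron_hat c t) \<le> 1 / (1 + t\<^sup>2)" using c by (intro perron_hat_bound) simp
    have "norm (perron_hat c t) * norm D \<le> h \<bar>t\<bar>"
    proof (cases "\<bar>t\<bar> < e")
      case True
      have "1 / (1 + t\<^sup>2) \<le> 1" by (simp add: divide_le_eq_1 add_pos_nonneg)
      then have "norm (perron_hat c t) \<le> 1" using ph by simp
      have "norm D \<le> B / sqrt (norm (s - 1))"
        unfolding D_def using c True s2 e by (intro near) (auto simp: s_def)
      also have "\<dots> \<le> B / sqrt \<bar>t\<bar>"
      proof -
        have "0 < \<bar>t\<bar>" using t by simp
        then have "0 < norm (s - 1)" using s1 by (rule less_le_trans)
        then show ?thesis using s1 t B by (intro divide_left_mono mult_pos_pos) auto
      qed
      also have "\<dots> = B * \<bar>t\<bar> powr (-1/2)" by (simp add: powr_minus_divide powr_half_sqrt)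
      finally have "norm D \<le> B * \<bar>t\<bar> powr (-1/2)" .
      then have "norm (perron_hat c t) * norm D \<le> 1 * (B * \<bar>t\<bar> powr (-1/2))"
        using \<open>norm (perron_hat c t) \<le> 1\<close> by (intro mult_mono) auto
      also have "\<dots> \<le> h \<bar>t\<bar>" using True t C E by (simp add: h_def)
      finally show ?thesis .
    next
      case False
      define x where "x = 1 + \<bar>t\<bar>"
      have x: "x \<ge> 1" by (simp add: x_def)
      have "norm (of_real (a / 2) / csqrt (s - 1) ^ 3) = (a / 2) / sqrt (norm (s - 1)) ^ 3"
        using a by (simp add: norm_divide norm_power norm_csqrt)
      also have "\<dots> \<le> E" unfolding E_def
        using a e s1 False by (intro divide_left_mono power_mono mult_pos_pos) auto
      also have "\<dots> \<le> E * x powr (3/8)" using x E by (simp add: ge_one_powr_ge_zero)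
      finally have "norm D \<le> C * x powr (3/8) + E * x powr (3/8)"
        unfolding D_def using C(2)[of c t] c e False norm_triangle_ineq4[of "split_log_series s" "of_real (a / 2) / csqrt (s - 1) ^ 3"]
        by (simp add: s_def x_def)
      then have D: "norm D \<le> (C + E) * x powr (3/8)" by (simp add: ring_distribs)
      have "x\<^sup>2 \<le> 2 * (1 + t\<^sup>2)"
      proof -
        have "0 \<le> (\<bar>t\<bar> - 1)\<^sup>2" by simp
        then show ?thesis by (simp add: x_def power2_eq_square algebra_simps abs_mult_self_eq)
      qed
      then have "1 / (1 + t\<^sup>2) \<le> 2 / x\<^sup>2" using x by (simp add: field_simps add_pos_nonneg)
      then have "norm (perron_hat c t) * norm D \<le> (2 / x\<^sup>2) * ((C + E) * x powr (3/8))"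
        using D ph by (intro mult_mono) auto
      also have "\<dots> = 2 * (C + E) * (x powr (3/8) / x powr 2)" using x by simp
      also have "x powr (3/8) / x powr 2 = x powr (-13/8)" by (simp add: powr_diff[symmetric])
      also have "2 * (C + E) * x powr (-13/8) \<le> h \<bar>t\<bar>"
        using t B by (simp add: h_def x_def)
      finally show ?thesis .
    qed
    then show ?thesis using Phi[of t] by (simp add: norm_mult D_def s_def)
  qed
  show ?thesis
    by (rule exI[of _ a], rule conjI[OF a(1)], rule exI[of _ e], rule conjI[OF e(1)], rule exI[of _ \<Phi>])
       (use a int main in blast)
qed

definition weighted_sum :: "real \<Rightarrow> real" where
  "weighted_sum x = (\<Sum>n | n \<ge> 1 \<and> real n \<le> x. split_ind n * ln (real n) * (x - real n))"

text \<open>After y = exp u this is the integral over 1 \<le> y \<le> x of (a / sqrt pi) sqrt(log y)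
  (x - y). The constant is chosen so that the transform equals (a/2) (s - 1)^(-3/2), the singular
  part of the logarithmic series.\<close>

definition main_integral :: "real \<Rightarrow> real \<Rightarrow> real" where
  "main_integral a x = (LINT u|lborel. indicator {0..} u * (a / sqrt pi * sqrt u * exp u) * max 0 (x - exp u))"

text \<open>The Perron formula for counting measure and w(n) = ln n. The kernel vanishes for n > exp
  v, so a finite sum remains.\<close>

lemma perron_sum:
  assumes c: "c > 1" and v: "v \<ge> 0"
  shows "integrable lborel (\<lambda>t. perron_hat c t * iexp (t * v) * split_log_series (Complex c t))"
    and "(LINT t|lborel. perron_hat c t * iexp (t * v) * split_log_series (Complex c t)) =
           2 * pi * (exp (- ((c + 1) * v)) * weighted_sum (exp v))"
proof -
  define f where "f n = split_ind n * ln (real n)" for n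
  let ?M = "count_space (UNIV :: nat set)"
  have sf: "sigma_finite_measure ?M" by (rule sigma_finite_measure_count_space)
  have ew: "f n * exp (- (c * ln (real n))) = f n * real n powr (- c)" for n
    by (cases "n = 0") (simp_all add: f_def powr_def)
  have sm: "summable (\<lambda>n. norm (f n * exp (- (c * ln (real n)))))"
    unfolding ew
  proof (rule summable_comparison_test'[OF summable_ln_powr[OF c], of 0])
    fix n
    have "ln (real n) \<ge> 0" by (cases "n = 0") simp_all
    then show "norm (norm (f n * real n powr (- c))) \<le> ln (real n) * real n powr (- c)"
      by (simp add: f_def abs_mult split_ind_def)
  qed
  then have int: "integrable ?M (\<lambda>n. f n * exp (- (c * ln (real n))))"
    by (simp add: integrable_count_space_nat_iff)
  have A: "(LINT n|?M. complex_of_real (f n) * exp (- (Complex c t * of_real (ln (real n))))) = split_log_series (Complex c t)" for t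
  proof -
    have eq: "complex_of_real (f n) * exp (- (Complex c t * of_real (ln (real n)))) = of_real (f n) * npow n (Complex c t)" for n
      by (cases "n = 0") (simp_all add: f_def npow_def powr_def Ln_of_nat)
    have "integrable ?M (\<lambda>n. of_real (f n) * npow n (Complex c t))"
      unfolding integrable_count_space_nat_iff using sm by (simp add: norm_mult norm_npow ew abs_mult)
    then show ?thesis unfolding eq by (simp add: integral_count_space_nat split_log_series_def f_def)
  qed
  have X: "(LINT n|?M. f n * exp (- (c * ln (real n))) * perron_kernel c (v - ln (real n))) = exp (- ((c + 1) * v)) * weighted_sum (exp v)"
  proof -
    let ?S = "{n::nat. n \<ge> 1 \<and> real n \<le> exp v}"
    have fin: "finite ?S" by (rule finite_subset[of _ "{..nat \<lfloor>exp v\<rfloor>}"]) (auto simp: le_nat_floor)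
    have eq: "f n * exp (- (c * ln (real n))) * perron_kernel c (v - ln (real n)) =
       (if n \<in> ?S then exp (- ((c + 1) * v)) * (f n * (exp v - real n)) else 0)" for n
    proof (cases "n = 0")
      case False
      then show ?thesis unfolding mult.assoc kernel_identity by (simp add: max_def)
    qed (simp add: f_def)
    have "(LINT n|?M. f n * exp (- (c * ln (real n))) * perron_kernel c (v - ln (real n))) =
      (\<Sum>n | n \<in> UNIV \<and> (if n \<in> ?S then exp (- ((c + 1) * v)) * (f n * (exp v - real n)) else 0) \<noteq> 0. 
         if n \<in> ?S then exp (- ((c + 1) * v)) * (f n * (exp v - real n)) else 0)"
      unfolding eq by (rule lebesgue_integral_count_space_finite_support) (rule finite_subset[OF _ fin], auto)
    also have "\<dots> = (\<Sum>n\<in>?S. exp (- ((c + 1) * v)) * (f n * (exp v - real n)))"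
      by (rule sum.mono_neutral_cong_left[OF fin]) auto
    finally show ?thesis by (simp add: weighted_sum_def f_def sum_distrib_left)
  qed
  note P = perron_formula[OF sf _ _ _ int, where u = v, unfolded A X]
  show "integrable lborel (\<lambda>t. perron_hat c t * iexp (t * v) * split_log_series (Complex c t))"
    by (rule P(1)) (use c in auto)
  show "(LINT t|lborel. perron_hat c t * iexp (t * v) * split_log_series (Complex c t)) =
           2 * pi * (exp (- ((c + 1) * v)) * weighted_sum (exp v))"
    by (rule P(2)) (use c in auto)
qed

text \<open>The Perron formula for Lebesgue measure and w(u) = u. The factor exp u in the density
  shifts the argument of the square root transform from s to s - 1.\<close>

lemma perron_main:
  assumes c: "c > 1"
  shows "integrable lborel (\<lambda>t. perron_hat c t * iexp (t * v) * (of_real (a / 2) / csqrt (Complex c t - 1) ^ 3))"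
    and "(LINT t|lborel. perron_hat c t * iexp (t * v) * (of_real (a / 2) / csqrt (Complex c t - 1) ^ 3)) =
           2 * pi * (exp (- ((c + 1) * v)) * main_integral a (exp v))"
proof -
  define f where "f u = indicator {0..} u * (a / sqrt pi * sqrt u * exp u)" for u
  have fm [measurable]: "f \<in> borel_measurable borel" unfolding f_def by measurable
  have eq: "complex_of_real (f u) * exp (- (Complex c t * of_real u)) =
     of_real (a / sqrt pi) * (indicator {0..} u *\<^sub>R (of_real (sqrt u) * exp (- ((Complex c t - 1) * of_real u))))" for t u
    by (simp add: f_def scaleR_conv_of_real left_diff_distrib exp_diff exp_minus exp_of_real field_simps)
  have re: "Re (Complex c t - 1) > 0" for t using c by simp
  have A: "(LINT u|lborel. complex_of_real (f u) * exp (- (Complex c t * of_real u))) = of_real (a / 2) / csqrt (Complex c t - 1) ^ 3" for t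
    unfolding eq by (subst integral_mult_right_zero, subst sqrt_laplace(2)[OF re]) simp
  have "integrable lborel (\<lambda>u. complex_of_real (f u) * exp (- (Complex c 0 * of_real u)))"
    unfolding eq using sqrt_laplace(1)[OF re[of 0]] by (intro integrable_mult_right)
  then have int: "integrable lborel (\<lambda>u. f u * exp (- (c * u)))"
  proof -
    have "Complex c 0 = of_real c" by (simp add: complex_eq_iff)
    then have "complex_of_real (f u) * exp (- (Complex c 0 * of_real u)) = complex_of_real (f u * exp (- (c * u)))" for u
      by (simp only: of_real_mult exp_of_real[symmetric] of_real_minus)
    with \<open>integrable lborel (\<lambda>u. complex_of_real (f u) * exp (- (Complex c 0 * of_real u)))\<close>
    show ?thesis by (simp only: complex_of_real_integrable_eq)
  qed
  have X: "(LINT u|lborel. f u * exp (- (c * u)) * perron_kernel c (v - u)) = exp (- ((c + 1) * v)) * main_integral a (exp v)"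
  proof -
    have "f u * exp (- (c * u)) * perron_kernel c (v - u) = exp (- ((c + 1) * v)) * (f u * max 0 (exp v - exp u))" for u
      unfolding mult.assoc kernel_identity by (simp add: mult_ac)
    then have "(LINT u|lborel. f u * exp (- (c * u)) * perron_kernel c (v - u)) = (LINT u|lborel. exp (- ((c + 1) * v)) * (f u * max 0 (exp v - exp u)))"
      by (simp only:)
    also have "\<dots> = exp (- ((c + 1) * v)) * (LINT u|lborel. f u * max 0 (exp v - exp u))"
      by (rule integral_mult_right_zero)
    finally show ?thesis by (simp only: main_integral_def f_def)
  qed
  note P = perron_formula[OF lborel.sigma_finite_measure_axioms _ _ _ int, where u = v, unfolded A X]
  show "integrable lborel (\<lambda>t. perron_hat c t * iexp (t * v) * (of_real (a / 2) / csqrt (Complex c t - 1) ^ 3))"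
    by (rule P(1)) (use c in auto)
  show "(LINT t|lborel. perron_hat c t * iexp (t * v) * (of_real (a / 2) / csqrt (Complex c t - 1) ^ 3)) =
           2 * pi * (exp (- ((c + 1) * v)) * main_integral a (exp v))"
    by (rule P(2)) (use c in auto)
qed

text \<open>Both Perron integrals are taken on the same line, so their difference is bounded by the
  integral of the common majorant, whatever c is. The line depends on x, close enough to
  \<open>Re s = 1\<close> that x^(c+1) \<le> e x^2.\<close>

theorem weighted_sum_asymptotic:
  "\<exists>a>0. \<exists>C>0. a\<^sup>2 = Re (cleared_square 1) \<and> (\<forall>x\<ge>1. \<bar>weighted_sum x - main_integral a x\<bar> \<le> C * x\<^sup>2)"
proof -
  obtain a d \<Phi> where a: "a > 0" "a\<^sup>2 = Re (cleared_square 1)" and d: "d > 0" and int: "integrable lborel \<Phi>"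
    and dom: "\<And>c t. 1 < c \<Longrightarrow> c < 1 + d \<Longrightarrow> t \<noteq> 0 \<Longrightarrow>
      norm (perron_hat c t * (split_log_series (Complex c t) - of_real (a / 2) / csqrt (Complex c t - 1) ^ 3)) \<le> \<Phi> t"
    using dominating_function by blast
  define I where "I = \<bar>integral\<^sup>L lborel \<Phi>\<bar> / (2 * pi)"
  have bound: "\<bar>weighted_sum (exp v) - main_integral a (exp v)\<bar> \<le> I * exp 1 * exp (2 * v)" if v: "v \<ge> 0" for v
  proof -
    \<comment> \<open>Gives (c - 1) v \<le> 1 with v = log x, within the range where the majorant is
      valid.\<close>
    define c where "c = 1 + min (d / 2) (1 / (1 + v))"
    have c: "1 < c" "c < 1 + d" "(c - 1) * v \<le> 1"
    proof -
      show "1 < c" "c < 1 + d" using d v by (auto simp: c_def min_def)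
      have "(c - 1) * v \<le> 1 / (1 + v) * v" unfolding c_def using v by (intro mult_right_mono) auto
      also have "\<dots> \<le> 1" using v by simp
      finally show "(c - 1) * v \<le> 1" .
    qed
    let ?f = "\<lambda>t. perron_hat c t * iexp (t * v) * split_log_series (Complex c t)"
    let ?g = "\<lambda>t. perron_hat c t * iexp (t * v) * (of_real (a / 2) / csqrt (Complex c t - 1) ^ 3)"
    have i: "integrable lborel ?f" "integrable lborel ?g"
      using perron_sum(1)[OF c(1) v] perron_main(1)[OF c(1)] by auto
    have "(LINT t|lborel. ?f t - ?g t) = of_real (2 * pi * (exp (- ((c + 1) * v)) * (weighted_sum (exp v) - main_integral a (exp v))))"
      unfolding Bochner_Integration.integral_diff[OF i] perron_sum(2)[OF c(1) v] perron_main(2)[OF c(1)]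
      by (simp add: algebra_simps)
    then have "2 * pi * (exp (- ((c + 1) * v)) * \<bar>weighted_sum (exp v) - main_integral a (exp v)\<bar>) = norm (LINT t|lborel. ?f t - ?g t)"
      by (simp only: norm_of_real abs_mult) simp
    also have "\<dots> \<le> (LINT t|lborel. norm (?f t - ?g t))" by (rule integral_norm_bound)
    also have "\<dots> \<le> (LINT t|lborel. \<Phi> t)"
    proof (rule integral_mono_AE)
      show "integrable lborel (\<lambda>t. norm (?f t - ?g t))" using i by auto
      have "norm (?f t - ?g t) \<le> \<Phi> t" if "t \<noteq> 0" for t
      proof -
        have "?f t - ?g t = iexp (t * v) * (perron_hat c t * (split_log_series (Complex c t) - of_real (a / 2) / csqrt (Complex c t - 1) ^ 3))"
          by (simp add: algebra_simps)
        then have "norm (?f t - ?g t) = norm (perron_hat c t * (split_log_series (Complex c t) - of_real (a / 2) / csqrt (Complex c t - 1) ^ 3))"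
          by (simp only: norm_mult norm_exp_i_times mult_1_left)
        then show ?thesis using dom[OF c(1,2) that] by simp
      qed
      moreover have "AE t in lborel. t \<noteq> (0::real)" by (rule AE_lborel_singleton)
      ultimately show "AE t in lborel. norm (?f t - ?g t) \<le> \<Phi> t" by (auto elim: eventually_mono)
    qed (rule int)
    finally have "exp (- ((c + 1) * v)) * \<bar>weighted_sum (exp v) - main_integral a (exp v)\<bar> \<le> I"
      unfolding I_def by (simp add: field_simps)
    then have "exp ((c + 1) * v) * (exp (- ((c + 1) * v)) * \<bar>weighted_sum (exp v) - main_integral a (exp v)\<bar>) \<le> exp ((c + 1) * v) * I"
      by (intro mult_left_mono) auto
    then have "\<bar>weighted_sum (exp v) - main_integral a (exp v)\<bar> \<le> I * exp ((c + 1) * v)"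
      by (simp only: mult.assoc[symmetric] exp_minus_inverse mult_1_left mult.commute[of I])
    also have "\<dots> \<le> I * (exp 1 * exp (2 * v))"
    proof (rule mult_left_mono)
      have "(c + 1) * v \<le> 1 + 2 * v" using c(3) by (simp add: algebra_simps)
      then show "exp ((c + 1) * v) \<le> exp 1 * exp (2 * v)" by (simp add: exp_add[symmetric])
    qed (simp add: I_def)
    finally show ?thesis by simp
  qed
  have "\<bar>weighted_sum x - main_integral a x\<bar> \<le> (I * exp 1 + 1) * x\<^sup>2" if "x \<ge> 1" for x
  proof -
    have "\<bar>weighted_sum x - main_integral a x\<bar> \<le> I * exp 1 * exp (2 * ln x)"
      using bound[of "ln x"] that by simp
    also have "exp (2 * ln x) = x\<^sup>2" using that by (simp add: exp_double)
    also have "I * exp 1 * x\<^sup>2 \<le> (I * exp 1 + 1) * x\<^sup>2" by (intro mult_right_mono) auto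
    finally show ?thesis .
  qed
  moreover have "I * exp 1 + 1 > 0" by (simp add: I_def add_nonneg_pos)
  ultimately show ?thesis using a by blast
qed

section \<open>Removing the weights\<close>

definition naturals_upto :: "real \<Rightarrow> nat set" where "naturals_upto x = {n. n \<ge> 1 \<and> real n \<le> x}"

definition log_sum :: "real \<Rightarrow> real" where
  "log_sum x = (\<Sum>n\<in>naturals_upto x. split_ind n * ln (real n))"

definition split_count :: "real \<Rightarrow> real" where
  "split_count x = (\<Sum>n\<in>naturals_upto x. split_ind n)"

lemma finite_naturals_upto [simp]: "finite (naturals_upto x)"
  by (rule finite_subset[of _ "{..nat \<lfloor>x\<rfloor>}"]) (auto simp: naturals_upto_def le_nat_floor)

lemma weighted_sum_max:
  assumes "x \<le> y"
  shows "weighted_sum x = (\<Sum>n\<in>naturals_upto y. split_ind n * ln (real n) * max 0 (x - real n))"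
  unfolding weighted_sum_def
  by (rule sum.mono_neutral_cong_left) (use assms in \<open>auto simp: naturals_upto_def[of y, symmetric], auto simp: naturals_upto_def max_def\<close>)

lemma split_ln_nonneg: "0 \<le> split_ind n * ln (real n)"
  by (cases "n = 0") (simp_all add: split_ind_def)

text \<open>\<open>weighted_sum\<close> is the integral of the nondecreasing function
  \<open>log_sum\<close>, so its difference quotient lies between the values of
  \<open>log_sum\<close> at the end points.\<close>

lemma weighted_sum_increment:
  assumes "x \<le> y"
  shows "log_sum x * (y - x) \<le> weighted_sum y - weighted_sum x"
    and "weighted_sum y - weighted_sum x \<le> log_sum y * (y - x)"
proof -
  have eq: "weighted_sum y - weighted_sum x = (\<Sum>n\<in>naturals_upto y. split_ind n * ln (real n) * (max 0 (y - real n) - max 0 (x - real n)))"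
    unfolding weighted_sum_max[OF assms] weighted_sum_max[OF order_refl[of y]] by (simp add: sum_subtractf right_diff_distrib)
  have "log_sum x * (y - x) = (\<Sum>n\<in>naturals_upto x. split_ind n * ln (real n) * (y - x))"
    by (simp add: log_sum_def sum_distrib_right)
  also have "\<dots> = (\<Sum>n\<in>naturals_upto x. split_ind n * ln (real n) * (max 0 (y - real n) - max 0 (x - real n)))"
    using assms by (intro sum.cong refl) (auto simp: naturals_upto_def)
  also have "\<dots> \<le> (\<Sum>n\<in>naturals_upto y. split_ind n * ln (real n) * (max 0 (y - real n) - max 0 (x - real n)))"
    by (rule sum_mono2[OF finite_naturals_upto]) (use assms in \<open>auto simp: naturals_upto_def intro!: mult_nonneg_nonneg split_ln_nonneg\<close>)
  finally show "log_sum x * (y - x) \<le> weighted_sum y - weighted_sum x" using eq by simp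
  show "weighted_sum y - weighted_sum x \<le> log_sum y * (y - x)"
    unfolding eq log_sum_def sum_distrib_right
    using assms by (intro sum_mono mult_left_mono split_ln_nonneg) auto
qed

lemma main_integral_increment:
  fixes a :: real
  defines "k \<equiv> a / sqrt pi"
  assumes a: "a > 0" and x: "x > 1" and xy: "x \<le> y"
  shows "main_integral a y - main_integral a x \<le> k * sqrt (ln y) * y * (y - x)"
    and "k * (y - x) * (sqrt (ln x) * x - x / sqrt (ln x) - sqrt (ln x)) \<le> main_integral a y - main_integral a x"
proof -
  have k: "k > 0" using a by (simp add: k_def)
  let ?f = "\<lambda>z u. indicator {0..} u * (k * sqrt u * exp u) * max 0 (z - exp u)"
  have int: "integrable lborel (?f z)" if z: "z > 1" for z
  proof -
    have "set_integrable lborel {0..ln z} (\<lambda>u. (k * sqrt u * exp u) * (z - exp u))"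
      by (intro borel_integrable_atLeastAtMost' continuous_intros)
    also have "set_integrable lborel {0..ln z} (\<lambda>u. (k * sqrt u * exp u) * (z - exp u)) = integrable lborel (?f z)"
      unfolding set_integrable_def
    proof (rule Bochner_Integration.integrable_cong[OF refl])
      fix u
      have "exp u \<le> z \<longleftrightarrow> u \<le> ln z" using z by (simp add: ln_ge_iff)
      then show "indicat_real {0..ln z} u *\<^sub>R ((k * sqrt u * exp u) * (z - exp u)) = ?f z u"
        by (auto simp: indicator_def max_def)
    qed
    finally show ?thesis .
  qed
  have diff: "main_integral a y - main_integral a x = (LINT u|lborel. ?f y u - ?f x u)"
    unfolding main_integral_def k_def[symmetric] using int[of x] int[of y] x xy
    by (subst Bochner_Integration.integral_diff) auto
  have idiff: "integrable lborel (\<lambda>u. ?f y u - ?f x u)"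
    using int[of x] int[of y] x xy by auto
  \<comment> \<open>Majorant for the increment: sqrt u is replaced by its maximum sqrt(ln y), and
    the truncated differences by y - x. The function is its own antiderivative.\<close>
  define G where "G u = k * sqrt (ln y) * (y - x) * exp u" for u
  have "has_bochner_integral lborel (\<lambda>u. G u * indicator {0..ln y} u) (G (ln y) - G 0)"
  proof (rule has_bochner_integral_FTC_Icc_real)
    show "DERIV G u :> G u" for u
      unfolding G_def by (auto intro!: derivative_eq_intros)
    show "isCont G u" for u unfolding G_def by (auto intro!: continuous_intros)
  qed (use x xy in simp)
  then have G: "integrable lborel (\<lambda>u. G u * indicator {0..ln y} u)" "(LINT u|lborel. G u * indicator {0..ln y} u) = G (ln y) - G 0"
    by (simp_all add: has_bochner_integral_iff)
  have "(LINT u|lborel. ?f y u - ?f x u) \<le> (LINT u|lborel. G u * indicator {0..ln y} u)"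
  proof (rule integral_mono[OF idiff G(1)])
    fix u
    have e: "exp u \<le> y \<longleftrightarrow> u \<le> ln y" using x xy by (simp add: ln_ge_iff)
    show "?f y u - ?f x u \<le> G u * indicator {0..ln y} u"
    proof (cases "0 \<le> u \<and> u \<le> ln y")
      case True
      have "max 0 (y - exp u) - max 0 (x - exp u) \<le> y - x" using xy by auto
      then have "(k * sqrt u * exp u) * (max 0 (y - exp u) - max 0 (x - exp u)) \<le> (k * sqrt (ln y) * exp u) * (y - x)"
        using True k xy by (intro mult_mono) auto
      then show ?thesis using True by (simp add: G_def algebra_simps)
    next
      case False
      then show ?thesis using e xy by (auto simp: indicator_def max_def)
    qed
  qed
  also have "\<dots> \<le> k * sqrt (ln y) * y * (y - x)"
    unfolding G(2) using k x xy by (simp add: G_def)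
  finally show "main_integral a y - main_integral a x \<le> k * sqrt (ln y) * y * (y - x)" unfolding diff .
  define L where "L = ln x"
  have L: "L > 0" "exp L = x" using x by (auto simp: L_def)
  define r where "r = sqrt L"
  have r: "r > 0" "sqrt L = r" using L by (simp_all add: r_def)
  \<comment> \<open>With L = ln x and r = sqrt L, the expression r - (L - u)/r in \<open>h\<close>
    is u / sqrt L, the chord of the square root over [0, L]. It lies below by concavity, and
    \<open>H\<close> is an antiderivative of \<open>h\<close>.\<close>
  define H where "H u = k * (y - x) * (exp u * r - ((L - u) * exp u + exp u) / r)" for u
  define h where "h u = k * (y - x) * (exp u * (r - (L - u) / r))" for u
  have "has_bochner_integral lborel (\<lambda>u. h u * indicator {0..L} u) (H L - H 0)"
  proof (rule has_bochner_integral_FTC_Icc_real)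
    show "DERIV H u :> h u" for u
      unfolding H_def h_def using r(1) by (auto intro!: derivative_eq_intros simp: field_simps)
    show "isCont h u" for u unfolding h_def using r(1) by (auto intro!: continuous_intros)
  qed (use L in simp)
  then have H: "integrable lborel (\<lambda>u. h u * indicator {0..L} u)" "(LINT u|lborel. h u * indicator {0..L} u) = H L - H 0"
    by (simp_all add: has_bochner_integral_iff)
  have "k * (y - x) * (sqrt L * x - x / sqrt L - sqrt L) \<le> H L - H 0"
  proof -
    have "H L - H 0 = k * (y - x) * (sqrt L * x - x / sqrt L - sqrt L + (L + 1) / sqrt L)"
    proof -
      have Lr: "L = r * r" using L by (simp add: r_def)
      have er: "exp (r * r) = x" using L(2) Lr by simp
      show ?thesis unfolding H_def r(2) unfolding Lr er using r(1) by (simp add: field_simps)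
    qed
    also have "\<dots> \<ge> k * (y - x) * (sqrt L * x - x / sqrt L - sqrt L)"
      using k xy L by (intro mult_left_mono) auto
    finally show ?thesis .
  qed
  also have "\<dots> = (LINT u|lborel. h u * indicator {0..L} u)" using H by simp
  also have "\<dots> \<le> (LINT u|lborel. ?f y u - ?f x u)"
  proof (rule integral_mono[OF H(1) idiff])
    fix u
    show "h u * indicator {0..L} u \<le> ?f y u - ?f x u"
    proof (cases "0 \<le> u \<and> u \<le> L")
      case True
      then have "exp u \<le> x" using L(2) by (metis exp_le_cancel_iff)
      then have m: "max 0 (y - exp u) - max 0 (x - exp u) = y - x" using xy by auto
      have "r - (L - u) / r \<le> sqrt u"
      proof -
        have "sqrt L * sqrt L - (L - u) \<le> sqrt u * sqrt L"
          using True L mult_left_mono[of "sqrt u" "sqrt L" "sqrt u"] by simp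
        then show ?thesis using L r by (simp add: field_simps)
      qed
      then have "exp u * (r - (L - u) / r) \<le> exp u * sqrt u" by (rule mult_left_mono) simp
      then have "h u \<le> k * (y - x) * (exp u * sqrt u)"
        unfolding h_def using k xy by (intro mult_left_mono) auto
      also have "\<dots> = (k * sqrt u * exp u) * (max 0 (y - exp u) - max 0 (x - exp u))"
        unfolding m by (simp add: mult_ac)
      finally show ?thesis using True by (simp add: right_diff_distrib)
    next
      case False
      have "0 \<le> (k * sqrt u * exp u) * (max 0 (y - exp u) - max 0 (x - exp u))" if "u \<ge> 0"
        using k xy that by (intro mult_nonneg_nonneg) auto
      then show ?thesis using False by (auto simp: indicator_def right_diff_distrib)
    qed
  qed
  finally show "k * (y - x) * (sqrt (ln x) * x - x / sqrt (ln x) - sqrt (ln x)) \<le> main_integral a y - main_integral a x"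
    unfolding diff L_def .
qed

text \<open>The step y - x stays free: the first term grows with it while the smoothing error is
  divided by it, and the best choice depends on x.\<close>

lemma log_sum_bounds:
  fixes a C :: real
  defines "k \<equiv> a / sqrt pi"
  assumes a: "a > 0" and C: "\<And>x. x \<ge> 1 \<Longrightarrow> \<bar>weighted_sum x - main_integral a x\<bar> \<le> C * x\<^sup>2" and C0: "C > 0"
    and x: "x > 1" and y: "y > x"
  shows "log_sum x \<le> k * sqrt (ln y) * y + 2 * C * y\<^sup>2 / (y - x)"
    and "log_sum y \<ge> k * (sqrt (ln x) * x - x / sqrt (ln x) - sqrt (ln x)) - 2 * C * y\<^sup>2 / (y - x)"
proof -
  have "C * x\<^sup>2 \<le> C * y\<^sup>2" using x y C0 by (intro mult_left_mono power_mono) auto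
  then have err: "\<bar>(weighted_sum y - weighted_sum x) - (main_integral a y - main_integral a x)\<bar> \<le> 2 * C * y\<^sup>2"
    using C[of x] C[of y] x y by simp
  have "log_sum x * (y - x) \<le> k * sqrt (ln y) * y * (y - x) + 2 * C * y\<^sup>2"
    using weighted_sum_increment(1)[of x y] main_integral_increment(1)[OF a x, of y] err y unfolding k_def by linarith
  then show "log_sum x \<le> k * sqrt (ln y) * y + 2 * C * y\<^sup>2 / (y - x)"
    using y by (simp add: field_simps)
  have "k * (y - x) * (sqrt (ln x) * x - x / sqrt (ln x) - sqrt (ln x)) - 2 * C * y\<^sup>2 \<le> log_sum y * (y - x)"
    using weighted_sum_increment(2)[of x y] main_integral_increment(2)[OF a x, of y] err y unfolding k_def by linarith
  then have "(k * (sqrt (ln x) * x - x / sqrt (ln x) - sqrt (ln x)) * (y - x) - 2 * C * y\<^sup>2) / (y - x) \<le> log_sum y"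
    using y by (subst pos_divide_le_eq) (auto simp: mult_ac)
  moreover have "(k * (sqrt (ln x) * x - x / sqrt (ln x) - sqrt (ln x)) * (y - x) - 2 * C * y\<^sup>2) / (y - x) =
    k * (sqrt (ln x) * x - x / sqrt (ln x) - sqrt (ln x)) - 2 * C * y\<^sup>2 / (y - x)"
    using y by (simp add: diff_divide_distrib)
  ultimately show "log_sum y \<ge> k * (sqrt (ln x) * x - x / sqrt (ln x) - sqrt (ln x)) - 2 * C * y\<^sup>2 / (y - x)"
    by simp
qed

lemma log_sum_asymptotic:
  "\<exists>a>0. a\<^sup>2 = Re (cleared_square 1) \<and> (\<lambda>x. log_sum x - a / sqrt pi * x * sqrt (ln x)) \<in> O(\<lambda>x. x * ln x powr (1/4))"
proof -
  obtain a C where a: "a > 0" "a\<^sup>2 = Re (cleared_square 1)" and C0: "C > 0"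
    and C: "\<And>x. x \<ge> 1 \<Longrightarrow> \<bar>weighted_sum x - main_integral a x\<bar> \<le> C * x\<^sup>2"
    using weighted_sum_asymptotic by blast
  define k where "k = a / sqrt pi"
  have k: "k > 0" using a by (simp add: k_def)
  \<comment> \<open>Relative step h: the smoothing error is of order x / h and the variation of the
    main term of order x h sqrt(log x). Both equal x (log x)^(1/4) for h = (log x)^(-1/4).
    \<open>U\<close> uses the interval to the right of x, \<open>V\<close> the one to the
    left.\<close>
  define h where "h x = ln x powr (-1/4)" for x :: real
  define U where "U x = k * sqrt (ln (x * (1 + h x))) * (x * (1 + h x)) + 2 * C * (x * (1 + h x))\<^sup>2 / (x * (1 + h x) - x)" for x
  define V where "V x = k * (sqrt (ln (x * (1 - h x))) * (x * (1 - h x)) - x * (1 - h x) / sqrt (ln (x * (1 - h x))) - sqrt (ln (x * (1 - h x)))) - 2 * C * x\<^sup>2 / (x - x * (1 - h x))" for x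
  have U: "(\<lambda>x. U x - k * x * sqrt (ln x)) \<in> O(\<lambda>x. x * ln x powr (1/4))"
    unfolding U_def h_def using k C0 by real_asymp
  have V: "(\<lambda>x. V x - k * x * sqrt (ln x)) \<in> O(\<lambda>x. x * ln x powr (1/4))"
    unfolding V_def h_def using k C0 by real_asymp
  have "eventually (\<lambda>x. x > 1 \<and> h x > 0 \<and> x * (1 - h x) > 1) at_top"
    unfolding h_def by (intro eventually_conj; real_asymp)
  then have "eventually (\<lambda>x. norm (log_sum x - k * x * sqrt (ln x)) \<le> norm (\<bar>U x - k * x * sqrt (ln x)\<bar> + \<bar>V x - k * x * sqrt (ln x)\<bar>)) at_top"
  proof eventually_elim
    case (elim x)
    have "log_sum x \<le> U x"
      unfolding U_def k_def using elim by (intro log_sum_bounds(1)[OF a(1) C C0]) auto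
    moreover have "V x \<le> log_sum x"
      unfolding V_def k_def using elim by (intro log_sum_bounds(2)[OF a(1) C C0]) auto
    ultimately show ?case by simp
  qed
  then have "(\<lambda>x. log_sum x - k * x * sqrt (ln x)) \<in> O(\<lambda>x. \<bar>U x - k * x * sqrt (ln x)\<bar> + \<bar>V x - k * x * sqrt (ln x)\<bar>)"
    by (rule landau_o.big_mono)
  also have "(\<lambda>x. \<bar>U x - k * x * sqrt (ln x)\<bar> + \<bar>V x - k * x * sqrt (ln x)\<bar>) \<in> O(\<lambda>x. x * ln x powr (1/4))"
    using U V by (intro sum_in_bigo) simp_all
  finally show ?thesis using a unfolding k_def by blast
qed

lemma sum_inverse_sqrt_le: "(\<Sum>n=1..N. 1 / sqrt (real n)) \<le> 2 * sqrt (real N)"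
proof (induction N)
  case (Suc N)
  have "sqrt (real N) * sqrt (real (Suc N)) \<le> (real N + real (Suc N)) / 2"
    by (rule arith_geo_mean_sqrt[unfolded real_sqrt_mult]) auto
  then have "1 + 2 * (sqrt (real N) * sqrt (real (Suc N))) \<le> 2 * (sqrt (real (Suc N)) * sqrt (real (Suc N)))"
    by simp
  then have "1 / sqrt (real (Suc N)) + 2 * sqrt (real N) \<le> 2 * sqrt (real (Suc N))"
    by (simp add: field_simps)
  with Suc show ?case by simp
qed simp

text \<open>In place of partial summation, ln(x/n) \<le> 2 sqrt(x/n), and summing 1/sqrt(n) gives
  O(x). This is below the error already present in \<open>log_sum\<close>.\<close>

lemma split_count_log_sum:
  assumes x: "x \<ge> 1"
  shows "0 \<le> split_count x * ln x - log_sum x" and "split_count x * ln x - log_sum x \<le> 4 * x"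
proof -
  have eq: "split_count x * ln x - log_sum x = (\<Sum>n\<in>naturals_upto x. split_ind n * (ln x - ln (real n)))"
    by (simp add: split_count_def log_sum_def sum_distrib_right sum_subtractf right_diff_distrib)
  show "0 \<le> split_count x * ln x - log_sum x"
    unfolding eq by (intro sum_nonneg mult_nonneg_nonneg) (use x in \<open>auto simp: naturals_upto_def split_ind_def\<close>)
  have "(\<Sum>n\<in>naturals_upto x. split_ind n * (ln x - ln (real n))) \<le> (\<Sum>n\<in>naturals_upto x. 2 * sqrt x * (1 / sqrt (real n)))"
  proof (rule sum_mono)
    fix n assume n: "n \<in> naturals_upto x"
    then have "1 \<le> x / real n" by (auto simp: naturals_upto_def)
    then have "ln (x / real n) \<le> (x / real n) powr (1/2) / (1/2)" by (rule ln_powr_bound) simp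
    also have "\<dots> = 2 * sqrt x * (1 / sqrt (real n))"
      using n x by (simp add: powr_half_sqrt naturals_upto_def real_sqrt_divide)
    finally have b: "ln x - ln (real n) \<le> 2 * sqrt x * (1 / sqrt (real n))"
      using n x by (simp add: naturals_upto_def ln_div)
    have "split_ind n * (ln x - ln (real n)) \<le> 1 * (ln x - ln (real n))"
      using n x by (intro mult_right_mono) (auto simp: naturals_upto_def split_ind_def)
    with b show "split_ind n * (ln x - ln (real n)) \<le> 2 * sqrt x * (1 / sqrt (real n))" by simp
  qed
  also have "\<dots> = 2 * sqrt x * (\<Sum>n\<in>naturals_upto x. 1 / sqrt (real n))" by (simp add: sum_distrib_left)
  also have "\<dots> \<le> 2 * sqrt x * (2 * sqrt x)"
  proof (rule mult_left_mono)
    have "naturals_upto x = {1..nat \<lfloor>x\<rfloor>}" using x by (auto simp: naturals_upto_def le_nat_floor) linarith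
    then have "(\<Sum>n\<in>naturals_upto x. 1 / sqrt (real n)) \<le> 2 * sqrt (real (nat \<lfloor>x\<rfloor>))"
      using sum_inverse_sqrt_le by simp
    also have "\<dots> \<le> 2 * sqrt x" using x by simp
    finally show "(\<Sum>n\<in>naturals_upto x. 1 / sqrt (real n)) \<le> 2 * sqrt x" .
  qed (use x in simp)
  also have "\<dots> = 4 * x" using x by simp
  finally show "split_count x * ln x - log_sum x \<le> 4 * x" unfolding eq .
qed

theorem split_count_asymptotic:
  "\<exists>a>0. a\<^sup>2 = Re (cleared_square 1) \<and> (\<lambda>x. split_count x - a / sqrt pi * x / sqrt (ln x)) \<in> O(\<lambda>x. x / ln x powr (3/4))"
proof -
  obtain a where a: "a > 0" "a\<^sup>2 = Re (cleared_square 1)"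
    and asy: "(\<lambda>x. log_sum x - a / sqrt pi * x * sqrt (ln x)) \<in> O(\<lambda>x. x * ln x powr (1/4))"
    using log_sum_asymptotic by blast
  have ev: "eventually (\<lambda>x::real. x > exp 1) at_top" by (rule eventually_gt_at_top)
  have "(\<lambda>x. split_count x * ln x - log_sum x) \<in> O(\<lambda>x. 4 * x)"
  proof (rule landau_o.big_mono)
    show "\<forall>\<^sub>F x in at_top. norm (split_count x * ln x - log_sum x) \<le> norm (4 * x)"
      using eventually_ge_at_top[of 1]
    proof eventually_elim
      case (elim x)
      then show ?case using split_count_log_sum[OF elim] by simp
    qed
  qed
  also have "(\<lambda>x. 4 * x) \<in> O(\<lambda>x::real. x * ln x powr (1/4))" by real_asymp
  finally have "(\<lambda>x. (split_count x * ln x - log_sum x) + (log_sum x - a / sqrt pi * x * sqrt (ln x))) \<in> O(\<lambda>x. x * ln x powr (1/4))"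
    using asy by (rule sum_in_bigo)
  then have "(\<lambda>x. split_count x * ln x - a / sqrt pi * x * sqrt (ln x)) \<in> O(\<lambda>x. x * ln x powr (1/4))"
    by simp
  moreover have "eventually (\<lambda>x::real. ln x \<noteq> 0) at_top"
    using eventually_gt_at_top[of 1] by eventually_elim simp
  ultimately have "(\<lambda>x. (split_count x * ln x - a / sqrt pi * x * sqrt (ln x)) / ln x) \<in> O(\<lambda>x. (x * ln x powr (1/4)) / ln x)"
    by (rule landau_o.big.divide_right[rotated])
  moreover have "(\<lambda>x::real. (x * ln x powr (1/4)) / ln x) \<in> O(\<lambda>x. x / ln x powr (3/4))" by real_asymp
  ultimately have 1: "(\<lambda>x. (split_count x * ln x - a / sqrt pi * x * sqrt (ln x)) / ln x) \<in> O(\<lambda>x. x / ln x powr (3/4))"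
    by (rule landau_o.big_trans)
  have "eventually (\<lambda>x. (split_count x * ln x - a / sqrt pi * x * sqrt (ln x)) / ln x = split_count x - a / sqrt pi * x / sqrt (ln x)) at_top"
    using ev
  proof eventually_elim
    case (elim x)
    have "ln x > 0" using elim exp_gt_one[of 1] by (intro ln_gt_zero) linarith
    then obtain r where r: "r > 0" "sqrt (ln x) = r" "ln x = r * r"
      by (intro that[of "sqrt (ln x)"]) auto
    show ?case unfolding r(2,3) using r(1) by (simp add: field_simps)
  qed
  from landau_o.big.in_cong[OF this] 1 have "(\<lambda>x. split_count x - a / sqrt pi * x / sqrt (ln x)) \<in> O(\<lambda>x. x / ln x powr (3/4))"
    by blast
  then show ?thesis using a by blast
qed

section \<open>The constant\<close>

lemma inert_prod_real_product:
  assumes "s > 1/2"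
  shows "(\<lambda>N. \<Prod>p | prime p \<and> p \<le> N. if p mod 4 = 3 then 1 - real p powr (- (2 * s)) else 1) \<longlonglongrightarrow> Re (inert_prod (of_real s))"
    and "Im (inert_prod (of_real s)) = 0"
proof -
  have eq: "(\<Prod>p | prime p \<and> p \<le> N. if p mod 4 = 3 then 1 - npow p (2 * of_real s) else 1) =
    complex_of_real (\<Prod>p | prime p \<and> p \<le> N. if p mod 4 = 3 then 1 - real p powr (- (2 * s)) else 1)" for N
  proof -
    have "npow p (2 * of_real s) = of_real (real p powr (- (2 * s)))" for p
      using npow_of_real[of p "2 * s"] by simp
    then show ?thesis unfolding of_real_prod by (intro prod.cong) auto
  qed
  have lim: "(\<lambda>N. complex_of_real (\<Prod>p | prime p \<and> p \<le> N. if p mod 4 = 3 then 1 - real p powr (- (2 * s)) else 1)) \<longlonglongrightarrow> inert_prod (of_real s)"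
    unfolding eq[symmetric] using assms by (intro inert_prod_product summable_pterm) auto
  from tendsto_Re[OF lim] show "(\<lambda>N. \<Prod>p | prime p \<and> p \<le> N. if p mod 4 = 3 then 1 - real p powr (- (2 * s)) else 1) \<longlonglongrightarrow> Re (inert_prod (of_real s))"
    unfolding Re_complex_of_real .
  from tendsto_Im[OF lim] have "(\<lambda>N. 0) \<longlonglongrightarrow> Im (inert_prod (of_real s))" unfolding Im_complex_of_real .
  then show "Im (inert_prod (of_real s)) = 0" by (simp add: LIMSEQ_const_iff)
qed

text \<open>The product of 1 - p^(-2k) over the primes p = 3 modulo 4. The case k = 1 enters
  \<open>C\<^sub>3\<close>, the case k = 2 its numerical evaluation.\<close>

definition inert_const :: "nat \<Rightarrow> real" where "inert_const k = Re (inert_prod (of_nat k))"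

lemma inert_const_product:
  assumes "k \<ge> 1"
  shows "(\<lambda>N. \<Prod>p | prime p \<and> p \<le> N. if p mod 4 = 3 then 1 - 1 / real p ^ (2 * k) else 1) \<longlonglongrightarrow> inert_const k"
    and "inert_prod (of_nat k) = of_real (inert_const k)"
proof -
  have eq: "(\<Prod>p | prime p \<and> p \<le> N. if p mod 4 = 3 then 1 - real p powr (- (2 * real k)) else 1) =
    (\<Prod>p | prime p \<and> p \<le> N. if p mod 4 = 3 then 1 - 1 / real p ^ (2 * k) else 1)" for N
  proof (intro prod.cong refl)
    fix p assume "p \<in> {p. prime p \<and> p \<le> N}"
    then have "real p > 0" by (simp add: prime_gt_0_nat)
    then have "real p powr (- (2 * real k)) = 1 / real p ^ (2 * k)"
      by (simp add: powr_minus_divide powr_realpow[symmetric])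
    then show "(if p mod 4 = 3 then 1 - real p powr (- (2 * real k)) else 1) = (if p mod 4 = 3 then 1 - 1 / real p ^ (2 * k) else 1)"
      by simp
  qed
  have k: "real k > 1/2" using assms by simp
  show "(\<lambda>N. \<Prod>p | prime p \<and> p \<le> N. if p mod 4 = 3 then 1 - 1 / real p ^ (2 * k) else 1) \<longlonglongrightarrow> inert_const k"
    using inert_prod_real_product(1)[OF k] unfolding eq by (simp add: inert_const_def)
  show "inert_prod (of_nat k) = of_real (inert_const k)"
    using inert_prod_real_product(2)[OF k] by (simp add: inert_const_def complex_eq_iff)
qed

text \<open>A limit of nonnegative products is nonnegative, and it is not 0 because
  \<open>inert_prod\<close> is defined as an exponential.\<close>

lemma inert_const_pos: "inert_const 1 > 0"
proof -
  have f: "(1 - 1 / real n ^ 2) \<ge> 0" for n by (cases "n = 0") (auto simp: divide_le_eq)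
  have "inert_const 1 \<ge> 0"
  proof (rule LIMSEQ_le_const[OF inert_const_product(1)])
    show "\<exists>N. \<forall>n\<ge>N. 0 \<le> (\<Prod>p | prime p \<and> p \<le> n. if p mod 4 = 3 then 1 - 1 / real p ^ (2 * 1) else 1)"
      using f by (intro exI[of _ 0] allI impI prod_nonneg) auto
  qed simp
  moreover have "inert_const 1 \<noteq> 0"
    using inert_const_product(2)[of 1] by (auto simp: inert_prod_def)
  ultimately show ?thesis by simp
qed

lemma Re_cleared_square_1: "Re (cleared_square 1) = pi / 8 * inert_const 1"
proof -
  have "inert_prod 1 = of_real (inert_const 1)" using inert_const_product(2)[of 1] by simp
  moreover have "npow 2 1 = of_real (1/2)" using npow_of_real[of 2 1] by (simp add: powr_minus_divide)
  ultimately have "cleared_square 1 = of_real (pi / 4 * (1 - 1/2) * inert_const 1)"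
    by (simp only: cleared_square_def zeta_cleared_1 L_chi4_1 of_real_mult of_real_diff of_real_1 mult_1_left)
  then have "Re (cleared_square 1) = pi / 4 * (1 - 1/2) * inert_const 1" by (simp only: Re_complex_of_real)
  then show ?thesis by simp
qed

lemma sqrt_prod: "sqrt (\<Prod>x\<in>A. f x) = (\<Prod>x\<in>A. sqrt (f x))"
  by (induction A rule: infinite_finite_induct) (simp_all add: real_sqrt_mult)

text \<open>Weierstrass' product inequality, used to bound the tail of an Euler product from
  below.\<close>

lemma one_minus_sum_le_prod:
  fixes a :: "'a \<Rightarrow> real"
  assumes "\<And>x. x \<in> A \<Longrightarrow> 0 \<le> a x \<and> a x \<le> 1"
  shows "1 - (\<Sum>x\<in>A. a x) \<le> (\<Prod>x\<in>A. 1 - a x)"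
  using assms
proof (induction A rule: infinite_finite_induct)
  case (insert x A)
  have p: "0 \<le> (\<Prod>x\<in>A. 1 - a x)" "(\<Prod>x\<in>A. 1 - a x) \<le> 1"
    using insert.prems by (auto intro!: prod_nonneg prod_le_1)
  have "a x * (\<Prod>x\<in>A. 1 - a x) \<le> a x * 1" using insert.prems p by (intro mult_left_mono) auto
  then show ?case using insert by (simp add: algebra_simps)
qed simp_all

lemma C3_eq: "C\<^sub>3 = 3 / (4 * sqrt 2) * sqrt (inert_const 1)"
proof -
  let ?f = "\<lambda>p::nat. if prime p \<and> [p = 3] (mod 4) then (1 - 1 / (real p)\<^sup>2) powr (1 / 2) else 1"
  have f: "?f p = (if prime p \<and> p mod 4 = 3 then sqrt (1 - 1 / (real p)\<^sup>2) else 1)" for p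
  proof -
    have "1 - 1 / (real p)\<^sup>2 \<ge> 0" by (cases "p = 0") (auto simp: divide_le_eq)
    then show ?thesis by (simp add: Cong.cong_def powr_half_sqrt)
  qed
  have "(\<Prod>p\<le>N. ?f p) = sqrt (\<Prod>p | prime p \<and> p \<le> N. if p mod 4 = 3 then 1 - 1 / real p ^ (2 * 1) else 1)" for N
  proof -
    have "(\<Prod>p\<le>N. ?f p) = (\<Prod>p | prime p \<and> p \<le> N. if p mod 4 = 3 then sqrt (1 - 1 / (real p)\<^sup>2) else 1)"
      unfolding f by (rule prod.mono_neutral_cong_right) auto
    also have "\<dots> = (\<Prod>p | prime p \<and> p \<le> N. sqrt (if p mod 4 = 3 then 1 - 1 / real p ^ (2 * 1) else 1))"
      by (intro prod.cong) auto
    also have "\<dots> = sqrt (\<Prod>p | prime p \<and> p \<le> N. if p mod 4 = 3 then 1 - 1 / real p ^ (2 * 1) else 1)"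
      by (rule sqrt_prod[symmetric])
    finally show ?thesis .
  qed
  then have "(\<lambda>N. \<Prod>p\<le>N. ?f p) \<longlonglongrightarrow> sqrt (inert_const 1)"
    using tendsto_real_sqrt[OF inert_const_product(1)[of 1]] by simp
  \<comment> \<open>\<open>raw_has_prod\<close> demands a nonzero limit, which positivity of
    \<open>inert_const 1\<close> provides.\<close>
  then have "raw_has_prod ?f 0 (sqrt (inert_const 1))"
    using inert_const_pos unfolding raw_has_prod_def by (simp only: add_0_right) simp
  then have "?f has_prod sqrt (inert_const 1)"
    unfolding has_prod_def by (rule disjI1)
  then have "prodinf ?f = sqrt (inert_const 1)" by (rule has_prod_unique[symmetric])
  then show ?thesis unfolding C\<^sub>3_def by simp
qed

section \<open>Catalan's constant and the numerical value\<close>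

definition catalan_term :: "nat \<Rightarrow> real" where
  "catalan_term k = 1 / real (4 * k + 1) ^ 2 - 1 / real (4 * k + 3) ^ 2"

text \<open>
  With \<open>m = 4 k + 2\<close> the term is \<open>4 m / (m\<^sup>2 - 1)\<^sup>2\<close>, which lies between telescoping differences
  of \<open>1 / (2 (m\<^sup>2 + c))\<close> with step \<open>4\<close>, for \<open>c = 0\<close> and \<open>c = 3\<close>.
\<close>

lemma catalan_term_bounds:
  assumes "k \<ge> 1"
  shows "catalan_term k \<le> 1 / (32 * real k ^ 2) - 1 / (32 * real (Suc k) ^ 2)"
    and "1 / (32 * real k ^ 2 + 6) - 1 / (32 * real (Suc k) ^ 2 + 6) \<le> catalan_term k"
    and "0 \<le> catalan_term k"
proof -
  define x where "x = real k"
  have x: "x \<ge> 1" using assms by (simp add: x_def)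
  have sx: "real (Suc k) = x + 1" by (simp add: x_def)
  have c: "catalan_term k = 8 * (2 * x + 1) / ((4 * x + 1) ^ 2 * (4 * x + 3) ^ 2)"
    using x by (simp add: catalan_term_def x_def[symmetric] field_simps) (simp add: power2_eq_square algebra_simps)
  show "0 \<le> catalan_term k" unfolding c using x by simp
  have u: "1 / (32 * x ^ 2) - 1 / (32 * (x + 1) ^ 2) = 8 * (2 * x + 1) / (256 * x ^ 2 * (x + 1) ^ 2)"
    using x by (simp add: field_simps) (simp add: eval_nat_numeral algebra_simps)
  have "256 * x ^ 2 * (x + 1) ^ 2 \<le> (4 * x + 1) ^ 2 * (4 * x + 3) ^ 2"
  proof -
    have "16 * x * (x + 1) \<le> (4 * x + 1) * (4 * x + 3)" using x by (simp add: algebra_simps)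
    then have "(16 * x * (x + 1)) ^ 2 \<le> ((4 * x + 1) * (4 * x + 3)) ^ 2" using x by (intro power_mono) auto
    then show ?thesis by (simp add: power_mult_distrib)
  qed
  then show "catalan_term k \<le> 1 / (32 * real k ^ 2) - 1 / (32 * real (Suc k) ^ 2)"
    unfolding c sx x_def[symmetric] u using x by (intro divide_left_mono) auto
  have posv: "32 * x ^ 2 + 6 > 0" "32 * (x + 1) ^ 2 + 6 > 0" by (auto intro: add_nonneg_pos)
  have v: "1 / (32 * x ^ 2 + 6) - 1 / (32 * (x + 1) ^ 2 + 6) = 8 * (2 * x + 1) / ((32 * x ^ 2 + 6) * (32 * (x + 1) ^ 2 + 6) / 4)"
    using posv by (simp add: field_simps) (simp add: eval_nat_numeral algebra_simps)
  have "(4 * x + 1) ^ 2 * (4 * x + 3) ^ 2 \<le> (32 * x ^ 2 + 6) * (32 * (x + 1) ^ 2 + 6) / 4"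
    using x by (simp add: power2_eq_square algebra_simps)
  moreover have "0 < (4 * x + 1) ^ 2 * (4 * x + 3) ^ 2" using x by simp
  ultimately show "1 / (32 * real k ^ 2 + 6) - 1 / (32 * real (Suc k) ^ 2 + 6) \<le> catalan_term k"
    unfolding c sx x_def[symmetric] v using x posv by (intro divide_left_mono) simp_all
qed

definition catalan :: real where "catalan = (\<Sum>k. catalan_term k)"

text \<open>The two telescoping bounds for the tail differ only by O(K^(-4)), so a handful of terms
  determines the constant to seven digits.\<close>

lemma catalan_bounds:
  assumes K: "K \<ge> 1"
  shows "summable catalan_term"
    and "catalan \<le> (\<Sum>k<K. catalan_term k) + 1 / (32 * real K ^ 2)"
    and "(\<Sum>k<K. catalan_term k) + 1 / (32 * real K ^ 2 + 6) \<le> catalan"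
proof -
  have tele: "(\<lambda>k. h (k + K) - h (Suc (k + K))) sums (h K - 0)" if "h \<longlonglongrightarrow> 0" for h :: "nat \<Rightarrow> real"
  proof -
    have "(\<lambda>k. h (k + K)) \<longlonglongrightarrow> 0" using that by (rule LIMSEQ_ignore_initial_segment)
    from telescope_sums'[OF this] show ?thesis by simp
  qed
  have U: "(\<lambda>k. 1 / (32 * real (k + K) ^ 2) - 1 / (32 * real (Suc (k + K)) ^ 2)) sums (1 / (32 * real K ^ 2) - 0)"
    by (rule tele) real_asymp
  have V: "(\<lambda>k. 1 / (32 * real (k + K) ^ 2 + 6) - 1 / (32 * real (Suc (k + K)) ^ 2 + 6)) sums (1 / (32 * real K ^ 2 + 6) - 0)"
    by (rule tele) real_asymp
  have b: "catalan_term (k + K) \<le> 1 / (32 * real (k + K) ^ 2) - 1 / (32 * real (Suc (k + K)) ^ 2)"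
     "1 / (32 * real (k + K) ^ 2 + 6) - 1 / (32 * real (Suc (k + K)) ^ 2 + 6) \<le> catalan_term (k + K)" "0 \<le> catalan_term (k + K)" for k
    using K by (intro catalan_term_bounds; simp)+
  have sm': "summable (\<lambda>k. catalan_term (k + K))"
    by (rule summable_comparison_test'[OF sums_summable[OF U], of 0]) (use b in auto)
  then show sm: "summable catalan_term" by (simp add: summable_iff_shift)
  have "catalan = (\<Sum>k. catalan_term (k + K)) + (\<Sum>k<K. catalan_term k)"
    unfolding catalan_def by (rule suminf_split_initial_segment[OF sm])
  moreover have "(\<Sum>k. catalan_term (k + K)) \<le> 1 / (32 * real K ^ 2)"
    using suminf_le[OF b(1) sm' sums_summable[OF U]] U by (simp add: sums_iff)
  moreover have "1 / (32 * real K ^ 2 + 6) \<le> (\<Sum>k. catalan_term (k + K))"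
    using suminf_le[OF b(2) sums_summable[OF V] sm'] V by (simp add: sums_iff)
  ultimately show "catalan \<le> (\<Sum>k<K. catalan_term k) + 1 / (32 * real K ^ 2)"
    "(\<Sum>k<K. catalan_term k) + 1 / (32 * real K ^ 2 + 6) \<le> catalan" by linarith+
qed

lemma L_chi4_2: "L_chi4 2 = of_real catalan"
proof -
  have p2: "real n powr (-2) = 1 / real n ^ 2" if "n > 0" for n
    using that by (simp add: powr_minus_divide)
  have "lterm k 2 = of_real (catalan_term k)" for k
    using npow_of_real[of "4 * k + 1" 2] npow_of_real[of "4 * k + 3" 2] p2[of "4 * k + 1"] p2[of "4 * k + 3"]
    by (simp add: lterm_def catalan_term_def)
  then have "L_chi4 2 = (\<Sum>k. of_real (catalan_term k))" unfolding L_chi4_def by simp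
  also have "\<dots> = of_real catalan"
    unfolding catalan_def by (rule suminf_of_real[symmetric]) (rule catalan_bounds(1)[of 1], simp)
  finally show ?thesis .
qed

text \<open>Accelerates convergence: a product over p^(-2) cut at N has an error of order 1/N, one
  over p^(-4) an error of order N^(-3). At inert primes the comparison is (1 - z)(1 - z^2) = (1 +
  z)(1 - z)^2 with z = p^(-2); split primes agree, and the prime 2 leaves the factor 3/4.\<close>

lemma inert_const_1_squared: "(inert_const 1)\<^sup>2 = inert_const 2 * catalan * 8 / pi\<^sup>2"
proof -
  define PN where "PN N = {p. prime p \<and> p \<le> N}" for N :: nat
  have fin: "finite (PN N)" for N by (rule finite_subset[of _ "{..N}"]) (auto simp: PN_def)
  have s: "Re 2 > 1" by simp
  have z: "(\<Sum>n. npow n 2) = of_real (pi\<^sup>2 / 6)"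
  proof -
    have "(\<lambda>n. complex_of_real (1 / (real n + 1)\<^sup>2)) sums of_real (pi\<^sup>2 / 6)"
      using inverse_squares_sums by (intro sums_of_real) (simp add: add.commute)
    also have "(\<lambda>n. complex_of_real (1 / (real n + 1)\<^sup>2)) = (\<lambda>n. npow (Suc n) 2)"
    proof
      fix n show "complex_of_real (1 / (real n + 1)\<^sup>2) = npow (Suc n) 2"
        using npow_of_real[of "Suc n" 2] by (simp add: powr_minus_divide add.commute)
    qed
    finally have "(\<lambda>n. npow n 2) sums (of_real (pi\<^sup>2 / 6) + npow 0 2)" by (subst (asm) sums_Suc_iff) simp
    then show ?thesis by (simp add: sums_iff)
  qed
  define a where "a N = (\<Prod>p\<in>PN N. 1 - npow p 2)" for N
  define b where "b N = (\<Prod>p\<in>PN N. 1 - of_real (chi4 p) * npow p 2)" for N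
  define P1 where "P1 N = (\<Prod>p\<in>PN N. if p mod 4 = 3 then 1 - npow p (2 * 1) else 1)" for N
  define P2 where "P2 N = (\<Prod>p\<in>PN N. if p mod 4 = 3 then 1 - npow p (2 * 2) else 1)" for N
  have Z: "(\<lambda>N. of_real (pi\<^sup>2 / 6) * a N) \<longlonglongrightarrow> 1"
    unfolding PN_def a_def z[symmetric] using summable_npow[OF s, of "\<lambda>_. 1"]
    by (intro euler_product completely_multiplicative_npow) simp
  have L: "(\<lambda>N. of_real catalan * b N) \<longlonglongrightarrow> 1"
    unfolding PN_def b_def L_chi4_2[symmetric] L_chi4_eq[OF s]
    by (intro euler_product completely_multiplicative_twist summable_npow[OF s chi4_le_1] chi4_mult) (simp add: chi4_def)
  have P: "P1 \<longlonglongrightarrow> of_real (inert_const 1)" "P2 \<longlonglongrightarrow> of_real (inert_const 2)"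
  proof -
    have "of_real (inert_const 1) = inert_prod 1" "of_real (inert_const 2) = inert_prod 2"
      using inert_const_product(2)[of 1] inert_const_product(2)[of 2] by simp_all
    then show "P1 \<longlonglongrightarrow> of_real (inert_const 1)" "P2 \<longlonglongrightarrow> of_real (inert_const 2)"
      unfolding P1_def[abs_def] P2_def[abs_def] PN_def
      by (simp_all only:) (intro inert_prod_product summable_pterm; simp)+
  qed
  have eq: "a N * P2 N = of_real (3/4) * (b N * (P1 N)\<^sup>2)" if "N \<ge> 2" for N
  proof -
    have fac: "(1 - npow p 2) * (if p mod 4 = 3 then 1 - npow p (2 * 2) else 1) =
       (if p = 2 then of_real (3/4) else 1) * ((1 - of_real (chi4 p) * npow p 2) * (if p mod 4 = 3 then 1 - npow p (2 * 1) else 1)\<^sup>2)"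
      if p: "prime p" for p
    proof -
      have sq: "npow p 4 = npow p 2 * npow p 2" using npow_add[of p 2 2] by simp
      from p show ?thesis
      proof (cases rule: prime_mod_4_cases)
        case 1
        have "npow 2 2 = of_real (1/4)" using npow_of_real[of 2 2] by (simp add: powr_minus_divide)
        then show ?thesis using 1 by (simp add: chi4_def)
      next
        case 2
        then have "chi4 p = 1" by (simp add: chi4_def)
        then show ?thesis using 2 by simp
      next
        case 3
        then have "chi4 p = -1" by (simp add: chi4_def)
        then show ?thesis using 3 by (simp add: sq power2_eq_square ring_distribs)
      qed
    qed
    have "a N * P2 N = (\<Prod>p\<in>PN N. (if p = 2 then of_real (3/4) else 1) * ((1 - of_real (chi4 p) * npow p 2) * (if p mod 4 = 3 then 1 - npow p (2 * 1) else 1)\<^sup>2))"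
      unfolding a_def P2_def prod.distrib[symmetric] by (intro prod.cong refl fac) (simp add: PN_def)
    also have "\<dots> = (\<Prod>p\<in>PN N. if p = 2 then of_real (3/4) else 1) * (b N * (P1 N)\<^sup>2)"
      unfolding prod.distrib b_def P1_def by (simp add: prod_power_distrib)
    also have "(\<Prod>p\<in>PN N. if p = 2 then complex_of_real (3/4) else 1) = of_real (3/4)"
      using that fin[of N] by (subst prod.delta) (auto simp: PN_def)
    finally show ?thesis .
  qed
  have "(\<lambda>N. of_real catalan * of_real (pi\<^sup>2 / 6) * (a N * P2 N)) \<longlonglongrightarrow> of_real catalan * (1 * of_real (inert_const 2))"
    using tendsto_mult[OF tendsto_const tendsto_mult[OF Z P(2)], of "of_real catalan"] by (simp add: mult.assoc)
  moreover have "(\<lambda>N. of_real (pi\<^sup>2 / 6) * of_real (3/4) * ((of_real catalan * b N) * (P1 N)\<^sup>2)) \<longlonglongrightarrow>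
      of_real (pi\<^sup>2 / 6) * of_real (3/4) * (1 * (of_real (inert_const 1))\<^sup>2)"
    by (intro tendsto_intros L P)
  moreover have "eventually (\<lambda>N. of_real catalan * of_real (pi\<^sup>2 / 6) * (a N * P2 N) = of_real (pi\<^sup>2 / 6) * of_real (3/4) * ((of_real catalan * b N) * (P1 N)\<^sup>2)) sequentially"
    using eventually_ge_at_top[of 2]
  proof eventually_elim
    case (elim N)
    show ?case unfolding eq[OF elim] by (simp only: mult_ac)
  qed
  ultimately have "of_real catalan * (1 * of_real (inert_const 2)) = of_real (pi\<^sup>2 / 6) * of_real (3/4) * (1 * (complex_of_real (inert_const 1))\<^sup>2)"
    using tendsto_cong LIMSEQ_unique by fast
  then have "complex_of_real (catalan * inert_const 2) = of_real (pi\<^sup>2 / 6 * (3/4) * (inert_const 1)\<^sup>2)" by simp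
  then have "catalan * inert_const 2 = pi\<^sup>2 / 6 * (3/4) * (inert_const 1)\<^sup>2" by (simp only: of_real_eq_iff)
  then show ?thesis by (simp add: field_simps)
qed

text \<open>Each term is compared with the integral of y^(-4) over the unit interval to its left,
  which telescopes.\<close>

lemma sum_inverse_fourth_le:
  assumes "N \<ge> 1" "N \<le> M"
  shows "(\<Sum>n\<in>{N<..M}. 1 / real n ^ 4) \<le> 1 / (3 * real N ^ 3) - 1 / (3 * real M ^ 3)"
  using assms(2)
proof (induction M rule: dec_induct)
  case (step M)
  define x where "x = real M"
  have x: "x \<ge> 1" using step assms by (simp add: x_def)
  have "{N<..Suc M} = insert (Suc M) {N<..M}" using step by auto
  then have "(\<Sum>n\<in>{N<..Suc M}. 1 / real n ^ 4) = 1 / (x + 1) ^ 4 + (\<Sum>n\<in>{N<..M}. 1 / real n ^ 4)"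
    by (simp add: x_def add.commute)
  also have "\<dots> \<le> 1 / (x + 1) ^ 4 + (1 / (3 * real N ^ 3) - 1 / (3 * x ^ 3))" using step unfolding x_def by simp
  also have "1 / (x + 1) ^ 4 \<le> 1 / (3 * x ^ 3) - 1 / (3 * (x + 1) ^ 3)"
  proof -
    have "1 / (3 * x ^ 3) - 1 / (3 * (x + 1) ^ 3) = (3 * x ^ 2 + 3 * x + 1) / (3 * x ^ 3 * (x + 1) ^ 3)"
      using x by (simp add: field_simps) (simp add: power2_eq_square power3_eq_cube algebra_simps)
    also have "\<dots> \<ge> 1 / (x + 1) ^ 4"
    proof -
      have "3 * x ^ 3 \<le> (3 * x ^ 2 + 3 * x + 1) * (x + 1)"
        using x by (simp add: power2_eq_square power3_eq_cube algebra_simps)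
      then have "(3 * x ^ 3) * (x + 1) ^ 3 \<le> ((3 * x ^ 2 + 3 * x + 1) * (x + 1)) * (x + 1) ^ 3"
        using x by (intro mult_right_mono) auto
      then show ?thesis using x by (simp add: divide_le_eq le_divide_eq power4_eq_xxxx power3_eq_cube mult_ac)
    qed
    finally show ?thesis by simp
  qed
  finally show ?case by (simp add: x_def add.commute)
qed simp

text \<open>All factors are at most 1, so truncation gives an upper bound. The tail is bounded below
  by Weierstrass' inequality applied to all integers beyond N.\<close>

lemma inert_const_2_bounds:
  fixes N :: nat
  assumes N: "N \<ge> 1"
  defines "Q \<equiv> (\<Prod>p\<le>N. if prime p \<and> p mod 4 = 3 then 1 - 1 / real p ^ 4 else 1)"
  shows "inert_const 2 \<le> Q" and "Q * (1 - 1 / (3 * real N ^ 3)) \<le> inert_const 2"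
proof -
  define f where "f p = (if prime p \<and> p mod 4 = 3 then 1 - 1 / real p ^ 4 else 1)" for p :: nat
  have f01: "0 \<le> f p" "f p \<le> 1" for p
    by (auto simp: f_def divide_le_eq prime_gt_0_nat power_le_one_iff)
  have lim: "(\<lambda>M. \<Prod>p\<le>M. f p) \<longlonglongrightarrow> inert_const 2"
  proof -
    have "(\<Prod>p\<le>M. f p) = (\<Prod>p | prime p \<and> p \<le> M. if p mod 4 = 3 then 1 - 1 / real p ^ (2 * 2) else 1)" for M
      unfolding f_def by (rule prod.mono_neutral_cong_right) auto
    then show ?thesis using inert_const_product(1)[of 2] by simp
  qed
  have Q: "Q = (\<Prod>p\<le>N. f p)" by (simp add: Q_def f_def)
  have Q0: "Q \<ge> 0" unfolding Q using f01 by (intro prod_nonneg) auto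
  have sp: "(\<Prod>p\<le>M. f p) = Q * (\<Prod>p\<in>{N<..M}. f p)" if "M \<ge> N" for M
  proof -
    have "{..M} = {..N} \<union> {N<..M}" using that by auto
    then have "(\<Prod>p\<le>M. f p) = (\<Prod>p\<in>{..N} \<union> {N<..M}. f p)" by simp
    also have "\<dots> = Q * (\<Prod>p\<in>{N<..M}. f p)" unfolding Q by (rule prod.union_disjoint) auto
    finally show ?thesis .
  qed
  show "inert_const 2 \<le> Q"
  proof (rule LIMSEQ_le_const2[OF lim], intro exI allI impI)
    fix M assume M: "N \<le> M"
    have "(\<Prod>p\<in>{N<..M}. f p) \<le> 1" using f01 by (intro prod_le_1) auto
    then show "(\<Prod>p\<le>M. f p) \<le> Q" unfolding sp[OF M] using Q0 by (simp add: mult_left_le)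
  qed
  show "Q * (1 - 1 / (3 * real N ^ 3)) \<le> inert_const 2"
  proof (rule LIMSEQ_le_const[OF lim], intro exI allI impI)
    fix M assume M: "N \<le> M"
    have "1 - 1 / (3 * real N ^ 3) \<le> 1 - (\<Sum>n\<in>{N<..M}. 1 / real n ^ 4)"
    proof -
      have "0 \<le> 1 / (3 * real M ^ 3)" by simp
      then show ?thesis using sum_inverse_fourth_le[OF N M] by linarith
    qed
    also have "\<dots> \<le> (\<Prod>n\<in>{N<..M}. 1 - 1 / real n ^ 4)"
      by (rule one_minus_sum_le_prod) (auto simp: divide_le_eq)
    also have "\<dots> \<le> (\<Prod>p\<in>{N<..M}. f p)"
      by (rule prod_mono) (auto simp: f_def divide_le_eq)
    finally show "Q * (1 - 1 / (3 * real N ^ 3)) \<le> (\<Prod>p\<le>M. f p)"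
      unfolding sp[OF M] using Q0 by (rule mult_left_mono)
  qed
qed

lemma catalan_numeric: "catalan \<in> {0.9159654..0.9159658}"
proof -
  \<comment> \<open>With K = 15 the bounds of \<open>catalan_bounds\<close> leave a gap 1/7200 -
    1/7206 of about 1.2e-7.\<close>
  have s: "(\<Sum>k<15. catalan_term k) = (\<Sum>k\<leftarrow>[0..<15]. catalan_term k)"
    by (simp only: sum_list_distinct_conv_sum_set distinct_upt set_upt atLeast0LessThan)
  have u: "[0..<15] = [0, 1, 2, 3, 4, 5, 6, 7, 8, 9, 10, 11, 12, 13, 14]" by (simp add: upt_conv_Cons)
  have "(\<Sum>k<15. catalan_term k) \<le> 0.9158269" "0.9158267 \<le> (\<Sum>k<15. catalan_term k)"
    unfolding s u by (simp_all add: catalan_term_def)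
  then show ?thesis
    using catalan_bounds(2,3)[of 15] by (simp add: field_simps)
qed

lemma inert_const_2_numeric: "inert_const 2 \<in> {0.987162..0.987163}"
proof -
  \<comment> \<open>At N = 83 the relative tail 1 / (3 * 83^3) is below 6e-7. The candidates up to
    83 are the numbers 4 q + 3 with q \<le> 20.\<close>
  define Q :: real where "Q = (\<Prod>p\<le>83. if prime p \<and> p mod 4 = 3 then 1 - 1 / real p ^ 4 else 1)"
  let ?g = "\<lambda>p. if prime p then 1 - 1 / real p ^ 4 else 1"
  have "Q = (\<Prod>p\<in>(\<lambda>q. 4 * q + 3) ` {..20}. ?g p)"
    unfolding Q_def
  proof (rule prod.mono_neutral_cong_right)
    show "\<forall>p\<in>{..83} - (\<lambda>q. 4 * q + 3) ` {..20}. (if prime p \<and> p mod 4 = 3 then 1 - 1 / real p ^ 4 else 1) = 1"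
    proof
      fix p :: nat assume p: "p \<in> {..83} - (\<lambda>q. 4 * q + 3) ` {..20}"
      have "p mod 4 \<noteq> 3"
      proof
        assume "p mod 4 = 3"
        then have "p = 4 * (p div 4) + 3" by presburger
        moreover have "p div 4 \<le> 83 div 4" using p by (intro div_le_mono) simp
        then have "p div 4 \<in> {..20}" by simp
        ultimately show False using p by blast
      qed
      then show "(if prime p \<and> p mod 4 = 3 then 1 - 1 / real p ^ 4 else 1) = 1" by simp
    qed
    show "(if prime p \<and> p mod 4 = 3 then 1 - 1 / real p ^ 4 else 1) = ?g p" if "p \<in> (\<lambda>q. 4 * q + 3) ` {..20}" for p
    proof -
      have "p mod 4 = 3" using that by auto
      then show ?thesis by simp
    qed
  qed auto
  also have "\<dots> = (\<Prod>q\<in>{..20}. ?g (4 * q + 3))"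
    by (subst prod.reindex) (auto simp: inj_on_def)
  also have "{..20::nat} = set [0,1,2,3,4,5,6,7,8,9,10,11,12,13,14,15,16,17,18,19,20]"
    by (simp add: atMost_nat_numeral atMost_Suc insert_commute)
  also have "(\<Prod>q\<in>set [0,1,2,3,4,5,6,7,8,9,10,11,12,13,14,15,16,17,18,19,20]. ?g (4 * q + 3)) =
     (1 - 1 / 3 ^ 4) * (1 - 1 / 7 ^ 4) * (1 - 1 / 11 ^ 4) * (1 - 1 / 19 ^ 4) * (1 - 1 / 23 ^ 4) * (1 - 1 / 31 ^ 4) *
     (1 - 1 / 43 ^ 4) * (1 - 1 / 47 ^ 4) * (1 - 1 / 59 ^ 4) * (1 - 1 / 67 ^ 4) * (1 - 1 / 71 ^ 4) * (1 - 1 / 79 ^ 4) * (1 - 1 / 83 ^ 4)"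
    by (subst prod.distinct_set_conv_list) simp_all
  finally have Q: "Q = (1 - 1 / 3 ^ 4) * (1 - 1 / 7 ^ 4) * (1 - 1 / 11 ^ 4) * (1 - 1 / 19 ^ 4) * (1 - 1 / 23 ^ 4) * (1 - 1 / 31 ^ 4) *
     (1 - 1 / 43 ^ 4) * (1 - 1 / 47 ^ 4) * (1 - 1 / 59 ^ 4) * (1 - 1 / 67 ^ 4) * (1 - 1 / 71 ^ 4) * (1 - 1 / 79 ^ 4) * (1 - 1 / 83 ^ 4)" .
  have "0.987162 \<le> Q * (1 - 1 / (3 * real 83 ^ 3))" "Q \<le> 0.987163" unfolding Q by simp_all
  then show ?thesis using inert_const_2_bounds[of 83] unfolding Q_def[symmetric] by simp
qed

text \<open>The fourth power of \<open>C\<^sub>3\<close> is rational in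
  \<open>inert_const 2\<close>, \<open>catalan\<close> and pi^2, so no root has to be approximated.
  The interval from 0.4906936 to 0.4906944 lies inside the required one.\<close>

theorem C3_numeric: "\<bar>C\<^sub>3 - 0.490694\<bar> < 5 / 10 ^ 7"
proof -
  have "C\<^sub>3 ^ 4 = (3 / (4 * sqrt 2)) ^ 4 * (sqrt (inert_const 1)) ^ 4" by (simp only: C3_eq power_mult_distrib)
  also have "(sqrt (inert_const 1)) ^ 4 = (inert_const 1)\<^sup>2" using inert_const_pos by (simp add: power4_eq_xxxx power2_eq_square)
  also have "(3 / (4 * sqrt 2)) ^ 4 = 81 / 1024" by (simp add: power4_eq_xxxx)
  finally have C4: "C\<^sub>3 ^ 4 = 81 / 1024 * (inert_const 1)\<^sup>2" .
  have C: "C\<^sub>3 ^ 4 = 81 / 128 * (inert_const 2 * catalan) / pi\<^sup>2" unfolding C4 inert_const_1_squared by simp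
  have A: "0.987162 \<le> inert_const 2" "inert_const 2 \<le> 0.987163" and G: "0.9159654 \<le> catalan" "catalan \<le> 0.9159658"
    using inert_const_2_numeric catalan_numeric by auto
  have AG: "0.987162 * 0.9159654 \<le> inert_const 2 * catalan" "inert_const 2 * catalan \<le> 0.987163 * 0.9159658"
    using A G by (intro mult_mono; simp)+
  have P: "3.14159265^2 \<le> pi\<^sup>2" "pi\<^sup>2 \<le> 3.14159266^2"
    using pi_approx by (intro power_mono; simp)+
  have P0: "pi\<^sup>2 > 0" by simp
  have "0.4906936 ^ 4 < C\<^sub>3 ^ 4"
  proof -
    have "0.4906936 ^ 4 * pi\<^sup>2 \<le> 0.4906936 ^ 4 * 3.14159266^2" using P(2) by (rule mult_left_mono) simp
    also have "\<dots> < 81 / 128 * (0.987162 * 0.9159654)" by (simp add: power_divide)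
    also have "\<dots> \<le> 81 / 128 * (inert_const 2 * catalan)" using AG(1) by (rule mult_left_mono) simp
    finally show ?thesis unfolding C using P0 by (simp only: pos_less_divide_eq)
  qed
  moreover have "C\<^sub>3 ^ 4 < 0.4906944 ^ 4"
  proof -
    have "81 / 128 * (inert_const 2 * catalan) \<le> 81 / 128 * (0.987163 * 0.9159658)" using AG(2) by (rule mult_left_mono) simp
    also have "\<dots> < 0.4906944 ^ 4 * 3.14159265^2" by (simp add: power_divide)
    also have "\<dots> \<le> 0.4906944 ^ 4 * pi\<^sup>2" using P(1) by (rule mult_left_mono) simp
    finally show ?thesis unfolding C using P0 by (simp only: pos_divide_less_eq)
  qed
  moreover have "C\<^sub>3 \<ge> 0" unfolding C3_eq using inert_const_pos by simp
  ultimately have "0.4906936 < C\<^sub>3" "C\<^sub>3 < 0.4906944"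
    by (auto dest: power_less_imp_less_base)
  then show ?thesis unfolding abs_less_iff by (simp add: field_simps)
qed

section \<open>The counting function\<close>

lemma split_number_odd:
  assumes "split_number n"
  shows "odd n"
proof
  assume "even n"
  then have "2 mod 4 = (1::nat)" using assms two_is_prime_nat unfolding split_number_def by blast
  then show False by simp
qed

lemma not_least_primary_factor_iff:
  assumes "n > 0"
  shows "\<not> is_least_primary_factor (mult_group_mod n) 2 \<longleftrightarrow> split_number n \<or> (\<exists>m. n = 2 * m \<and> split_number m)"
proof -
  have "\<not> (4 dvd n \<or> (\<exists>p. prime p \<and> p dvd n \<and> p mod 4 = 3)) \<longleftrightarrow> split_number n \<or> (\<exists>m. n = 2 * m \<and> split_number m)"
  proof
    assume *: "\<not> (4 dvd n \<or> (\<exists>p. prime p \<and> p dvd n \<and> p mod 4 = 3))"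
    have split: "split_number m" if m: "m dvd n" "odd m" "m > 0" for m
      unfolding split_number_def
    proof (intro conjI allI impI)
      fix p assume p: "prime p" "p dvd m"
      have "odd p" using m(2) p(2) by (meson dvd_trans)
      moreover have "p mod 4 \<noteq> 3" using * p m(1) by (meson dvd_trans)
      ultimately show "p mod 4 = 1" by presburger
    qed (rule m(3))
    show "split_number n \<or> (\<exists>m. n = 2 * m \<and> split_number m)"
    proof (cases "even n")
      case True
      then obtain m where m: "n = 2 * m" by auto
      moreover have "odd m"
      proof
        assume "even m"
        then have "4 dvd n" using m by auto
        then show False using * by blast
      qed
      ultimately show ?thesis using split[of m] assms by auto
    qed (use split[of n] assms in simp)
  next
    assume "split_number n \<or> (\<exists>m. n = 2 * m \<and> split_number m)"
    then obtain m where m: "split_number m" "n = m \<or> n = 2 * m" by blast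
    have "odd m" by (rule split_number_odd[OF m(1)])
    then have "\<not> 4 dvd n" using m(2) by presburger
    moreover have "p mod 4 \<noteq> 3" if p: "prime p" "p dvd n" for p
    proof -
      have "p dvd 2 * m" using p(2) m(2) by auto
      then have "p dvd 2 \<or> p dvd m" using p(1) by (simp add: prime_dvd_mult_iff)
      then show ?thesis
      proof
        assume "p dvd 2"
        then have "p = 2" by (rule primes_dvd_imp_eq[OF p(1) two_is_prime_nat])
        then show ?thesis by simp
      next
        assume "p dvd m"
        then show ?thesis using m(1) p(1) by (auto simp: split_number_def)
      qed
    qed
    ultimately show "\<not> (4 dvd n \<or> (\<exists>p. prime p \<and> p dvd n \<and> p mod 4 = 3))" by blast
  qed
  then show ?thesis using least_primary_factor_mult_group_mod_iff[OF assms] by simp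
qed

lemma split_count_card: "split_count x = real (card {n \<in> naturals_upto x. split_number n})"
proof -
  have "split_count x = (\<Sum>n\<in>naturals_upto x. if split_number n then 1 else 0)"
    unfolding split_count_def by (intro sum.cong) (auto simp: split_ind_def)
  also have "\<dots> = real (card {n \<in> naturals_upto x. split_number n})"
    by (subst sum.If_cases) (auto simp: Int_def)
  finally show ?thesis .
qed

text \<open>Split numbers are odd, so the split numbers and their doubles are disjoint; doubles up
  to x correspond to split numbers up to x/2.\<close>

lemma card_not_least_primary_factor:
  "real (card {n::nat. 1 \<le> n \<and> real n \<le> x \<and> \<not> is_least_primary_factor (mult_group_mod n) 2}) = split_count x + split_count (x / 2)"
proof -
  let ?A = "{n \<in> naturals_upto x. split_number n}" and ?B = "{n \<in> naturals_upto (x / 2). split_number n}"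
  have "{n::nat. 1 \<le> n \<and> real n \<le> x \<and> \<not> is_least_primary_factor (mult_group_mod n) 2} = ?A \<union> (\<lambda>m. 2 * m) ` ?B"
  proof (rule Set.set_eqI)
    fix n :: nat
    show "n \<in> {n::nat. 1 \<le> n \<and> real n \<le> x \<and> \<not> is_least_primary_factor (mult_group_mod n) 2} \<longleftrightarrow> n \<in> ?A \<union> (\<lambda>m. 2 * m) ` ?B"
    proof (cases "n > 0")
      case True
      then show ?thesis using not_least_primary_factor_iff[OF True] by (auto simp: naturals_upto_def image_iff)
    qed (auto simp: naturals_upto_def)
  qed
  moreover have "card (?A \<union> (\<lambda>m. 2 * m) ` ?B) = card ?A + card ?B"
  proof -
    have "?A \<inter> (\<lambda>m. 2 * m) ` ?B = {}" using split_number_odd by fastforce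
    then have "card (?A \<union> (\<lambda>m. 2 * m) ` ?B) = card ?A + card ((\<lambda>m. 2 * m) ` ?B)"
      by (intro card_Un_disjoint) auto
    also have "card ((\<lambda>m. 2 * m) ` ?B) = card ?B" by (rule card_image) (auto simp: inj_on_def)
    finally show ?thesis .
  qed
  ultimately show ?thesis by (simp add: split_count_card)
qed

theorem theorem1p1:
  shows "(\<lambda>x::real. real (card {n::nat. 1 \<le> n \<and> real n \<le> x \<and>
              \<not> is_least_primary_factor (mult_group_mod n) 2})
            - C\<^sub>3 * (x / (ln x) powr (1 / 2)))
          \<in> O[at_top](\<lambda>x. x / (ln x) powr (2 / 3))
         \<and> \<bar>C\<^sub>3 - 0.490694\<bar> < 5 / 10 ^ 7"
proof
  obtain a where a: "a > 0" "a\<^sup>2 = Re (cleared_square 1)"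
    and S: "(\<lambda>x. split_count x - a / sqrt pi * x / sqrt (ln x)) \<in> O(\<lambda>x. x / ln x powr (3/4))"
    using split_count_asymptotic by blast
  define k where "k = a / sqrt pi"
  have k: "k > 0" using a by (simp add: k_def)
  \<comment> \<open>The counts up to x and x/2 contribute k and k/2. From a^2 = (pi/8)
    \<open>inert_const 1\<close> follows k^2 = \<open>inert_const 1\<close> / 8.\<close>
  have C3: "C\<^sub>3 = 3 / 2 * k"
  proof -
    have "k\<^sup>2 = inert_const 1 / 8" using a by (simp add: k_def power_divide Re_cleared_square_1)
    then have "k = sqrt (inert_const 1 / 8)" using k by (intro real_sqrt_unique[symmetric]) auto
    also have "\<dots> = sqrt (inert_const 1) / (2 * sqrt 2)"
      using real_sqrt_mult[of 4 2] by (simp add: real_sqrt_divide)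
    finally show ?thesis unfolding C3_eq by simp
  qed
  have half: "filterlim (\<lambda>x::real. x / 2) at_top at_top" by real_asymp
  have S': "(\<lambda>x. split_count (x / 2) - k * (x / 2) / sqrt (ln (x / 2))) \<in> O(\<lambda>x. (x / 2) / ln (x / 2) powr (3/4))"
    using landau_o.big.compose[OF S half] unfolding k_def .
  have t: "(\<lambda>x::real. x / ln x powr (3/4)) \<in> O(\<lambda>x. x / ln x powr (2/3))"
    "(\<lambda>x::real. (x / 2) / ln (x / 2) powr (3/4)) \<in> O(\<lambda>x. x / ln x powr (2/3))" by real_asymp+
  \<comment> \<open>Replacing ln(x/2) by ln x changes the main term only by O(x / (log
    x)^(3/2)).\<close>
  have d: "(\<lambda>x. k * x / sqrt (ln x) + k * (x / 2) / sqrt (ln (x / 2)) - C\<^sub>3 * (x / ln x powr (1/2))) \<in> O(\<lambda>x. x / ln x powr (2/3))"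
    unfolding C3 using k by real_asymp
  have "(\<lambda>x. (split_count x - k * x / sqrt (ln x)) + (split_count (x / 2) - k * (x / 2) / sqrt (ln (x / 2)))
      + (k * x / sqrt (ln x) + k * (x / 2) / sqrt (ln (x / 2)) - C\<^sub>3 * (x / ln x powr (1/2)))) \<in> O(\<lambda>x. x / ln x powr (2/3))"
    by (rule sum_in_bigo(1)[OF sum_in_bigo(1)[OF landau_o.big_trans[OF S[folded k_def] t(1)] landau_o.big_trans[OF S' t(2)]] d])
  then show "(\<lambda>x::real. real (card {n::nat. 1 \<le> n \<and> real n \<le> x \<and>
              \<not> is_least_primary_factor (mult_group_mod n) 2})
            - C\<^sub>3 * (x / (ln x) powr (1 / 2)))
          \<in> O[at_top](\<lambda>x. x / (ln x) powr (2 / 3))"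
    unfolding card_not_least_primary_factor by (simp add: algebra_simps)
qed (rule C3_numeric)

end
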